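(* Let $\sigma^2>0$ and let $\mathbf{\Xi}_N$ be a (normalized) periodically banded GUE matrix of band width $b_N$, where $(b_N)$ is a sequence of nonnegative integers with $b_N\to\infty$; that is, $\mathbf{\Xi}_N(j,k)=\frac{1}{\sqrt{\xi_N}}\mathbf{1}\{|j-k|_N\le b_N\}\mathbf{X}_N(j,k)$ with $\mathbf{X}_N\sim\mathrm{GUE}(N,\sigma^2)$, $|j-k|_N=\min(|j-k|,N-|j-k|)$ and $\xi_N=\min(2b_N+1,N)$. Let $\mathrm{Cat}(\ell)=\frac{1}{\ell+1}\binom{2\ell}{\ell}$ be the $\ell$th Catalan number. Then for any $\ell\in\mathbb{N}$, $$\lim_{N\to\infty}\Big(\mathbb{E}[\mathrm{Tr}(\mathbf{\Xi}_N^{2\ell})]-N\sigma^{2\ell}\mathrm{Cat}(\ell)\Big)=\begin{cases}0&\text{if }b_N\gg\sqrt N;\\ \infty&\text{if }b_N\ll\sqrt N;\\ m_{2\ell}(\sigma^2,c)&\text{if }\lim_{N\to\infty}\frac{b_N}{\sqrt N}=c\in(0,\infty),\end{cases}$$ where $m_{2\ell}(\sigma^2,c)$ is a number depending only on $\ell,\sigma^2,c$, with $m_2(\sigma^2,c)=0$ and $m_{2\ell}(\sigma^2,c)\in(0,\infty)$ for $\ell\ge2$. In particular, if $b_N\gg\sqrt N$, then the type $B$ distribution of $\mathbf{\Xi}_N$ exists and agrees with that of a usual GUE matrix $\mathbf{W}_N\sim\mathrm{GUE}(N,\frac{\sigma^2}{N})$, namely $\big(\frac{1}{2\pi\sigma^2}\sqrt{4\sigma^2-t^2}\,dt,\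 0\big)$.
   Context: $\mathrm{GUE}(N,\sigma^2)$ is the law of a self-adjoint $N\times N$ complex Gaussian matrix, with entries on and above the diagonal independent and centered, real diagonal entries of variance $\sigma^2$, and off-diagonal entries with independent real and imaginary parts of variance $\sigma^2/2$ each. $b_N\gg\sqrt N$ means $b_N/\sqrt N\to\infty$; $b_N\ll\sqrt N$ means $b_N/\sqrt N\to0$. For a sequence of self-adjoint random $N\times N$ matrices $\mathbf{A}_N$ with entries having all moments, let $\mu_{\mathbf{A}_N}(P)=\frac1N\mathbb{E}[\mathrm{Tr}\,P(\mathbf{A}_N)]$ for $P\in\mathbb{C}[x]$. If $\mu(P)=\lim_N\mu_{\mathbf{A}_N}(P)$ and $\nu(P)=\lim_N N(\mu_{\mathbf{A}_N}(P)-\mu(P))$ exist for all $P$, the pair $(\mu,\nu)$ is the type $B$ distribution of $\mathbf{A}_N$ (identified with a probability measure and a signed measure of total mass zero with those moments when these are determined).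
   Formalization: In the case b_N ≪ √N the limit ∞ is stated only for ℓ ≥ 2; for ℓ = 1 the claim is false, since E[Tr Ξ_N²] = Nσ² exactly, and the correct limit 0 is stated instead. *)

theory Defs
  imports "HOL-Probability.Probability" "Jordan_Normal_Form.Schur_Decomposition"
begin

definition mat_trace :: "complex mat \<Rightarrow> complex" where
  "mat_trace A = (\<Sum>i<dim_row A. A $$ (i, i))"

definition poly_mat :: "complex poly \<Rightarrow> complex mat \<Rightarrow> complex mat" where
  "poly_mat P A = mat (dim_row A) (dim_col A)
     (\<lambda>(j, k). \<Sum>i\<le>degree P. coeff P i * (A ^\<^sub>m i) $$ (j, k))"

definition random_selfadjoint :: "'a measure \<Rightarrow> nat \<Rightarrow> ('a \<Rightarrow> complex mat) \<Rightarrow> bool" where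
  "random_selfadjoint M N A \<longleftrightarrow>
     prob_space M \<and>
     (\<forall>\<omega>\<in>space M. A \<omega> \<in> carrier_mat N N \<and> mat_adjoint (A \<omega>) = A \<omega>) \<and>
     (\<forall>j<N. \<forall>k<N. (\<lambda>\<omega>. A \<omega> $$ (j, k)) \<in> borel_measurable M)"

text \<open>The entry indices range over \<open>0, \<dots>, N - 1\<close>. The second argument of
  \<^const>\<open>normal_density\<close> is the standard deviation, and \<open>s2\<close> stands for \<open>\<sigma>\<^sup>2\<close>. The diagonal
  entries are real by self-adjointness.\<close>

definition is_GUE :: "'a measure \<Rightarrow> nat \<Rightarrow> real \<Rightarrow> ('a \<Rightarrow> complex mat) \<Rightarrow> bool" where
  "is_GUE M N s2 X \<longleftrightarrow>
     random_selfadjoint M N X \<and>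
     prob_space.indep_vars M (\<lambda>_. borel) (\<lambda>(j, k) \<omega>. X \<omega> $$ (j, k)) {(j, k). j \<le> k \<and> k < N} \<and>
     (\<forall>j<N. distributed M lborel (\<lambda>\<omega>. Re (X \<omega> $$ (j, j))) (normal_density 0 (sqrt s2))) \<and>
     (\<forall>j k. j < k \<and> k < N \<longrightarrow>
        prob_space.indep_var M borel (\<lambda>\<omega>. Re (X \<omega> $$ (j, k))) borel (\<lambda>\<omega>. Im (X \<omega> $$ (j, k))) \<and>
        distributed M lborel (\<lambda>\<omega>. Re (X \<omega> $$ (j, k))) (normal_density 0 (sqrt (s2 / 2))) \<and>
        distributed M lborel (\<lambda>\<omega>. Im (X \<omega> $$ (j, k))) (normal_density 0 (sqrt (s2 / 2))))"

definition cyclic_dist :: "nat \<Rightarrow> nat \<Rightarrow> nat \<Rightarrow> int" where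
  "cyclic_dist N j k = min \<bar>int j - int k\<bar> (int N - \<bar>int j - int k\<bar>)"

definition band_norm :: "nat \<Rightarrow> nat \<Rightarrow> nat" where
  "band_norm N b = min (2 * b + 1) N"

definition periodic_band :: "nat \<Rightarrow> nat \<Rightarrow> complex mat \<Rightarrow> complex mat" where
  "periodic_band N b A = mat N N (\<lambda>(j, k).
     complex_of_real (1 / sqrt (real (band_norm N b))) *
     (if cyclic_dist N j k \<le> int b then A $$ (j, k) else 0))"

definition catalan :: "nat \<Rightarrow> real" where
  "catalan l = real ((2 * l) choose l) / real (l + 1)"

definition mean_moment :: "'a measure \<Rightarrow> nat \<Rightarrow> ('a \<Rightarrow> complex mat) \<Rightarrow> complex poly \<Rightarrow> complex" where
  "mean_moment M N A P = (\<integral>\<omega>. mat_trace (poly_mat P (A \<omega>)) \<partial>M) / of_nat N"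

definition type_B_distribution ::
  "(nat \<Rightarrow> 'a measure) \<Rightarrow> (nat \<Rightarrow> 'a \<Rightarrow> complex mat) \<Rightarrow>
   (complex poly \<Rightarrow> complex) \<Rightarrow> (complex poly \<Rightarrow> complex) \<Rightarrow> bool" where
  "type_B_distribution M A \<mu> \<nu> \<longleftrightarrow>
     (\<forall>N>0. random_selfadjoint (M N) N (A N) \<and>
        (\<forall>j<N. \<forall>k<N. \<forall>p::nat. integrable (M N) (\<lambda>\<omega>. cmod (A N \<omega> $$ (j, k)) ^ p))) \<and>
     (\<forall>P. (\<lambda>N. mean_moment (M N) N (A N) P) \<longlonglongrightarrow> \<mu> P \<and>
          (\<lambda>N. of_nat N * (mean_moment (M N) N (A N) P - \<mu> P)) \<longlonglongrightarrow> \<nu> P)"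

definition compact_finite_measure :: "real measure \<Rightarrow> bool" where
  "compact_finite_measure m \<longleftrightarrow>
     sets m = sets borel \<and> finite_measure m \<and> (\<exists>R. AE t in m. \<bar>t\<bar> \<le> R)"

definition moments_of :: "real measure \<Rightarrow> complex poly \<Rightarrow> complex" where
  "moments_of m P = (\<integral>t. poly P (complex_of_real t) \<partial>m)"

text \<open>The identification of a type \<open>B\<close> distribution with a probability measure \<open>m\<close> and a signed
  measure of total mass zero, the latter given as a difference \<open>n1 - n2\<close> of finite measures.
  Compact support makes \<open>m\<close> the only probability measure, and \<open>n1 - n2\<close> the only compactly supported
  signed measure, with the given moments.\<close>

definition type_B_law ::
  "(nat \<Rightarrow> 'a measure) \<Rightarrow> (nat \<Rightarrow> 'a \<Rightarrow> complex mat) \<Rightarrow>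
   real measure \<Rightarrow> real measure \<times> real measure \<Rightarrow> bool" where
  "type_B_law M A m = (\<lambda>(n1, n2).
     prob_space m \<and> compact_finite_measure m \<and>
     compact_finite_measure n1 \<and> compact_finite_measure n2 \<and>
     measure n1 UNIV = measure n2 UNIV \<and>
     type_B_distribution M A (moments_of m) (\<lambda>P. moments_of n1 P - moments_of n2 P))"

definition semicircle :: "real \<Rightarrow> real measure" where
  "semicircle s2 = density lborel (\<lambda>t. ennreal
     (indicator {- 2 * sqrt s2..2 * sqrt s2} t * (sqrt (4 * s2 - t\<^sup>2) / (2 * pi * s2))))"

abbreviation zero_signed :: "real measure \<times> real measure" where
  "zero_signed \<equiv> (null_measure borel, null_measure borel)"

text \<open>The quantity \<open>E[Tr A\<^sup>2\<^sup>l] - N \<sigma>\<^sup>2\<^sup>l Cat(l)\<close>; even powers of self-adjoint matrices have real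
  trace.\<close>

definition moment_defect :: "'a measure \<Rightarrow> nat \<Rightarrow> real \<Rightarrow> ('a \<Rightarrow> complex mat) \<Rightarrow> nat \<Rightarrow> real" where
  "moment_defect M N s2 A l =
     Re (\<integral>\<omega>. mat_trace (A \<omega> ^\<^sub>m (2 * l)) \<partial>M) - real N * s2 ^ l * catalan l"

end

theory Submission
  imports Defs "HOL-Combinatorics.Orbits" "HOL-Computational_Algebra.Formal_Power_Series"
    "HOL-Real_Asymp.Real_Asymp"
begin

text \<open>The mean trace is expanded by Wick's formula into a sum over pairings of the \<open>2l\<close> steps of a
  closed walk. A pairing contributes the number of closed walks, with steps inside the band, that run
  through paired steps in opposite directions. Such a walk is a function on the orbits of
  \<open>p \<mapsto> \<pi> p + 1\<close>; if there are \<open>V\<close> orbits, there are at most \<open>N \<xi>\<^sup>V\<^sup>-\<^sup>1\<close> such walks. Noncrossing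
  pairings have \<open>V = l + 1\<close> and give exactly \<open>N \<xi>\<^sup>l\<close> walks each, which accounts for the Catalan term.
  A pairing with a crossing has \<open>V \<le> l\<close>, and the signs of the permutations involved force
  \<open>V \<equiv> l + 1\<close> modulo \<open>2\<close>, so that \<open>V \<le> l - 1\<close> and the contribution is \<open>O(N / \<xi>\<^sup>2)\<close>. When \<open>b / N \<rightarrow> 0\<close>
  the walks lift to the integers, and the rescaled number of lifted walks converges by a
  superadditivity argument.\<close>

section \<open>Wick's formula\<close>

text \<open>The factor \<open>N \<xi>^(V-1)\<close> comes from a spanning tree of the glued polygon:
  one orbit is placed freely, and each further one is entered by a band step, which has exactly
  \<open>\<xi>\<close> targets even where the band wraps around. This exactness keeps every error
  out of the Catalan term, whatever the band width. The parity step decides the threshold: for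
  \<open>V = l\<close> the bound would be of order \<open>N / \<xi>\<close>, which never tends to
  \<open>0\<close>; excluding this case leaves \<open>N / \<xi>^2\<close>, whence
  \<open>sqrt N\<close>. Behind it is the evenness of the Euler characteristic of a closed
  orientable surface; signs of permutations replace the topology. At the critical scale
  \<open>N / (2 b + 1)^2\<close> tends to \<open>1 / (4 c^2)\<close>, and only the pairings with
  \<open>V = l - 1\<close>, of genus one, survive. Their limiting walk counts are volumes of
  polytopes, but since only existence and positivity of the limit are claimed, no volume is
  computed: refining the lattice gives existence, and one explicit crossing pairing a positive lower
  bound. For \<open>l = 1\<close> no crossing exists, hence the value
  \<open>m 2 = 0\<close>.\<close>

abbreviation swap :: "'a \<Rightarrow> 'a \<Rightarrow> 'a \<Rightarrow> 'a" where "swap \<equiv> Transposition.transpose"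

text \<open>A perfect matching is encoded by the fixed-point-free involution exchanging partners,
  extended by the identity, so that each matching has one code and signs and orbits of permutations
  apply to it.\<close>

definition pairings :: "'i set \<Rightarrow> ('i \<Rightarrow> 'i) set" where
  "pairings S = {\<pi>. \<pi> permutes S \<and> (\<forall>i\<in>S. \<pi> i \<noteq> i \<and> \<pi> (\<pi> i) = i)}"

lemma finite_pairings [simp]: "finite S \<Longrightarrow> finite (pairings S)"
  by (rule finite_subset[OF _ finite_permutations[of S]]) (auto simp: pairings_def)

lemma pairings_empty [simp]: "pairings {} = {id}"
  by (auto simp: pairings_def)

lemma pairingsD:
  assumes "\<pi> \<in> pairings S"
  shows "\<pi> permutes S" "\<And>i. \<pi> (\<pi> i) = i" "\<And>i. i \<in> S \<Longrightarrow> \<pi> i \<noteq> i" "\<And>i. \<pi> i \<in> S \<longleftrightarrow> i \<in> S"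
    "\<And>i. i \<notin> S \<Longrightarrow> \<pi> i = i"
proof -
  show p: "\<pi> permutes S" and "\<And>i. i \<in> S \<Longrightarrow> \<pi> i \<noteq> i" using assms by (auto simp: pairings_def)
  show n: "\<And>i. i \<notin> S \<Longrightarrow> \<pi> i = i" using p by (auto simp: permutes_def)
  show "\<pi> (\<pi> i) = i" for i using assms n by (cases "i \<in> S") (auto simp: pairings_def)
  show "\<And>i. \<pi> i \<in> S \<longleftrightarrow> i \<in> S" using permutes_in_image[OF p] .
qed

text \<open>Adds the chord between \<open>a\<close> and \<open>c\<close>; off these points nothing
  changes, because \<open>\<pi>\<close> fixes both of them. The inverse operation is
  \<open>pairings_split\<close>.\<close>

lemma pairings_join:
  assumes "a \<in> S" "c \<in> S" "a \<noteq> c" "\<pi> \<in> pairings (S - {a, c})"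
  shows "swap a c \<circ> \<pi> \<in> pairings S"
    and "(swap a c \<circ> \<pi>) i = (if i = a then c else if i = c then a else \<pi> i)"
proof -
  note d = pairingsD[OF assms(4)]
  have e: "(swap a c \<circ> \<pi>) i = (if i = a then c else if i = c then a else \<pi> i)" for i
  proof (cases "i \<in> S - {a, c}")
    case True
    then have "\<pi> i \<in> S - {a, c}" using d(4) by blast
    with True show ?thesis by (auto simp: transpose_def)
  next
    case False
    then show ?thesis using d(5)[of i] by (auto simp: transpose_def)
  qed
  show "(swap a c \<circ> \<pi>) i = (if i = a then c else if i = c then a else \<pi> i)" by (rule e)
  have "swap a c permutes S" using assms by (simp add: permutes_swap_id)
  moreover have "\<pi> permutes S" using d(1) by (rule permutes_subset) auto
  ultimately have "(swap a c \<circ> \<pi>) permutes S" by (metis permutes_compose)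
  moreover have "(swap a c \<circ> \<pi>) j \<noteq> j \<and> (swap a c \<circ> \<pi>) ((swap a c \<circ> \<pi>) j) = j" if "j \<in> S" for j
  proof (cases "j \<in> {a, c}")
    case True then show ?thesis unfolding e using assms by auto
  next
    case False
    then have "j \<in> S - {a, c}" using that by auto
    then have "\<pi> j \<in> S - {a, c}" "\<pi> j \<noteq> j" "\<pi> (\<pi> j) = j" using d by blast+
    then show ?thesis unfolding e using False by auto
  qed
  ultimately show "swap a c \<circ> \<pi> \<in> pairings S" by (auto simp: pairings_def)
qed

lemma pairings_split:
  assumes "\<pi> \<in> pairings S" "a \<in> S"
  shows "swap a (\<pi> a) \<circ> \<pi> \<in> pairings (S - {a, \<pi> a})"
    and "swap a (\<pi> a) \<circ> (swap a (\<pi> a) \<circ> \<pi>) = \<pi>"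
proof -
  note d = pairingsD[OF assms(1)]
  show "swap a (\<pi> a) \<circ> (swap a (\<pi> a) \<circ> \<pi>) = \<pi>" by (auto simp: fun_eq_iff)
  have v: "(swap a (\<pi> a) \<circ> \<pi>) i = (if i \<in> {a, \<pi> a} then i else \<pi> i)" for i
  proof -
    have "\<pi> i = a \<longleftrightarrow> i = \<pi> a" "\<pi> i = \<pi> a \<longleftrightarrow> i = a" using d(2) by metis+
    then show ?thesis by (auto simp: Transposition.transpose_def)
  qed
  have "(swap a (\<pi> a) \<circ> \<pi>) permutes S"
    using assms(2) d by (metis permutes_compose permutes_swap_id)
  then have "(swap a (\<pi> a) \<circ> \<pi>) permutes (S - {a, \<pi> a})"
    by (rule permutes_superset) (use v in auto)
  moreover have "(swap a (\<pi> a) \<circ> \<pi>) j \<noteq> j \<and> (swap a (\<pi> a) \<circ> \<pi>) ((swap a (\<pi> a) \<circ> \<pi>) j) = j"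
    if "j \<in> S - {a, \<pi> a}" for j
    unfolding v using that d(2,3) by (auto, metis+)
  ultimately show "swap a (\<pi> a) \<circ> \<pi> \<in> pairings (S - {a, \<pi> a})" by (auto simp: pairings_def)
qed

text \<open>A pairing amounts to the partner \<open>c\<close> of the chosen point \<open>a\<close>
  together with a pairing of the remaining points; joining and splitting are the mutually inverse
  maps.\<close>

lemma sum_pairings:
  assumes "finite S" "a \<in> S"
  shows "(\<Sum>\<pi>\<in>pairings S. F \<pi>) = (\<Sum>c\<in>S-{a}. \<Sum>\<pi>\<in>pairings (S-{a,c}). F (swap a c \<circ> \<pi>))"
proof -
  have "(\<Sum>c\<in>S-{a}. \<Sum>\<pi>\<in>pairings (S-{a,c}). F (swap a c \<circ> \<pi>)) =
        (\<Sum>(c,\<pi>)\<in>Sigma (S-{a}) (\<lambda>c. pairings (S-{a,c})). F (swap a c \<circ> \<pi>))"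
    using assms by (intro sum.Sigma) auto
  also have "\<dots> = (\<Sum>\<pi>\<in>pairings S. F \<pi>)"
  proof (rule sum.reindex_bij_witness[where i = "\<lambda>\<pi>. (\<pi> a, swap a (\<pi> a) \<circ> \<pi>)" and j = "\<lambda>(c,\<pi>). swap a c \<circ> \<pi>"])
    fix p assume "p \<in> Sigma (S-{a}) (\<lambda>c. pairings (S-{a,c}))"
    then obtain c \<pi> where p: "p = (c, \<pi>)" "c \<in> S" "c \<noteq> a" "\<pi> \<in> pairings (S-{a,c})" by auto
    have v: "(swap a c \<circ> \<pi>) a = c" using pairings_join(2)[of a S c \<pi> a] p assms by auto
    then have "swap a ((swap a c \<circ> \<pi>) a) \<circ> (swap a c \<circ> \<pi>) = \<pi>" by (auto simp: fun_eq_iff)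
    then show "(case p of (c, \<pi>) \<Rightarrow> swap a c \<circ> \<pi>) \<in> pairings S"
      "((case p of (c, \<pi>) \<Rightarrow> swap a c \<circ> \<pi>) a, swap a ((case p of (c, \<pi>) \<Rightarrow> swap a c \<circ> \<pi>) a) \<circ> (case p of (c, \<pi>) \<Rightarrow> swap a c \<circ> \<pi>)) = p"
      using p v pairings_join(1)[of a S c \<pi>] assms by auto
  next
    fix \<pi> assume \<pi>: "\<pi> \<in> pairings S"
    show "(case (\<pi> a, swap a (\<pi> a) \<circ> \<pi>) of (c, \<pi>) \<Rightarrow> swap a c \<circ> \<pi>) = \<pi>"
      using pairings_split(2)[OF \<pi> assms(2)] by simp
    show "(\<pi> a, swap a (\<pi> a) \<circ> \<pi>) \<in> Sigma (S-{a}) (\<lambda>c. pairings (S-{a,c}))"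
      using pairings_split(1)[OF \<pi> assms(2)] pairingsD[OF \<pi>] assms by auto
  qed auto
  finally show ?thesis ..
qed

text \<open>Unrolls a recursion that removes one pair at a time. \<open>K\<close> may be asymmetric,
  so each pair has to enter with its smaller point first.\<close>

lemma wick_pairings:
  fixes F :: "'i::linorder set \<Rightarrow> 'c::comm_ring_1"
  assumes "finite S" and F0: "F {} = 1"
    and rec: "\<And>T a. T \<subseteq> S \<Longrightarrow> a \<in> T \<Longrightarrow> F T = (\<Sum>c\<in>T-{a}. K a c * F (T-{a,c}))"
  shows "F S = (\<Sum>\<pi>\<in>pairings S. \<Prod>i\<in>{i\<in>S. i < \<pi> i}. K i (\<pi> i))"
proof -
  have "F T = (\<Sum>\<pi>\<in>pairings T. \<Prod>i\<in>{i\<in>T. i < \<pi> i}. K i (\<pi> i))" if "T \<subseteq> S" for T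
    using finite_subset[OF that assms(1)] that
  proof (induction T rule: finite_psubset_induct)
    case (psubset T)
    show ?case
    proof (cases "T = {}")
      case True then show ?thesis by (simp add: F0)
    next
      case False
      \<comment> \<open>The least element is the left end of its chord whatever its partner, so
        \<open>K a c\<close> is precisely the factor that \<open>a\<close> contributes to the
        product over left ends.\<close>
      define a where "a = Min T"
      have a: "a \<in> T" "\<And>i. i \<in> T \<Longrightarrow> a \<le> i" using False psubset by (auto simp: a_def)
      have "F T = (\<Sum>c\<in>T-{a}. K a c * F (T-{a,c}))" using rec psubset a by blast
      also have "\<dots> = (\<Sum>c\<in>T-{a}. \<Sum>\<pi>\<in>pairings (T-{a,c}). K a c * (\<Prod>i\<in>{i\<in>T-{a,c}. i < \<pi> i}. K i (\<pi> i)))"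
      proof (rule sum.cong[OF refl])
        fix c assume "c \<in> T - {a}"
        then have "F (T-{a,c}) = (\<Sum>\<pi>\<in>pairings (T-{a,c}). \<Prod>i\<in>{i\<in>T-{a,c}. i < \<pi> i}. K i (\<pi> i))"
          using a psubset.prems by (intro psubset.IH) auto
        then show "K a c * F (T-{a,c}) = (\<Sum>\<pi>\<in>pairings (T-{a,c}). K a c * (\<Prod>i\<in>{i\<in>T-{a,c}. i < \<pi> i}. K i (\<pi> i)))"
          by (simp add: sum_distrib_left)
      qed
      also have "\<dots> = (\<Sum>c\<in>T-{a}. \<Sum>\<pi>\<in>pairings (T-{a,c}). (\<Prod>i\<in>{i\<in>T. i < (swap a c \<circ> \<pi>) i}. K i ((swap a c \<circ> \<pi>) i)))"
      proof (intro sum.cong refl)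
        fix c \<pi> assume c: "c \<in> T - {a}" and \<pi>: "\<pi> \<in> pairings (T-{a,c})"
        have v: "(swap a c \<circ> \<pi>) i = (if i = a then c else if i = c then a else \<pi> i)" for i
          using pairings_join(2)[OF _ _ _ \<pi>, of i] a c by auto
        have "a < c" using a c by (auto simp: order.strict_iff_order)
        then have "{i\<in>T. i < (swap a c \<circ> \<pi>) i} = insert a {i\<in>T-{a,c}. i < \<pi> i}"
          unfolding v using a c by auto
        moreover have "(\<Prod>i\<in>insert a {i\<in>T-{a,c}. i < \<pi> i}. K i ((swap a c \<circ> \<pi>) i)) =
          K a c * (\<Prod>i\<in>{i\<in>T-{a,c}. i < \<pi> i}. K i ((swap a c \<circ> \<pi>) i))"
          using psubset.hyps by (subst prod.insert) (auto simp: v[unfolded o_apply])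
        moreover have "(\<Prod>i\<in>{i\<in>T-{a,c}. i < \<pi> i}. K i ((swap a c \<circ> \<pi>) i)) = (\<Prod>i\<in>{i\<in>T-{a,c}. i < \<pi> i}. K i (\<pi> i))"
          by (rule prod.cong) (auto simp: v[unfolded o_apply])
        ultimately show "K a c * (\<Prod>i\<in>{i\<in>T-{a,c}. i < \<pi> i}. K i (\<pi> i)) =
          (\<Prod>i\<in>{i\<in>T. i < (swap a c \<circ> \<pi>) i}. K i ((swap a c \<circ> \<pi>) i))" by simp
      qed
      also have "\<dots> = (\<Sum>\<pi>\<in>pairings T. \<Prod>i\<in>{i\<in>T. i < \<pi> i}. K i (\<pi> i))"
        using psubset.hyps a by (intro sum_pairings[symmetric]) auto
      finally show ?thesis .
    qed
  qed
  then show ?thesis by simp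
qed

text \<open>The family \<open>G a b T\<close> stands for the mean of \<open>x\<^sup>a y\<^sup>b \<Prod>(\<alpha>\<^sub>i x + \<beta>\<^sub>i y)\<close>, \<open>i\<close> ranging over \<open>T\<close>,
  for independent centered Gaussians \<open>x, y\<close> of variances \<open>v, w\<close>; a variance may be \<open>0\<close>.\<close>

lemma gaussian_functional_step:
  fixes G :: "nat \<Rightarrow> nat \<Rightarrow> 'i set \<Rightarrow> complex"
  assumes G0: "\<And>a b. G a b {} = \<mu> a * \<nu> b"
    and Gi: "\<And>a b d T. finite T \<Longrightarrow> d \<notin> T \<Longrightarrow> G a b (insert d T) = \<alpha> d * G (Suc a) b T + \<beta> d * G a (Suc b) T"
    and \<mu>: "\<And>a. \<mu> (Suc a) = v * of_nat a * \<mu> (a - 1)"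
    and "finite T"
  shows "G (Suc a) b T = v * (of_nat a * G (a - 1) b T + (\<Sum>c\<in>T. \<alpha> c * G a b (T - {c})))"
  using assms(4)
\<comment> \<open>The identity is Gaussian integration by parts. For monomials it is the moment
  recursion; a further linear factor raises one of the exponents, so both are left
  arbitrary.\<close>
proof (induction T arbitrary: a b rule: finite_induct)
  case empty then show ?case by (simp add: G0 \<mu>)
next
  case (insert d T)
  have *: "G a b (insert d T - {c}) = \<alpha> d * G (Suc a) b (T - {c}) + \<beta> d * G a (Suc b) (T - {c})" if "c \<in> T" for a b c
  proof -
    have "insert d T - {c} = insert d (T - {c})" using that insert by auto
    then show ?thesis using Gi[of "T - {c}" d a b] insert by simp
  qed
  have s: "(\<Sum>c\<in>insert d T. \<alpha> c * G a b (insert d T - {c})) =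
    \<alpha> d * G a b T + (\<alpha> d * (\<Sum>c\<in>T. \<alpha> c * G (Suc a) b (T - {c})) + \<beta> d * (\<Sum>c\<in>T. \<alpha> c * G a (Suc b) (T - {c})))"
    using insert by (simp add: * sum.distrib sum_distrib_left algebra_simps)
  have p: "of_nat a * G (a - 1) b (insert d T) = of_nat a * (\<alpha> d * G a b T + \<beta> d * G (a - 1) (Suc b) T)"
    using Gi[OF insert.hyps(1,2), of "a - 1" b] by (cases a) auto
  show ?case unfolding s p Gi[OF insert.hyps(1,2), of "Suc a" b] insert.IH[of "Suc a" b] insert.IH[of a "Suc b"] by (simp add: algebra_simps)
qed

text \<open>One linear factor is split off and its two summands are integrated by parts, the
  \<open>y\<close> part by the same lemma with the variables exchanged. With both exponents zero
  only the sum over the remaining factors is left.\<close>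

lemma gaussian_functional_wick:
  fixes G :: "nat \<Rightarrow> nat \<Rightarrow> 'i set \<Rightarrow> complex"
  assumes G0: "\<And>a b. G a b {} = \<mu> a * \<nu> b"
    and Gi: "\<And>a b d T. finite T \<Longrightarrow> d \<notin> T \<Longrightarrow> G a b (insert d T) = \<alpha> d * G (Suc a) b T + \<beta> d * G a (Suc b) T"
    and \<mu>: "\<And>a. \<mu> (Suc a) = v * of_nat a * \<mu> (a - 1)"
    and \<nu>: "\<And>b. \<nu> (Suc b) = w * of_nat b * \<nu> (b - 1)"
    and T: "finite T" "t \<in> T"
  shows "G 0 0 T = (\<Sum>c\<in>T-{t}. (v * \<alpha> t * \<alpha> c + w * \<beta> t * \<beta> c) * G 0 0 (T - {t, c}))"
proof -
  note x = gaussian_functional_step[where G = G, OF G0 Gi \<mu>]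
  note y = gaussian_functional_step[where G = "\<lambda>b a. G a b" and \<mu> = \<nu> and \<nu> = \<mu> and \<alpha> = \<beta> and \<beta> = \<alpha> and v = w]
  have y: "G a (Suc b) T = w * (of_nat b * G a (b - 1) T + (\<Sum>c\<in>T. \<beta> c * G a b (T - {c})))" if "finite T" for a b T
    by (rule y) (use G0 Gi \<nu> that in \<open>simp_all add: mult.commute add.commute\<close>)
  have "G 0 0 T = G 0 0 (insert t (T - {t}))" using T by (simp add: insert_absorb)
  also have "\<dots> = \<alpha> t * G (Suc 0) 0 (T - {t}) + \<beta> t * G 0 (Suc 0) (T - {t})" using T by (intro Gi) auto
  also have "\<dots> = (\<Sum>c\<in>T-{t}. (v * \<alpha> t * \<alpha> c + w * \<beta> t * \<beta> c) * G 0 0 (T - {t} - {c}))"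
  proof -
    have X: "G (Suc 0) 0 (T - {t}) = (\<Sum>c\<in>T-{t}. v * \<alpha> c * G 0 0 (T - {t} - {c}))"
      using x[of "T - {t}" 0 0] T(1) by (simp add: sum_distrib_left mult.assoc)
    have Y: "G 0 (Suc 0) (T - {t}) = (\<Sum>c\<in>T-{t}. w * \<beta> c * G 0 0 (T - {t} - {c}))"
      using y[of "T - {t}" 0 0] T(1) by (simp add: sum_distrib_left mult.assoc)
    show ?thesis unfolding X Y sum_distrib_left sum.distrib[symmetric]
      by (intro sum.cong refl) (simp add: algebra_simps)
  qed
  also have "\<dots> = (\<Sum>c\<in>T-{t}. (v * \<alpha> t * \<alpha> c + w * \<beta> t * \<beta> c) * G 0 0 (T - {t, c}))"
  proof -
    have "T - {t} - {c} = T - {t, c}" for c by auto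
    then show ?thesis by simp
  qed
  finally show ?thesis .
qed

lemma gaussian_pair_wick:
  fixes x y :: "'a \<Rightarrow> real" and \<alpha> \<beta> :: "'i \<Rightarrow> complex"
  defines "\<zeta> \<equiv> (\<lambda>i \<omega>. \<alpha> i * complex_of_real (x \<omega>) + \<beta> i * complex_of_real (y \<omega>))"
  assumes int: "\<And>a b. integrable M (\<lambda>\<omega>. x \<omega> ^ a * y \<omega> ^ b)"
    and mom: "\<And>a b. (\<integral>\<omega>. x \<omega> ^ a * y \<omega> ^ b \<partial>M) = \<mu> a * \<nu> b"
    and \<mu>: "\<And>a. \<mu> (Suc a) = v * real a * \<mu> (a - 1)"
    and \<nu>: "\<And>b. \<nu> (Suc b) = w * real b * \<nu> (b - 1)"
    and T: "finite T"
  shows "integrable M (\<lambda>\<omega>. \<Prod>i\<in>T. \<zeta> i \<omega>)"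
    and "t \<in> T \<Longrightarrow> (\<integral>\<omega>. (\<Prod>i\<in>T. \<zeta> i \<omega>) \<partial>M) =
      (\<Sum>c\<in>T-{t}. (v * \<alpha> t * \<alpha> c + w * \<beta> t * \<beta> c) * (\<integral>\<omega>. (\<Prod>i\<in>T-{t,c}. \<zeta> i \<omega>) \<partial>M))"
proof -
  define g where "g a b T \<omega> = complex_of_real (x \<omega> ^ a * y \<omega> ^ b) * (\<Prod>i\<in>T. \<zeta> i \<omega>)" for a b T \<omega>
  have gi: "g a b (insert d T) \<omega> = \<alpha> d * g (Suc a) b T \<omega> + \<beta> d * g a (Suc b) T \<omega>" if "finite T" "d \<notin> T" for a b d T \<omega>
    using that by (simp add: g_def \<zeta>_def algebra_simps)
  have I: "integrable M (g a b T)" if "finite T" for a b T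
    using that
  proof (induction T arbitrary: a b rule: finite_induct)
    case empty
    have "integrable M (\<lambda>\<omega>. complex_of_real (x \<omega> ^ a * y \<omega> ^ b))" by (rule integrable_of_real[OF int])
    then show ?case by (simp add: g_def[abs_def])
  next
    case (insert d T)
    have "integrable M (\<lambda>\<omega>. \<alpha> d * g (Suc a) b T \<omega> + \<beta> d * g a (Suc b) T \<omega>)"
      using insert.IH by (intro Bochner_Integration.integrable_add integrable_mult_right) auto
    then show ?case by (simp add: gi[OF insert.hyps(1,2)] cong: integrable_cong)
  qed
  have g0: "g 0 0 T = (\<lambda>\<omega>. \<Prod>i\<in>T. \<zeta> i \<omega>)" for T by (simp add: g_def[abs_def])
  show "integrable M (\<lambda>\<omega>. \<Prod>i\<in>T. \<zeta> i \<omega>)" using I[OF T, of 0 0] by (simp add: g0)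
  assume t: "t \<in> T"
  have \<mu>': "complex_of_real (\<mu> (Suc a)) = complex_of_real v * of_nat a * complex_of_real (\<mu> (a - 1))" for a
    by (simp add: \<mu>)
  have \<nu>': "complex_of_real (\<nu> (Suc b)) = complex_of_real w * of_nat b * complex_of_real (\<nu> (b - 1))" for b
    by (simp add: \<nu>)
  have "(\<integral>\<omega>. g 0 0 T \<omega> \<partial>M) = (\<Sum>c\<in>T-{t}. (complex_of_real v * \<alpha> t * \<alpha> c + complex_of_real w * \<beta> t * \<beta> c) * (\<integral>\<omega>. g 0 0 (T-{t,c}) \<omega> \<partial>M))"
  proof (rule gaussian_functional_wick[where G = "\<lambda>a b T. \<integral>\<omega>. g a b T \<omega> \<partial>M" and \<mu> = "\<lambda>a. of_real (\<mu> a)" and \<nu> = "\<lambda>a. of_real (\<nu> a)"])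
    fix a b
    show "(\<integral>\<omega>. g a b {} \<omega> \<partial>M) = complex_of_real (\<mu> a) * complex_of_real (\<nu> b)"
      using mom[of a b] by (simp add: g_def flip: of_real_mult of_real_power)
  next
    fix a b d and T :: "'i set" assume "finite T" "d \<notin> T"
    then show "(\<integral>\<omega>. g a b (insert d T) \<omega> \<partial>M) = \<alpha> d * (\<integral>\<omega>. g (Suc a) b T \<omega> \<partial>M) + \<beta> d * (\<integral>\<omega>. g a (Suc b) T \<omega> \<partial>M)"
      by (simp add: gi I)
  qed (fact \<mu>' \<nu>' T t)+
  then show "(\<integral>\<omega>. (\<Prod>i\<in>T. \<zeta> i \<omega>) \<partial>M) =
      (\<Sum>c\<in>T-{t}. (v * \<alpha> t * \<alpha> c + w * \<beta> t * \<beta> c) * (\<integral>\<omega>. (\<Prod>i\<in>T-{t,c}. \<zeta> i \<omega>) \<partial>M))"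
    by (simp add: g0)
qed

section \<open>Gaussian moments and Wick's formula for the entries of a GUE matrix\<close>

definition normal_mom :: "real \<Rightarrow> nat \<Rightarrow> real" where
  "normal_mom v a = (\<integral>t. normal_density 0 (sqrt v) t * t ^ a \<partial>lborel)"

text \<open>Read off from the closed form of the even moments and the vanishing of the odd ones. At
  \<open>a = 0\<close> the truncated \<open>a - 1\<close> is harmless, being multiplied by
  \<open>0\<close>.\<close>

lemma normal_mom_Suc:
  assumes "v > 0"
  shows "normal_mom v (Suc a) = v * real a * normal_mom v (a - 1)"
proof -
  have e: "normal_mom v (2 * k) = fact (2 * k) / ((2 / v) ^ k * fact k)" for k
    using integral_normal_moment_even[of "sqrt v" 0 k] assms by (simp add: normal_mom_def)
  have o: "normal_mom v (2 * k + 1) = 0" for k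
    using integral_normal_moment_odd[of "sqrt v" 0 k] assms by (simp add: normal_mom_def)
  show ?thesis
  proof (cases "even a")
    case True
    then obtain k where a: "a = 2 * k" by (auto elim: evenE)
    then show ?thesis using o[of k] o[of "k - 1"] by (cases k) auto
  next
    case False
    then obtain k where a: "a = 2 * k + 1" by (auto elim: oddE)
    have "normal_mom v (Suc a) = normal_mom v (2 * Suc k)" by (simp add: a)
    also have "\<dots> = v * real a * (fact (2 * k) / ((2 / v) ^ k * fact k))"
    proof -
      have "fact (2 * Suc k) = (2 * (real k + 1)) * (2 * real k + 1) * (fact (2 * k) :: real)"
        by (simp add: algebra_simps)
      moreover have "(2 / v) ^ Suc k * fact (Suc k) = (2 * (real k + 1)) * ((2 / v) ^ k * fact k) / v"
        by (simp add: algebra_simps)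
      moreover have "A * B * F / (A * Q / v) = v * B * (F / Q)" if "A \<noteq> 0" for A B F Q :: real
        using that by simp
      ultimately show ?thesis unfolding e a by (simp only:) (simp add: add.commute)
    qed
    finally show ?thesis using e[of k] by (simp add: a)
  qed
qed

lemma normal_mom_distributed:
  assumes "v > 0" "distributed M lborel x (normal_density 0 (sqrt v))"
  shows "integrable M (\<lambda>\<omega>. x \<omega> ^ a)" "(\<integral>\<omega>. x \<omega> ^ a \<partial>M) = normal_mom v a"
proof -
  have "integrable lborel (\<lambda>t. normal_density 0 (sqrt v) t * t ^ a)"
    using integrable_normal_moment[of "sqrt v" 0 a] assms by simp
  then show "integrable M (\<lambda>\<omega>. x \<omega> ^ a)"
    using distributed_integrable[OF assms(2), of "\<lambda>t. t ^ a"] by simp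
  show "(\<integral>\<omega>. x \<omega> ^ a \<partial>M) = normal_mom v a"
    using distributed_integral[OF assms(2), of "\<lambda>t. t ^ a"] by (simp add: normal_mom_def)
qed

lemma mat_adjoint_entry:
  fixes A :: "complex mat"
  assumes "A \<in> carrier_mat N N" "i < N" "j < N"
  shows "mat_adjoint A $$ (i, j) = cnj (A $$ (j, i))"
  using assms unfolding mat_adjoint_def by (subst mat_of_rows_index) auto

lemma mat_adjoint_index:
  fixes A :: "complex mat"
  assumes "A \<in> carrier_mat N N" "mat_adjoint A = A" "j < N" "k < N"
  shows "A $$ (k, j) = cnj (A $$ (j, k))"
  using mat_adjoint_entry[OF assms(1,4,3)] assms(2) by simp

text \<open>The mean of the product of two entries, without conjugation: off the diagonal the
  variances \<open>s / 2\<close> of real and imaginary part cancel in the mean of a square and add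
  up in the mean of an entry times its mirror image.\<close>

definition entry_cov :: "real \<Rightarrow> nat \<times> nat \<Rightarrow> nat \<times> nat \<Rightarrow> complex" where
  "entry_cov s p q = (if q = prod.swap p then complex_of_real s else 0)"

text \<open>The case of one entry and its conjugate, in arbitrary multiplicity, reduced to the pair
  formed by real and imaginary part.\<close>

lemma GUE_entry_wick:
  assumes G: "is_GUE M N s X" "s > 0" and u: "j \<le> k" "k < N"
    and T: "finite T" "\<And>i. i \<in> T \<Longrightarrow> e i \<in> {(j, k), (k, j)}"
  shows "integrable M (\<lambda>\<omega>. \<Prod>i\<in>T. X \<omega> $$ e i)"
    and "t \<in> T \<Longrightarrow> (\<integral>\<omega>. (\<Prod>i\<in>T. X \<omega> $$ e i) \<partial>M) =
      (\<Sum>c\<in>T-{t}. entry_cov s (e t) (e c) * (\<integral>\<omega>. (\<Prod>i\<in>T-{t,c}. X \<omega> $$ e i) \<partial>M))"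
proof -
  interpret prob_space M using G by (simp add: is_GUE_def random_selfadjoint_def)
  define Z where "Z \<omega> = X \<omega> $$ (j, k)" for \<omega>
  have adj: "X \<omega> $$ (k, j) = cnj (Z \<omega>)" if "\<omega> \<in> space M" for \<omega>
    unfolding Z_def using that G u by (intro mat_adjoint_index) (auto simp: is_GUE_def random_selfadjoint_def)
  define x where "x \<omega> = Re (Z \<omega>)" for \<omega>
  define y where "y \<omega> = (if j = k then 0 else Im (Z \<omega>))" for \<omega>
  define v where "v = (if j = k then s else s / 2)"
  define w where "w = (if j = k then 0 else s / 2)"
  \<comment> \<open>The entry is \<open>x + \<i> y\<close>, its mirror image
    \<open>x - \<i> y\<close>. On the diagonal \<open>y = 0\<close>, so either sign is correct
    there.\<close>
  define \<beta> where "\<beta> i = (if e i = (j, k) then \<i> else - \<i>)" for i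
  \<comment> \<open>On the diagonal these are the moments of the constant \<open>0\<close>, which
    satisfy the same recursion with \<open>w = 0\<close>.\<close>
  define \<nu> where "\<nu> b = (if j = k then (if b = 0 then 1 else 0) else normal_mom w b)" for b :: nat
  have v: "v > 0" using G by (simp add: v_def)
  have dx: "distributed M lborel x (normal_density 0 (sqrt v))"
    using G u unfolding x_def Z_def v_def is_GUE_def by (cases "j = k") auto
  have mom: "integrable M (\<lambda>\<omega>. x \<omega> ^ a * y \<omega> ^ b) \<and> (\<integral>\<omega>. x \<omega> ^ a * y \<omega> ^ b \<partial>M) = normal_mom v a * \<nu> b" for a b
  proof (cases "j = k")
    case True
    then show ?thesis using normal_mom_distributed[OF v dx, of a] by (cases b) (auto simp: y_def \<nu>_def)
  next
    case False
    then have jk: "j < k" using u by simp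
    have w: "w > 0" using False G by (simp add: w_def)
    have dy: "distributed M lborel y (normal_density 0 (sqrt w))"
      using G u jk False unfolding y_def Z_def w_def is_GUE_def by auto
    have "indep_var borel x borel y"
      using G u jk unfolding x_def y_def Z_def is_GUE_def by auto
    then have ind: "indep_var borel ((\<lambda>t. t ^ a) \<circ> x) borel ((\<lambda>t. t ^ b) \<circ> y)"
      by (rule indep_var_compose) auto
    then have ind': "indep_var borel (\<lambda>\<omega>. x \<omega> ^ a) borel (\<lambda>\<omega>. y \<omega> ^ b)" by (simp add: o_def)
    show ?thesis
      using indep_var_integrable[OF ind'] indep_var_lebesgue_integral[OF ind'] False
        normal_mom_distributed[OF v dx, of a] normal_mom_distributed[OF w dy, of b]
      by (simp add: \<nu>_def)
  qed
  have \<nu>: "\<nu> (Suc b) = w * real b * \<nu> (b - 1)" for b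
    using normal_mom_Suc[of w b] G by (auto simp: \<nu>_def w_def)
  have Zx: "Z \<omega> = complex_of_real (x \<omega>) + \<i> * complex_of_real (y \<omega>)" if "\<omega> \<in> space M" for \<omega>
  proof (cases "j = k")
    case True
    then have "Im (Z \<omega>) = 0" using adj[OF that] by (simp add: Z_def complex_eq_iff)
    then show ?thesis using True by (simp add: x_def y_def complex_eq_iff)
  qed (simp add: x_def y_def complex_eq_iff)
  have ez: "X \<omega> $$ e i = 1 * complex_of_real (x \<omega>) + \<beta> i * complex_of_real (y \<omega>)" if "\<omega> \<in> space M" "i \<in> T" for \<omega> i
  proof (cases "e i = (j, k)")
    case True
    then have "X \<omega> $$ e i = Z \<omega>" by (simp add: Z_def)
    then show ?thesis using True Zx[OF that(1)] by (simp add: \<beta>_def)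
  next
    case False
    then have "e i = (k, j)" using T(2)[OF that(2)] by auto
    then have "X \<omega> $$ e i = cnj (Z \<omega>)" using adj[OF that(1)] by simp
    also have "\<dots> = complex_of_real (x \<omega>) - \<i> * complex_of_real (y \<omega>)" unfolding Zx[OF that(1)] by simp
    finally show ?thesis using False by (simp add: \<beta>_def)
  qed
  have P: "(\<Prod>i\<in>T'. X \<omega> $$ e i) = (\<Prod>i\<in>T'. 1 * complex_of_real (x \<omega>) + \<beta> i * complex_of_real (y \<omega>))"
    if "\<omega> \<in> space M" "T' \<subseteq> T" for \<omega> T'
    using ez that by (intro prod.cong) auto
  note W = gaussian_pair_wick[where x = x and y = y and \<alpha> = "\<lambda>_. 1" and \<beta> = \<beta> and M = M and \<mu> = "normal_mom v" and \<nu> = \<nu> and v = v and w = w,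
    OF conjunct1[OF mom] conjunct2[OF mom] normal_mom_Suc[OF v] \<nu> T(1)]
  show "integrable M (\<lambda>\<omega>. \<Prod>i\<in>T. X \<omega> $$ e i)"
    using W(1) by (rule Bochner_Integration.integrable_cong[THEN iffD1, rotated -1]) (use P in auto)
  have I: "(\<integral>\<omega>. (\<Prod>i\<in>T'. X \<omega> $$ e i) \<partial>M) = (\<integral>\<omega>. (\<Prod>i\<in>T'. 1 * complex_of_real (x \<omega>) + \<beta> i * complex_of_real (y \<omega>)) \<partial>M)"
    if "T' \<subseteq> T" for T'
    by (rule Bochner_Integration.integral_cong[OF refl]) (use P that in auto)
  assume t: "t \<in> T"
  \<comment> \<open>Off the diagonal equal positions give \<open>v - w = 0\<close> and opposite ones
    \<open>v + w = s\<close>; on the diagonal \<open>w = 0\<close> and \<open>v = s\<close>.\<close>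
  have cov: "complex_of_real v * 1 * 1 + complex_of_real w * \<beta> t * \<beta> c = entry_cov s (e t) (e c)" if "c \<in> T" for c
    using T(2)[OF t] T(2)[OF that] by (auto simp: v_def w_def \<beta>_def entry_cov_def mult.assoc)
  show "(\<integral>\<omega>. (\<Prod>i\<in>T. X \<omega> $$ e i) \<partial>M) =
    (\<Sum>c\<in>T-{t}. entry_cov s (e t) (e c) * (\<integral>\<omega>. (\<Prod>i\<in>T-{t,c}. X \<omega> $$ e i) \<partial>M))"
    unfolding I[OF order_refl] W(2)[OF t]
    by (intro sum.cong refl arg_cong2[of _ _ _ _ "(*)"] I[symmetric] cov) auto
qed

text \<open>The indices are grouped into blocks, one for each position on or above the diagonal. By
  independence the mean is the product of the block means, so expanding at \<open>a\<close> affects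
  only the block of \<open>a\<close>.\<close>

lemma GUE_wick:
  fixes S :: "'i::linorder set"
  assumes G: "is_GUE M N s X" "s > 0" and S: "finite S" "\<And>i. i \<in> S \<Longrightarrow> e i \<in> {..<N} \<times> {..<N}"
  shows "integrable M (\<lambda>\<omega>. \<Prod>i\<in>S. X \<omega> $$ e i)"
    and "(\<integral>\<omega>. (\<Prod>i\<in>S. X \<omega> $$ e i) \<partial>M) = (\<Sum>\<pi>\<in>pairings S. \<Prod>i\<in>{i\<in>S. i < \<pi> i}. entry_cov s (e i) (e (\<pi> i)))"
proof -
  interpret prob_space M using G by (simp add: is_GUE_def random_selfadjoint_def)
  define U where "U = {(j, k). j \<le> k \<and> k < N}"
  define f where "f = (\<lambda>(j, k). (min j k, max j (k::nat)))"
  have "U \<subseteq> {..N} \<times> {..N}" by (auto simp: U_def)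
  then have finU: "finite U" by (rule finite_subset) auto
  have fU: "f (e i) \<in> U" if "i \<in> S" for i using S(2)[OF that] by (auto simp: U_def f_def)
  define B where "B T u = {i\<in>T. f (e i) = u}" for T :: "'i set" and u
  have finB: "finite (B T u)" if "T \<subseteq> S" for T u using finite_subset[OF that S(1)] by (simp add: B_def)
  have eB: "e i \<in> {(j, k), (k, j)}" if "i \<in> B T (j, k)" for i T j k
    using that by (cases "e i") (auto simp: B_def f_def min_def max_def split: if_splits)
  have adj: "X \<omega> $$ (k, j) = cnj (X \<omega> $$ (j, k))" if "\<omega> \<in> space M" "j < N" "k < N" for \<omega> j k
    using that G by (intro mat_adjoint_index) (auto simp: is_GUE_def random_selfadjoint_def)
  \<comment> \<open>A block as a measurable function of a single entry, mirrored entries being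
    conjugates; in this form independence passes from entries to blocks.\<close>
  define h where "h T u z = (\<Prod>i\<in>B T u. if e i = u then z else cnj z)" for T :: "'i set" and u and z :: complex
  have hX: "(\<Prod>i\<in>B T u. X \<omega> $$ e i) = h T u (X \<omega> $$ u)" if "\<omega> \<in> space M" "u \<in> U" for T u \<omega>
    unfolding h_def
  proof (rule prod.cong[OF refl])
    fix i assume i: "i \<in> B T u"
    have "u \<in> U" by fact
    then obtain j k where u: "u = (j, k)" "j < N" "k < N" by (auto simp: U_def)
    then show "X \<omega> $$ e i = (if e i = u then X \<omega> $$ u else cnj (X \<omega> $$ u))"
      using eB[of i T j k] i adj[OF that(1) u(2,3)] by auto
  qed
  have "indep_vars (\<lambda>_. borel) (\<lambda>(j, k) \<omega>. X \<omega> $$ (j, k)) U"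
    using G by (simp add: is_GUE_def U_def)
  then have ind0: "indep_vars (\<lambda>_. borel) (\<lambda>u \<omega>. X \<omega> $$ u) U"
    by (simp add: case_prod_unfold)
  have meas: "h T u \<in> borel_measurable borel" if "T \<subseteq> S" for T u
    unfolding h_def
  proof (rule borel_measurable_prod)
    fix i
    have "cnj \<in> borel_measurable borel"
      by (intro borel_measurable_continuous_onI continuous_on_cnj continuous_on_id)
    then show "(\<lambda>z. if e i = u then z else cnj z) \<in> borel_measurable borel" by (cases "e i = u") auto
  qed
  have ind: "indep_vars (\<lambda>_. borel) (\<lambda>u \<omega>. h T u (X \<omega> $$ u)) U" if "T \<subseteq> S" for T
    using ind0 by (rule indep_vars_compose2) (use meas[OF that] in auto)
  have int: "integrable M (\<lambda>\<omega>. h T u (X \<omega> $$ u))" if "T \<subseteq> S" "u \<in> U" for T u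
  proof -
    have "u \<in> U" by fact
    then obtain j k where u: "u = (j, k)" "j \<le> k" "k < N" by (auto simp: U_def)
    have "integrable M (\<lambda>\<omega>. \<Prod>i\<in>B T u. X \<omega> $$ e i)"
    proof (rule GUE_entry_wick(1)[OF G u(2,3) finB[OF that(1)]])
      show "e i \<in> {(j, k), (k, j)}" if "i \<in> B T u" for i using eB[of i T j k] that u(1) by simp
    qed
    then show ?thesis
      by (rule Bochner_Integration.integrable_cong[THEN iffD1, rotated -1]) (use hX that in auto)
  qed
  have split: "(\<Prod>i\<in>T. X \<omega> $$ e i) = (\<Prod>u\<in>U. h T u (X \<omega> $$ u))" if "T \<subseteq> S" "\<omega> \<in> space M" for T \<omega>
  proof -
    have "(\<Prod>i\<in>T. X \<omega> $$ e i) = (\<Prod>u\<in>U. \<Prod>i\<in>B T u. X \<omega> $$ e i)"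
      unfolding B_def using finite_subset[OF that(1) S(1)] finU fU that by (intro prod.group[symmetric]) auto
    then show ?thesis using hX that(2) by simp
  qed
  define E where "E T = (\<integral>\<omega>. (\<Prod>i\<in>T. X \<omega> $$ e i) \<partial>M)" for T
  have EB: "(\<integral>\<omega>. h T u (X \<omega> $$ u) \<partial>M) = E (B T u)" if "u \<in> U" for T u
    unfolding E_def by (rule Bochner_Integration.integral_cong[OF refl]) (use hX that in auto)
  have Eprod: "E T = (\<Prod>u\<in>U. E (B T u))" if "T \<subseteq> S" for T
  proof -
    have "E T = (\<integral>\<omega>. (\<Prod>u\<in>U. h T u (X \<omega> $$ u)) \<partial>M)"
      unfolding E_def by (rule Bochner_Integration.integral_cong[OF refl]) (use split that in auto)
    also have "\<dots> = (\<Prod>u\<in>U. \<integral>\<omega>. h T u (X \<omega> $$ u) \<partial>M)"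
      using finU ind[OF that] int[OF that] by (rule indep_vars_lebesgue_integral)
    finally show ?thesis using EB by simp
  qed
  have "integrable M (\<lambda>\<omega>. \<Prod>u\<in>U. h S u (X \<omega> $$ u))"
    by (rule indep_vars_integrable[OF finU ind[OF order_refl] int[OF order_refl]])
  then show "integrable M (\<lambda>\<omega>. \<Prod>i\<in>S. X \<omega> $$ e i)"
    by (rule Bochner_Integration.integrable_cong[THEN iffD1, rotated -1]) (use split in auto)
  have "E S = (\<Sum>\<pi>\<in>pairings S. \<Prod>i\<in>{i\<in>S. i < \<pi> i}. entry_cov s (e i) (e (\<pi> i)))"
  proof (rule wick_pairings[OF S(1)])
    show "E {} = 1" by (simp add: E_def prob_space)
    fix T a assume T: "T \<subseteq> S" "a \<in> T"
    define u where "u = f (e a)"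
    have u: "u \<in> U" using fU T by (auto simp: u_def)
    obtain j k where jk: "u = (j, k)" "j \<le> k" "k < N" using u by (auto simp: U_def)
    have aB: "a \<in> B T u" using T by (simp add: B_def u_def)
    define R where "R = (\<Prod>u'\<in>U - {u}. E (B T u'))"
    have "E T = E (B T u) * R" unfolding Eprod[OF T(1)] R_def using finU u by (rule prod.remove)
    also have "E (B T u) = (\<Sum>c\<in>B T u-{a}. entry_cov s (e a) (e c) * E (B T u-{a,c}))"
      unfolding E_def
    proof (rule GUE_entry_wick(2)[OF G jk(2,3) finB[OF T(1)] _ aB])
      show "e i \<in> {(j, k), (k, j)}" if "i \<in> B T u" for i using eB[of i T j k] that jk(1) by simp
    qed
    also have "\<dots> * R = (\<Sum>c\<in>B T u-{a}. entry_cov s (e a) (e c) * E (T-{a,c}))"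
      unfolding sum_distrib_right
    proof (rule sum.cong[OF refl])
      fix c assume c: "c \<in> B T u - {a}"
      have u1: "B (T - {a,c}) u = B T u - {a,c}" by (auto simp: B_def)
      have u2: "B (T - {a,c}) u' = B T u'" if "u' \<in> U - {u}" for u'
        using that c aB by (auto simp: B_def)
      have "E (T - {a,c}) = (\<Prod>u'\<in>U. E (B (T - {a,c}) u'))" using T by (intro Eprod) auto
      also have "\<dots> = E (B (T - {a,c}) u) * (\<Prod>u'\<in>U - {u}. E (B (T - {a,c}) u'))"
        using finU u by (rule prod.remove)
      also have "\<dots> = E (B T u - {a,c}) * R" unfolding R_def u1 using u2 by simp
      finally have "E (T - {a,c}) = E (B T u - {a,c}) * R" .
      then show "entry_cov s (e a) (e c) * E (B T u - {a, c}) * R = entry_cov s (e a) (e c) * E (T - {a, c})" by simp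
    qed
    \<comment> \<open>The sum extends to all of \<open>T\<close>: for \<open>c\<close> from another
      block, \<open>e c\<close> is not the mirror image of \<open>e a\<close>, and the covariance
      vanishes.\<close>
    also have "\<dots> = (\<Sum>c\<in>T-{a}. entry_cov s (e a) (e c) * E (T-{a,c}))"
    proof -
      have z: "entry_cov s (e a) (e c) * E (T - {a, c}) = 0" if "c \<in> T - {a} - (B T u - {a})" for c
      proof -
        have "f (e c) \<noteq> f (e a)" using that aB by (auto simp: B_def u_def)
        moreover have "f (prod.swap p) = f p" for p
          by (cases p) (simp add: f_def min_def max_def)
        ultimately have "e c \<noteq> prod.swap (e a)" by metis
        then show ?thesis by (simp add: entry_cov_def)
      qed
      have fin: "finite (T - {a})" using finite_subset[OF T(1) S(1)] by simp
      have sub: "B T u - {a} \<subseteq> T - {a}" by (simp add: B_def Diff_mono)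
      show ?thesis by (rule sum.mono_neutral_left[OF fin sub]) (use z in blast)
    qed
    finally show "E T = (\<Sum>c\<in>T-{a}. entry_cov s (e a) (e c) * E (T-{a,c}))" .
  qed
  then show "(\<integral>\<omega>. (\<Prod>i\<in>S. X \<omega> $$ e i) \<partial>M) = (\<Sum>\<pi>\<in>pairings S. \<Prod>i\<in>{i\<in>S. i < \<pi> i}. entry_cov s (e i) (e (\<pi> i)))"
    by (simp add: E_def)
qed

section \<open>The mean trace as a sum over walks\<close>

lemma mat_pow_Suc_entry:
  fixes A :: "complex mat"
  assumes A: "A \<in> carrier_mat N N" and "i < N" "j < N"
  shows "(A ^\<^sub>m Suc n) $$ (i, j) =
    (\<Sum>x\<in>{x\<in>{..n} \<rightarrow>\<^sub>E {..<N}. x 0 = i}. (\<Prod>k<n. A $$ (x k, x (Suc k))) * A $$ (x n, j))"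
  using assms(3)
proof (induction n arbitrary: j)
  case 0
  have "{x\<in>{..0::nat} \<rightarrow>\<^sub>E {..<N}. x 0 = i} = {\<lambda>k. if k = 0 then i else undefined}"
    using assms(2) by (auto simp: PiE_iff extensional_def fun_eq_iff)
  then show ?case using A by simp
next
  case (Suc n)
  let ?P = "\<lambda>n. {x\<in>{..n} \<rightarrow>\<^sub>E {..<N}. x 0 = i}"
  have "(A ^\<^sub>m Suc (Suc n)) $$ (i, j) = (\<Sum>m<N. (A ^\<^sub>m Suc n) $$ (i, m) * A $$ (m, j))"
    using A Suc.prems assms(2) by (simp add: scalar_prod_def lessThan_atLeast0)
  also have "\<dots> = (\<Sum>m<N. \<Sum>x\<in>?P n. (\<Prod>k<n. A $$ (x k, x (Suc k))) * A $$ (x n, m) * A $$ (m, j))"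
    using Suc.IH by (simp add: sum_distrib_right)
  also have "\<dots> = (\<Sum>(m, x)\<in>{..<N} \<times> ?P n. (\<Prod>k<n. A $$ (x k, x (Suc k))) * A $$ (x n, m) * A $$ (m, j))"
    by (rule sum.cartesian_product)
  also have "\<dots> = (\<Sum>x\<in>?P (Suc n). (\<Prod>k<Suc n. A $$ (x k, x (Suc k))) * A $$ (x (Suc n), j))"
  proof (rule sum.reindex_bij_witness[where i = "\<lambda>y. (y (Suc n), restrict y {..n})" and j = "\<lambda>(m, x). x(Suc n := m)"])
    fix p assume p: "p \<in> {..<N} \<times> ?P n"
    then obtain m x where mx: "p = (m, x)" "m < N" "x \<in> {..n} \<rightarrow>\<^sub>E {..<N}" "x 0 = i" by auto
    have "restrict (x(Suc n := m)) {..n} = x"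
      using mx(3) by (auto simp: fun_eq_iff PiE_iff extensional_def)
    then show "((case p of (m, x) \<Rightarrow> x(Suc n := m)) (Suc n), restrict (case p of (m, x) \<Rightarrow> x(Suc n := m)) {..n}) = p"
      using mx by simp
    show "(case p of (m, x) \<Rightarrow> x(Suc n := m)) \<in> ?P (Suc n)"
      using mx by (auto simp: PiE_iff extensional_def le_Suc_eq)
    have "(\<Prod>k<n. A $$ ((x(Suc n := m)) k, (x(Suc n := m)) (Suc k))) = (\<Prod>k<n. A $$ (x k, x (Suc k)))"
      by (rule prod.cong) auto
    then show "(\<Prod>k<Suc n. A $$ ((case p of (m, x) \<Rightarrow> x(Suc n := m)) k, (case p of (m, x) \<Rightarrow> x(Suc n := m)) (Suc k))) *
        A $$ ((case p of (m, x) \<Rightarrow> x(Suc n := m)) (Suc n), j) =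
      (case p of (m, x) \<Rightarrow> (\<Prod>k<n. A $$ (x k, x (Suc k))) * A $$ (x n, m) * A $$ (m, j))"
      using mx by simp
  next
    fix y assume "y \<in> ?P (Suc n)"
    then show "(y (Suc n), restrict y {..n}) \<in> {..<N} \<times> ?P n"
      "(case (y (Suc n), restrict y {..n}) of (m, x) \<Rightarrow> x(Suc n := m)) = y"
      by (auto simp: PiE_iff extensional_def fun_eq_iff)
  qed
  finally show ?case .
qed

lemma mat_trace_pow:
  fixes A :: "complex mat"
  assumes A: "A \<in> carrier_mat N N" and "n > 0"
  shows "mat_trace (A ^\<^sub>m n) = (\<Sum>x\<in>{..<n} \<rightarrow>\<^sub>E {..<N}. \<Prod>k<n. A $$ (x k, x (Suc k mod n)))"
proof -
  obtain m where n: "n = Suc m" using assms(2) by (cases n) auto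
  have e: "(\<Prod>k<m. A $$ (x k, x (Suc k))) * A $$ (x m, x 0) = (\<Prod>k<n. A $$ (x k, x (Suc k mod n)))" for x
    unfolding n by simp
  have "mat_trace (A ^\<^sub>m n) = (\<Sum>i<N. (A ^\<^sub>m Suc m) $$ (i, i))"
    using A by (simp add: mat_trace_def n)
  also have "\<dots> = (\<Sum>i<N. \<Sum>x\<in>{x\<in>{..m} \<rightarrow>\<^sub>E {..<N}. x 0 = i}. \<Prod>k<n. A $$ (x k, x (Suc k mod n)))"
    unfolding e[symmetric] using mat_pow_Suc_entry[OF A] by (intro sum.cong refl) (auto simp del: pow_mat.simps)
  also have "\<dots> = (\<Sum>x\<in>{..m} \<rightarrow>\<^sub>E {..<N}. \<Prod>k<n. A $$ (x k, x (Suc k mod n)))"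
    by (rule sum.group) (auto intro!: finite_PiE)
  finally show ?thesis unfolding n lessThan_Suc_atMost .
qed

text \<open>\<open>\<pi>\<close> exchanges left ends and right ends. This fixes the power of the
  variance and rules out pairings of a set of odd size.\<close>

lemma card_openers:
  assumes "\<pi> \<in> pairings S" "finite (S :: 'i::linorder set)"
  shows "2 * card {i\<in>S. i < \<pi> i} = card S"
proof -
  note d = pairingsD[OF assms(1)]
  have "bij_betw \<pi> {i\<in>S. i < \<pi> i} {i\<in>S. \<pi> i < i}"
    by (rule bij_betw_byWitness[where f' = \<pi>]) (auto simp: d)
  then have "card {i\<in>S. i < \<pi> i} = card {i\<in>S. \<pi> i < i}" by (rule bij_betw_same_card)
  moreover have "card ({i\<in>S. i < \<pi> i} \<union> {i\<in>S. \<pi> i < i}) = card {i\<in>S. i < \<pi> i} + card {i\<in>S. \<pi> i < i}"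
    using assms(2) by (intro card_Un_disjoint) auto
  moreover have "{i\<in>S. i < \<pi> i} \<union> {i\<in>S. \<pi> i < i} = S" using d(3) by (auto simp: neq_iff)
  ultimately show ?thesis by simp
qed

text \<open>Since the condition on \<open>x\<close> is required at \<open>\<pi> k\<close> as well, it says that the paired steps \<open>k\<close> and
  \<open>\<pi> k\<close> run through the same edge in opposite directions.\<close>

definition band_walks :: "nat \<Rightarrow> nat \<Rightarrow> nat \<Rightarrow> (nat \<Rightarrow> nat) \<Rightarrow> (nat \<Rightarrow> nat) set" where
  "band_walks N b n \<pi> = {x\<in>{..<n} \<rightarrow>\<^sub>E {..<N}.
     \<forall>k<n. x (\<pi> k) = x (Suc k mod n) \<and> cyclic_dist N (x k) (x (Suc k mod n)) \<le> int b}"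

text \<open>This covers both the normalized band matrices and, with \<open>b = N\<close> and \<open>c = 1\<close>, the full GUE matrix.\<close>

definition wband :: "nat \<Rightarrow> nat \<Rightarrow> real \<Rightarrow> complex mat \<Rightarrow> complex mat" where
  "wband N b c A = mat N N (\<lambda>(j, k). complex_of_real c * (if cyclic_dist N j k \<le> int b then A $$ (j, k) else 0))"

lemma wband_carrier [simp]: "wband N b c A \<in> carrier_mat N N"
  by (simp add: wband_def)

text \<open>The trace is a sum over closed walks. By Wick's formula the mean of each becomes a sum
  over pairings, and a pairing contributes \<open>s ^ (n div 2)\<close> exactly when all paired
  steps are opposite. Exchanging the sums leaves walk counts.\<close>

lemma trace_moment_pairings:
  assumes G: "is_GUE M N s X" "s > 0" and n: "n > 0"
  shows "integrable M (\<lambda>\<omega>. mat_trace (wband N b c (X \<omega>) ^\<^sub>m n))"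
    and "(\<integral>\<omega>. mat_trace (wband N b c (X \<omega>) ^\<^sub>m n) \<partial>M) =
      complex_of_real (c ^ n * s ^ (n div 2) * (\<Sum>\<pi>\<in>pairings {..<n}. real (card (band_walks N b n \<pi>))))"
proof -
  define V where "V = ({..<n} \<rightarrow>\<^sub>E {..<N})"
  have finV: "finite V" by (auto simp: V_def intro: finite_PiE)
  define e where "e x k = (x k, x (Suc k mod n))" for x :: "nat \<Rightarrow> nat" and k
  define B where "B x \<longleftrightarrow> (\<forall>k<n. cyclic_dist N (x k) (x (Suc k mod n)) \<le> int b)" for x
  have eV: "e x k \<in> {..<N} \<times> {..<N}" if "x \<in> V" "k \<in> {..<n}" for x k
  proof -
    have "Suc k mod n \<in> {..<n}" using n by simp
    then show ?thesis using that by (auto simp: e_def V_def PiE_iff)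
  qed
  have wp: "(\<Prod>k<n. wband N b c (X \<omega>) $$ e x k) = (if B x then complex_of_real (c ^ n) else 0) * (\<Prod>k<n. X \<omega> $$ e x k)"
    if x: "x \<in> V" for \<omega> x
  proof -
    have ent: "wband N b c (X \<omega>) $$ e x k = complex_of_real c * (if cyclic_dist N (x k) (x (Suc k mod n)) \<le> int b then X \<omega> $$ e x k else 0)"
      if "k < n" for k
      using eV[OF x, of k] that by (auto simp: wband_def e_def)
    show ?thesis
    proof (cases "B x")
      case True
      then show ?thesis using ent by (simp add: B_def prod.distrib)
    next
      case False
      then obtain k where k: "k < n" "\<not> cyclic_dist N (x k) (x (Suc k mod n)) \<le> int b" by (auto simp: B_def)
      then have "wband N b c (X \<omega>) $$ e x k = 0" using ent by simp
      then have "(\<Prod>k<n. wband N b c (X \<omega>) $$ e x k) = 0" using k by auto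
      then show ?thesis using False by simp
    qed
  qed
  have tr: "mat_trace (wband N b c (X \<omega>) ^\<^sub>m n) = (\<Sum>x\<in>V. (if B x then complex_of_real (c ^ n) else 0) * (\<Prod>k<n. X \<omega> $$ e x k))" for \<omega>
    using mat_trace_pow[OF wband_carrier n, of N b c "X \<omega>"] wp by (simp add: V_def e_def)
  have int: "integrable M (\<lambda>\<omega>. \<Prod>k<n. X \<omega> $$ e x k)" if "x \<in> V" for x
    using GUE_wick(1)[OF G, of "{..<n}" "e x"] eV[OF that] by simp
  show "integrable M (\<lambda>\<omega>. mat_trace (wband N b c (X \<omega>) ^\<^sub>m n))"
    unfolding tr by (intro Bochner_Integration.integrable_sum integrable_mult_right int)
  have cov: "(\<Prod>i\<in>{i\<in>{..<n}. i < \<pi> i}. entry_cov s (e x i) (e x (\<pi> i))) =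
      (if \<forall>k<n. x (\<pi> k) = x (Suc k mod n) then complex_of_real (s ^ (n div 2)) else 0)"
    if \<pi>: "\<pi> \<in> pairings {..<n}" for \<pi> x
  proof -
    note d = pairingsD[OF \<pi>]
    have co: "card {i\<in>{..<n}. i < \<pi> i} = n div 2" using card_openers[OF \<pi>] by simp
    show ?thesis
    proof (cases "\<forall>k<n. x (\<pi> k) = x (Suc k mod n)")
      case True
      have "entry_cov s (e x i) (e x (\<pi> i)) = complex_of_real s" if "i \<in> {i\<in>{..<n}. i < \<pi> i}" for i
      proof -
        have "i < n" "\<pi> i < n" using that d(4)[of i] by auto
        then have "x (\<pi> i) = x (Suc i mod n)" "x (\<pi> (\<pi> i)) = x (Suc (\<pi> i) mod n)" using True by blast+
        then show ?thesis by (simp add: entry_cov_def e_def d(2))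
      qed
      then have "(\<Prod>i\<in>{i\<in>{..<n}. i < \<pi> i}. entry_cov s (e x i) (e x (\<pi> i))) = complex_of_real s ^ (n div 2)"
        using co by simp
      then show ?thesis using True by simp
    next
      case False
      then obtain k where k: "k < n" "x (\<pi> k) \<noteq> x (Suc k mod n)" by blast
      \<comment> \<open>The left end of the violated pair: the product runs over left ends only, and
        the two coordinates of the edge test the condition at \<open>k\<close> and at
        \<open>\<pi> k\<close> alike.\<close>
      define i where "i = min k (\<pi> k)"
      have i: "i \<in> {i\<in>{..<n}. i < \<pi> i}" using k d(2)[of k] d(3)[of k] d(4)[of k] by (auto simp: i_def min_def)
      have "e x (\<pi> i) \<noteq> prod.swap (e x i)"
        using k d(2)[of k] by (auto simp: i_def e_def min_def)
      then have "entry_cov s (e x i) (e x (\<pi> i)) = 0" by (simp add: entry_cov_def)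
      then have "(\<Prod>i\<in>{i\<in>{..<n}. i < \<pi> i}. entry_cov s (e x i) (e x (\<pi> i))) = 0" using i by (intro prod_zero) auto
      then show ?thesis using False by auto
    qed
  qed
  have "(\<integral>\<omega>. mat_trace (wband N b c (X \<omega>) ^\<^sub>m n) \<partial>M) =
      (\<Sum>x\<in>V. (if B x then complex_of_real (c ^ n) else 0) * (\<integral>\<omega>. (\<Prod>k<n. X \<omega> $$ e x k) \<partial>M))"
    unfolding tr by (subst Bochner_Integration.integral_sum) (auto intro!: integrable_mult_right int)
  also have "\<dots> = (\<Sum>x\<in>V. \<Sum>\<pi>\<in>pairings {..<n}. complex_of_real (c ^ n * s ^ (n div 2)) * of_bool (x \<in> band_walks N b n \<pi>))"
  proof (rule sum.cong[OF refl])
    fix x assume x: "x \<in> V"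
    have "(\<integral>\<omega>. (\<Prod>k<n. X \<omega> $$ e x k) \<partial>M) =
      (\<Sum>\<pi>\<in>pairings {..<n}. \<Prod>i\<in>{i\<in>{..<n}. i < \<pi> i}. entry_cov s (e x i) (e x (\<pi> i)))"
      using GUE_wick(2)[OF G, of "{..<n}" "e x"] eV[OF x] by simp
    also have "\<dots> = (\<Sum>\<pi>\<in>pairings {..<n}. if \<forall>k<n. x (\<pi> k) = x (Suc k mod n) then complex_of_real (s ^ (n div 2)) else 0)"
      by (rule sum.cong[OF refl cov])
    finally have E: "(\<integral>\<omega>. (\<Prod>k<n. X \<omega> $$ e x k) \<partial>M) =
      (\<Sum>\<pi>\<in>pairings {..<n}. if \<forall>k<n. x (\<pi> k) = x (Suc k mod n) then complex_of_real (s ^ (n div 2)) else 0)" .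
    show "(if B x then complex_of_real (c ^ n) else 0) * (\<integral>\<omega>. (\<Prod>k<n. X \<omega> $$ e x k) \<partial>M) =
      (\<Sum>\<pi>\<in>pairings {..<n}. complex_of_real (c ^ n * s ^ (n div 2)) * of_bool (x \<in> band_walks N b n \<pi>))"
      unfolding E sum_distrib_left
      by (rule sum.cong[OF refl]) (use x in \<open>auto simp: band_walks_def B_def V_def\<close>)
  qed
  also have "\<dots> = (\<Sum>\<pi>\<in>pairings {..<n}. complex_of_real (c ^ n * s ^ (n div 2)) * (\<Sum>x\<in>V. of_bool (x \<in> band_walks N b n \<pi>)))"
    by (subst sum.swap) (simp add: sum_distrib_left)
  also have "\<dots> = (\<Sum>\<pi>\<in>pairings {..<n}. complex_of_real (c ^ n * s ^ (n div 2)) * of_nat (card (band_walks N b n \<pi>)))"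
  proof (intro sum.cong refl)
    fix \<pi>
    have "V \<inter> {x. x \<in> band_walks N b n \<pi>} = band_walks N b n \<pi>" by (auto simp: band_walks_def V_def)
    then show "complex_of_real (c ^ n * s ^ (n div 2)) * (\<Sum>x\<in>V. of_bool (x \<in> band_walks N b n \<pi>)) =
      complex_of_real (c ^ n * s ^ (n div 2)) * of_nat (card (band_walks N b n \<pi>))"
      using finV by (simp add: sum_of_bool_eq)
  qed
  finally show "(\<integral>\<omega>. mat_trace (wband N b c (X \<omega>) ^\<^sub>m n) \<partial>M) =
      complex_of_real (c ^ n * s ^ (n div 2) * (\<Sum>\<pi>\<in>pairings {..<n}. real (card (band_walks N b n \<pi>))))"
    by (simp add: sum_distrib_left)
qed

section \<open>Orbits of glued points\<close>

lemma permutation_of_permutes: "f permutes S \<Longrightarrow> finite S \<Longrightarrow> permutation f"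
  unfolding permutation_permutes by (rule exI[of _ S]) simp

definition norbits :: "('i \<Rightarrow> 'i) \<Rightarrow> 'i set \<Rightarrow> nat" where
  "norbits f S = card (orbit f ` S)"

lemma orbit_eq:
  assumes "f permutes S" "finite S" "q \<in> orbit f p"
  shows "orbit f q = orbit f p"
  by (rule orbit_cyclic_eq3[OF cyclic_on_orbit[OF assms(1,2)] assms(3)])

text \<open>\<open>orbit\<close> starts with the first iterate; the base point belongs to it because
  a permutation of a finite set eventually returns.\<close>

lemma self_in_orbit:
  assumes "f permutes S" "finite S"
  shows "p \<in> orbit f p"
  by (rule permutation_self_in_orbit[OF permutation_of_permutes[OF assms]])

lemma orbit_step_eq:
  assumes "f permutes S" "finite S"
  shows "orbit f (f p) = orbit f p"
  by (rule orbit_eq[OF assms]) (rule orbit.base)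

lemma orbit_invariant:
  assumes "f permutes S" "p \<in> S" "\<And>q. q \<in> S \<Longrightarrow> x (f q) = x q" "q \<in> orbit f p"
  shows "x q = x p"
  using assms(4)
proof induction
  case base then show ?case using assms by simp
next
  case (step y)
  then show ?case using assms permutes_orbit_subset[OF assms(1,2)] by auto
qed

text \<open>Deleting the point \<open>a\<close> from its cycle changes the sign, and the number of points by one, but
  not the number of cycles, unless \<open>a\<close> is a fixed point.\<close>

lemma sign_norbits:
  assumes "finite S" "f permutes S"
  shows "sign f = (-1) ^ (card S + norbits f S)"
  using assms
proof (induction S arbitrary: f rule: finite_induct)
  case empty
  then show ?case by (simp add: norbits_def)
next
  case (insert a S)
  \<comment> \<open>\<open>q\<close> bypasses \<open>a\<close>: the predecessor of \<open>a\<close>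
    is sent to \<open>f a\<close>, and \<open>a\<close> becomes a fixed point.\<close>
  define q where "q = swap a (f a) \<circ> f"
  have fin: "finite (insert a S)" using insert by simp
  note f = insert.prems
  have fa: "f a \<in> insert a S" using permutes_in_image[OF f, of a] by simp
  have qa: "q a = a" by (simp add: q_def)
  have "q permutes insert a S" unfolding q_def using f fa by (intro permutes_compose permutes_swap_id) auto
  then have q: "q permutes S" by (rule permutes_superset) (use qa in auto)
  have qv: "q p = (if f p = a then f a else f p)" if "p \<noteq> a" for p
  proof -
    have "f p \<noteq> f a" using inj_eq[OF permutes_inj[OF f]] that by simp
    then show ?thesis by (auto simp: q_def Transposition.transpose_def)
  qed
  have fq: "swap a (f a) \<circ> q = f" by (auto simp: q_def fun_eq_iff)
  have "permutation q" using permutation_of_permutes[OF q] insert.hyps by simp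
  then have "sign (swap a (f a) \<circ> q) = sign (swap a (f a)) * sign q"
    by (intro sign_compose permutation_swap_id)
  then have sg: "sign f = sign (swap a (f a)) * sign q" unfolding fq .
  have IH: "sign q = (-1) ^ (card S + norbits q S)" by (rule insert.IH[OF q])
  have ins: "y \<in> S" if "p \<in> S" "y \<in> orbit q p" for y p
    using permutes_orbit_subset[OF q] that by blast
  have sub: "y \<in> orbit f p" if "p \<in> S" "y \<in> orbit q p" for y p
    using that(2)
  proof induction
    case base
    have "p \<noteq> a" using that insert by auto
    then show ?case using qv[of p] by (metis orbit.base orbit.step)
  next
    case (step y)
    then have "y \<noteq> a" using ins[OF that(1)] insert.hyps by auto
    then show ?case using qv[of y] step by (metis orbit.step)
  qed
  \<comment> \<open>The second conjunct carries the induction through the deleted point: an orbit of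
    \<open>f\<close> that reaches \<open>a\<close> leaves it at \<open>f a\<close>, which
    \<open>q\<close> reaches directly.\<close>
  have sup: "(y \<noteq> a \<longrightarrow> y \<in> orbit q p) \<and> (y = a \<longrightarrow> f a \<in> orbit q p)" if "p \<in> S" "f a \<noteq> a" "y \<in> orbit f p" for y p
    using that(3)
  proof induction
    case base
    have "p \<noteq> a" using that insert by auto
    then show ?case using qv[of p] orbit.base[of q p] by auto
  next
    case (step y)
    show ?case
    proof (cases "y = a")
      case True
      then show ?thesis using step that(2) by auto
    next
      case False
      then show ?thesis using step qv[of y] orbit.step[of y q p] by auto
    qed
  qed
  show ?case
  proof (cases "f a = a")
    case True
    then have "f = q" by (auto simp: q_def)
    moreover have "norbits f (insert a S) = Suc (norbits f S)"
    proof -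
      have "orbit f a = {a}" using True by (simp add: orbit_eq_singleton_iff)
      moreover have "orbit f a \<notin> orbit f ` S"
      proof
        assume "orbit f a \<in> orbit f ` S"
        then obtain p where "p \<in> S" "orbit f p = {a}" using calculation by auto
        then show False using self_in_orbit[OF f fin, of p] insert by auto
      qed
      ultimately show ?thesis using insert by (simp add: norbits_def)
    qed
    ultimately show ?thesis using IH insert by simp
  next
    case False
    have "norbits f (insert a S) = norbits q S"
    proof -
      have faS: "f a \<in> S" using fa False by simp
      have 1: "orbit f ` insert a S = orbit f ` S"
        using orbit_step_eq[OF f fin, of a] faS by auto
      have 2: "orbit f p - {a} = orbit q p" if "p \<in> S" for p
      proof (intro Set.set_eqI iffI)
        show "y \<in> orbit q p" if "y \<in> orbit f p - {a}" for y
          using sup[OF \<open>p \<in> S\<close> False, of y] that by simp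
        show "y \<in> orbit f p - {a}" if "y \<in> orbit q p" for y
          using sub[OF \<open>p \<in> S\<close> that] ins[OF \<open>p \<in> S\<close> that] insert.hyps by auto
      qed
      have "(\<lambda>A. A - {a}) ` orbit f ` S = orbit q ` S" unfolding image_image using 2 by (intro image_cong) auto
      \<comment> \<open>The orbit of a point of \<open>S\<close> keeps that point when
        \<open>a\<close> is removed, and one point determines the orbit.\<close>
      moreover have "inj_on (\<lambda>A. A - {a}) (orbit f ` S)"
      proof (rule inj_onI)
        fix A B assume "A \<in> orbit f ` S" "B \<in> orbit f ` S" and e: "A - {a} = B - {a}"
        then obtain p p' where p: "p \<in> S" "p' \<in> S" "A = orbit f p" "B = orbit f p'" by auto
        have "p \<in> A - {a}" using p self_in_orbit[OF f fin] insert.hyps by auto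
        then have "p \<in> orbit f p'" using e p by auto
        then show "A = B" using orbit_eq[OF f fin] p by blast
      qed
      ultimately show ?thesis unfolding norbits_def 1 by (metis card_image)
    qed
    then show ?thesis using sg IH False insert by (simp add: sign_swap_id)
  qed
qed

text \<open>A pairing is a product of \<open>card S div 2\<close> disjoint transpositions, peeled
  off one at a time.\<close>

lemma sign_pairing:
  assumes "finite S" "\<pi> \<in> pairings S"
  shows "sign \<pi> = (-1) ^ (card S div 2)"
  using assms
proof (induction S arbitrary: \<pi> rule: finite_psubset_induct)
  case (psubset S)
  show ?case
  proof (cases "S = {}")
    case True then show ?thesis using psubset by auto
  next
    case False
    then obtain a where a: "a \<in> S" by auto
    define \<pi>' where "\<pi>' = swap a (\<pi> a) \<circ> \<pi>"
    note d = pairingsD[OF psubset.prems]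
    note p = pairings_split(1,2)[OF psubset.prems a, folded \<pi>'_def]
    have "finite (S - {a, \<pi> a})" using psubset by simp
    then have "permutation \<pi>'" by (rule permutation_of_permutes[OF pairingsD(1)[OF p(1)]])
    then have "sign (swap a (\<pi> a) \<circ> \<pi>') = sign (swap a (\<pi> a)) * sign \<pi>'"
      by (intro sign_compose permutation_swap_id)
    then have "sign \<pi> = sign (swap a (\<pi> a)) * sign \<pi>'" using p(2) by simp
    moreover have "sign \<pi>' = (-1) ^ (card (S - {a, \<pi> a}) div 2)"
      using a p(1) by (intro psubset.IH) auto
    moreover have "card S = Suc (Suc (card (S - {a, \<pi> a})))"
    proof -
      have "S = insert a (insert (\<pi> a) (S - {a, \<pi> a}))" using a d(4)[of a] by auto
      moreover have "a \<notin> insert (\<pi> a) (S - {a, \<pi> a})" using d(3)[OF a] by auto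
      ultimately show ?thesis using psubset.hyps by (metis Diff_iff card_insert_disjoint finite_Diff finite_insert insertCI)
    qed
    ultimately show ?thesis using d(3)[OF a] by (simp add: sign_swap_id)
  qed
qed

definition rot :: "nat \<Rightarrow> nat \<Rightarrow> nat" where
  "rot n p = (if p < n then Suc p mod n else p)"

lemma rot_permutes: "rot n permutes {..<n}"
proof (rule bij_imp_permutes)
  have "inj_on (rot n) {..<n}"
    by (rule inj_onI) (auto simp: rot_def mod_Suc split: if_splits)
  moreover have "rot n ` {..<n} \<subseteq> {..<n}" by (auto simp: rot_def)
  ultimately show "bij_betw (rot n) {..<n} {..<n}"
    by (simp add: bij_betw_def endo_inj_surj)
qed (auto simp: rot_def)

lemma norbits_rot:
  assumes "n > 0"
  shows "norbits (rot n) {..<n} = 1"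
proof -
  have "k < n \<Longrightarrow> k \<in> orbit (rot n) 0" for k
  proof (induction k)
    case 0
    then show ?case using self_in_orbit[OF rot_permutes] by blast
  next
    case (Suc k)
    then have "rot n k \<in> orbit (rot n) 0" by (auto intro: orbit.step)
    moreover have "rot n k = Suc k" using Suc.prems by (simp add: rot_def)
    ultimately show ?case by simp
  qed
  then have "orbit (rot n) ` {..<n} = {orbit (rot n) 0}"
    using orbit_eq[OF rot_permutes, of n] assms by auto
  then show ?thesis by (simp add: norbits_def)
qed

text \<open>Gluing the paired edges of an \<open>n\<close>-gon identifies its vertices along the orbits of \<open>glue n \<pi>\<close>; the
  least element of an orbit serves as its representative.\<close>

definition glue :: "nat \<Rightarrow> (nat \<Rightarrow> nat) \<Rightarrow> nat \<Rightarrow> nat" where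
  "glue n \<pi> = rot n \<circ> \<pi>"

lemma glue_permutes: "\<pi> \<in> pairings {..<n} \<Longrightarrow> glue n \<pi> permutes {..<n}"
  unfolding glue_def by (intro permutes_compose rot_permutes pairingsD(1))

lemma glue_eq: "\<pi> \<in> pairings {..<n} \<Longrightarrow> p < n \<Longrightarrow> glue n \<pi> p = Suc (\<pi> p) mod n"
  using pairingsD(4)[of \<pi> "{..<n}" p] by (simp add: glue_def rot_def)

text \<open>The number \<open>V\<close> of vertices of the closed surface obtained by gluing the
  sides of the polygon.\<close>

definition nvert :: "nat \<Rightarrow> (nat \<Rightarrow> nat) \<Rightarrow> nat" where
  "nvert n \<pi> = norbits (glue n \<pi>) {..<n}"

text \<open>\<open>(-1)^V\<close> is the sign of \<open>glue\<close>, as the number of points is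
  even; \<open>rot\<close> is a cycle of even length and has sign \<open>-1\<close>, and
  \<open>\<pi>\<close> is a product of \<open>l\<close> transpositions. Topologically,
  \<open>V - l + 1\<close> is the even Euler characteristic of the glued surface.\<close>

lemma nvert_parity:
  assumes "\<pi> \<in> pairings {..<2 * l}" "l > 0"
  shows "even (nvert (2 * l) \<pi> + l + 1)"
proof -
  let ?n = "2 * l"
  have "permutation (rot ?n)" by (rule permutation_of_permutes[OF rot_permutes]) simp
  moreover have "permutation \<pi>" by (rule permutation_of_permutes[OF pairingsD(1)[OF assms(1)]]) simp
  ultimately have "sign (glue ?n \<pi>) = sign (rot ?n) * sign \<pi>"
    unfolding glue_def by (rule sign_compose)
  moreover have "sign (rot ?n) = -1" using sign_norbits[OF _ rot_permutes, of ?n] norbits_rot[of ?n] assms by simp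
  moreover have "sign \<pi> = (-1) ^ l" using sign_pairing[OF _ assms(1)] by simp
  moreover have "sign (glue ?n \<pi>) = (-1) ^ nvert ?n \<pi>"
    using sign_norbits[OF _ glue_permutes[OF assms(1)]] by (simp add: nvert_def power_add)
  ultimately have "(-1::int) ^ nvert ?n \<pi> = (-1) ^ Suc l" by simp
  then show ?thesis by (cases "even (nvert ?n \<pi>)"; cases "even l") auto
qed

section \<open>Least representatives of the glued vertices\<close>

definition vrep :: "nat \<Rightarrow> (nat \<Rightarrow> nat) \<Rightarrow> nat \<Rightarrow> nat" where
  "vrep n \<pi> p = Min (orbit (glue n \<pi>) p)"

definition vreps :: "nat \<Rightarrow> (nat \<Rightarrow> nat) \<Rightarrow> nat set" where
  "vreps n \<pi> = vrep n \<pi> ` {..<n}"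

text \<open>A vertex is first reached either as the starting point or by the first of two paired steps.\<close>

definition cands :: "nat \<Rightarrow> (nat \<Rightarrow> nat) \<Rightarrow> nat set" where
  "cands n \<pi> = insert 0 (Suc ` {k. k < n \<and> k < \<pi> k})"

context
  fixes n \<pi> assumes \<pi>: "\<pi> \<in> pairings {..<n::nat}"
begin

lemma orbit_glue_subset: "p < n \<Longrightarrow> orbit (glue n \<pi>) p \<subseteq> {..<n}"
  using permutes_orbit_subset[OF glue_permutes[OF \<pi>]] by auto

lemma vrep_props:
  assumes "p < n"
  shows "vrep n \<pi> p \<in> orbit (glue n \<pi>) p" "vrep n \<pi> p \<le> p" "vrep n \<pi> p < n"
    "orbit (glue n \<pi>) (vrep n \<pi> p) = orbit (glue n \<pi>) p" "vrep n \<pi> (vrep n \<pi> p) = vrep n \<pi> p"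
proof -
  note s = self_in_orbit[OF glue_permutes[OF \<pi>], of p]
  have fin: "finite (orbit (glue n \<pi>) p)" using orbit_glue_subset[OF assms] finite_subset by blast
  show 1: "vrep n \<pi> p \<in> orbit (glue n \<pi>) p" unfolding vrep_def using fin s by (intro Min_in) auto
  show "vrep n \<pi> p \<le> p" unfolding vrep_def using fin s by (intro Min_le) auto
  then show "vrep n \<pi> p < n" using assms by simp
  show 2: "orbit (glue n \<pi>) (vrep n \<pi> p) = orbit (glue n \<pi>) p"
    by (rule orbit_eq[OF glue_permutes[OF \<pi>] _ 1]) simp
  then show "vrep n \<pi> (vrep n \<pi> p) = vrep n \<pi> p" by (simp add: vrep_def)
qed

text \<open>The end of step \<open>\<pi> p\<close> is the start of step \<open>p\<close>, as the two
  run oppositely. Applied to \<open>\<pi> p\<close>, it identifies the end of step \<open>p\<close>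
  with the start of its partner.\<close>

lemma vrep_glue: "p < n \<Longrightarrow> vrep n \<pi> (Suc (\<pi> p) mod n) = vrep n \<pi> p"
  using orbit_step_eq[OF glue_permutes[OF \<pi>], of p] by (simp add: vrep_def glue_eq[OF \<pi>])

lemma card_vreps: "card (vreps n \<pi>) = nvert n \<pi>"
proof -
  have "vreps n \<pi> = Min ` orbit (glue n \<pi>) ` {..<n}" by (auto simp: vreps_def vrep_def)
  moreover have "inj_on Min (orbit (glue n \<pi>) ` {..<n})"
  proof (rule inj_onI)
    fix A B assume "A \<in> orbit (glue n \<pi>) ` {..<n}" "B \<in> orbit (glue n \<pi>) ` {..<n}" "Min A = Min B"
    then obtain p q where "p < n" "q < n" "A = orbit (glue n \<pi>) p" "B = orbit (glue n \<pi>) q" "vrep n \<pi> p = vrep n \<pi> q"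
      by (auto simp: vrep_def)
    then show "A = B" using vrep_props(4) by metis
  qed
  ultimately show ?thesis by (simp add: nvert_def norbits_def card_image)
qed

lemma vreps_props:
  "r \<in> vreps n \<pi> \<longleftrightarrow> r < n \<and> vrep n \<pi> r = r" "vreps n \<pi> \<subseteq> {..<n}" "finite (vreps n \<pi>)"
  "p < n \<Longrightarrow> vrep n \<pi> p \<in> vreps n \<pi>"
proof -
  show 1: "r \<in> vreps n \<pi> \<longleftrightarrow> r < n \<and> vrep n \<pi> r = r" for r
  proof
    assume "r \<in> vreps n \<pi>"
    then obtain p where "p < n" "r = vrep n \<pi> p" by (auto simp: vreps_def)
    then show "r < n \<and> vrep n \<pi> r = r" using vrep_props(3,5) by simp
  next
    assume "r < n \<and> vrep n \<pi> r = r"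
    then show "r \<in> vreps n \<pi>" by (metis vreps_def image_eqI lessThan_iff)
  qed
  show "vreps n \<pi> \<subseteq> {..<n}" using 1 by blast
  show "finite (vreps n \<pi>)" by (simp add: vreps_def)
  show "p < n \<Longrightarrow> vrep n \<pi> p \<in> vreps n \<pi>" by (simp add: vreps_def)
qed

lemma card_cands: "card (cands n \<pi>) = Suc (n div 2)"
proof -
  have "2 * card {i\<in>{..<n}. i < \<pi> i} = n" using card_openers[OF \<pi>] by simp
  moreover have "{i\<in>{..<n}. i < \<pi> i} = {k. k < n \<and> k < \<pi> k}" by auto
  ultimately have "card {k. k < n \<and> k < \<pi> k} = n div 2" by (metis nonzero_mult_div_cancel_left zero_neq_numeral)
  then show ?thesis unfolding cands_def by (subst card_insert_disjoint) (auto simp: card_image)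
qed

text \<open>If a representative \<open>Suc k\<close> were the end of a closing step
  \<open>k\<close>, it would be glued to the start of the partner \<open>\<pi> k < k\<close>,
  contradicting its minimality.\<close>

lemma vreps_subset_cands: "vreps n \<pi> \<subseteq> cands n \<pi>"
proof
  fix p assume "p \<in> vreps n \<pi>"
  then have p: "p < n" "vrep n \<pi> p = p" using vreps_props(1) by auto
  show "p \<in> cands n \<pi>"
  proof (cases p)
    case (Suc k)
    have "k < \<pi> k"
    proof (rule ccontr)
      assume "\<not> k < \<pi> k"
      then have lt: "\<pi> k < k" using pairingsD(3)[OF \<pi>, of k] p Suc by auto
      then have "\<pi> k < n" using p Suc by simp
      then have "vrep n \<pi> (\<pi> k) = vrep n \<pi> p" using vrep_glue[of "\<pi> k"] pairingsD(2)[OF \<pi>] p Suc by simp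
      then show False using vrep_props(2)[OF \<open>\<pi> k < n\<close>] lt p Suc by simp
    qed
    then show ?thesis using p Suc by (auto simp: cands_def)
  qed (simp add: cands_def)
qed

lemma nvert_le: "nvert n \<pi> \<le> Suc (n div 2)"
proof -
  have "finite (cands n \<pi>)" using card_cands by (metis card.infinite nat.distinct(1))
  then show ?thesis using card_mono[OF _ vreps_subset_cands] card_vreps card_cands by simp
qed

end

section \<open>Crossings and the number of walks\<close>

definition noncrossing :: "'i::linorder set \<Rightarrow> ('i \<Rightarrow> 'i) \<Rightarrow> bool" where
  "noncrossing S \<pi> \<longleftrightarrow> \<not> (\<exists>i\<in>S. \<exists>j\<in>S. i < j \<and> j < \<pi> i \<and> \<pi> i < \<pi> j)"

lemma finite_cands: "\<pi> \<in> pairings {..<n} \<Longrightarrow> finite (cands n \<pi>)"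
  using card_cands by (metis card.infinite nat.distinct(1))

text \<open>The earliest chord that is closed while a later one is still open glues together two points
  of \<^const>\<open>cands\<close>.\<close>

lemma crossing_nvert:
  assumes \<pi>: "\<pi> \<in> pairings {..<n}" and c: "\<not> noncrossing {..<n} \<pi>"
  shows "nvert n \<pi> \<le> n div 2"
proof -
  note d = pairingsD[OF \<pi>]
  \<comment> \<open>At step \<open>k\<close> a chord closes over the starting step \<open>j\<close>
    of a chord that is still open.\<close>
  define Q where "Q k \<longleftrightarrow> k < n \<and> (\<exists>j. \<pi> k < j \<and> j < k \<and> k < \<pi> j)" for k
  obtain i0 j0 where ij: "i0 < n" "j0 < n" "i0 < j0" "j0 < \<pi> i0" "\<pi> i0 < \<pi> j0"
    using c by (auto simp: noncrossing_def)
  have "Q (\<pi> i0)" using ij d(2)[of i0] d(4)[of i0] unfolding Q_def by auto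
  define k where "k = (LEAST k. Q k)"
  have "Q k" unfolding k_def using \<open>Q (\<pi> i0)\<close> by (rule LeastI)
  then obtain j where kj: "k < n" "\<pi> k < j" "j < k" "k < \<pi> j" by (auto simp: Q_def)
  have minimal: "\<not> Q q" if "q < k" for q using that not_less_Least unfolding k_def by blast
  \<comment> \<open>A descent inside one orbit: if the step ending at \<open>p\<close> closes a
    chord, \<open>p\<close> is glued to the start of that chord, which by minimality of
    \<open>k\<close> still lies beyond \<open>j\<close>. The descent stops at a candidate.\<close>
  have claim: "\<exists>r\<in>cands n \<pi>. j < r \<and> vrep n \<pi> r = vrep n \<pi> p" if "j < p" "p \<le> k" for p
    using that
  proof (induction p rule: less_induct)
    case (less p)
    obtain q where q: "p = Suc q" using less.prems by (cases p) auto
    show ?case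
    proof (cases "q < \<pi> q")
      case True
      then have "p \<in> cands n \<pi>" using q less.prems kj by (auto simp: cands_def)
      then show ?thesis using less.prems by blast
    next
      case False
      have qn: "q < n" "q < k" using q less.prems kj by auto
      have lt: "\<pi> q < q" using False d(3)[of q] qn by (auto simp: neq_iff)
      have "q \<noteq> j" using lt kj by auto
      then have jq: "j < q" using less.prems q by auto
      have "\<not> \<pi> q < j" using minimal[OF qn(2)] jq kj qn unfolding Q_def by (meson order.strict_trans)
      moreover have "\<pi> q \<noteq> j" using d(2)[of q] kj qn by auto
      ultimately have jp: "j < \<pi> q" by auto
      have "vrep n \<pi> p = vrep n \<pi> (\<pi> q)"
        using vrep_glue[OF \<pi>, of "\<pi> q"] d(2)[of q] lt qn q less.prems kj by simp
      then show ?thesis using less.IH[of "\<pi> q"] jp lt q less.prems by auto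
    qed
  qed
  obtain r where r: "r \<in> cands n \<pi>" "j < r" "vrep n \<pi> r = vrep n \<pi> k" using claim[of k] kj by auto
  \<comment> \<open>The orbit of \<open>k\<close> also contains
    \<open>Suc (\<pi> k) \<le> j\<close>, so the candidate \<open>r > j\<close> is not its least
    element.\<close>
  have "vrep n \<pi> (Suc (\<pi> k)) = vrep n \<pi> k" using vrep_glue[OF \<pi>, of k] kj by simp
  then have "vrep n \<pi> r \<le> Suc (\<pi> k)" using r vrep_props(2)[OF \<pi>, of "Suc (\<pi> k)"] kj by simp
  then have "r \<notin> vreps n \<pi>" using r(2) kj vreps_props(1)[OF \<pi>] by auto
  then have "vreps n \<pi> \<subset> cands n \<pi>" using r(1) vreps_subset_cands[OF \<pi>] by blast
  then have "card (vreps n \<pi>) < card (cands n \<pi>)" by (rule psubset_card_mono[OF finite_cands[OF \<pi>]])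
  then show ?thesis using card_vreps[OF \<pi>] card_cands[OF \<pi>] by simp
qed

text \<open>\<open>{i, a}\<close> and \<open>{p, q}\<close> are chords, and the last four hypotheses
  forbid them to cross; if they are distinct, \<open>p\<close> and \<open>q\<close> therefore lie
  both under \<open>{i, a}\<close> or both outside. The half-open form \<open>i < p \<le> a\<close>
  gives agreement also when they coincide.\<close>

lemma chord_order: 
  fixes a q i p :: nat
  assumes "a = p \<longleftrightarrow> i = q" "a = q \<longleftrightarrow> i = p" "q \<noteq> p" 
    and "\<not> (i < p \<and> p < a \<and> a < q)" "\<not> (p < i \<and> i < q \<and> q < a)" "\<not> (q < i \<and> i < p \<and> p < a)" "\<not> (i < q \<and> q < a \<and> a < p)"
  shows "(i < Suc q \<and> Suc q \<le> a) = (i < p \<and> p \<le> a)"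
proof (cases "i = p \<or> i = q")
  case True then show ?thesis using assms(1,2,3) by auto
next
  case False
  then have "a \<noteq> p" "a \<noteq> q" using assms by auto
  then have "(i < q \<and> q < a) = (i < p \<and> p < a)" using False assms(4-7) by (metis linorder_neqE_nat)
  with False \<open>a \<noteq> p\<close> show ?thesis by (auto simp: less_Suc_eq Suc_le_eq le_less)
qed

text \<open>If there is no crossing, the set of chords above a point is constant on orbits.\<close>

lemma noncrossing_nvert:
  assumes \<pi>: "\<pi> \<in> pairings {..<n}" and nc: "noncrossing {..<n} \<pi>" and n: "n > 0"
  shows "nvert n \<pi> = Suc (n div 2)"
proof -
  note d = pairingsD[OF \<pi>]
  \<comment> \<open>Point \<open>p\<close> lies between the steps \<open>p - 1\<close> and
    \<open>p\<close>, so the chord opened at \<open>i\<close> passes over it iff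
    \<open>i < p \<le> \<pi> i\<close>.\<close>
  define cover where "cover p = {i. i < n \<and> i < p \<and> p \<le> \<pi> i}" for p
  have ncD: "\<not> (i < j \<and> j < \<pi> i \<and> \<pi> i < \<pi> j)" if "i < n" "j < n" for i j
    using nc that unfolding noncrossing_def by blast
  have c1: "cover (Suc (\<pi> p)) = cover p" if p: "p < n" for p
  proof -
    have "(i < Suc (\<pi> p) \<and> Suc (\<pi> p) \<le> \<pi> i) = (i < p \<and> p \<le> \<pi> i)" if i: "i < n" for i
    proof -
      have pn: "\<pi> p < n" using d(4)[of p] p by simp
      have "\<pi> i = p \<longleftrightarrow> i = \<pi> p" "\<pi> i = \<pi> p \<longleftrightarrow> i = p" using d(2) by metis+
      moreover have "\<pi> p \<noteq> p" using d(3)[of p] p by simp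
      moreover note ncD[OF i p] ncD[OF p i] ncD[OF pn i, unfolded d(2)] ncD[OF i pn, unfolded d(2)]
      ultimately show ?thesis by (rule chord_order)
    qed
    then show ?thesis unfolding cover_def by blast
  qed
  \<comment> \<open>Point \<open>n\<close> is point \<open>0\<close>; no chord passes over either,
    so the invariance survives the reduction modulo \<open>n\<close>.\<close>
  have c0: "cover 0 = {}" "cover n = {}"
    using d(4) by (auto simp: cover_def not_le)
  have inv: "cover (glue n \<pi> p) = cover p" if p: "p < n" for p
  proof (cases "Suc (\<pi> p) = n")
    case True
    then show ?thesis using c1[OF p] c0 glue_eq[OF \<pi> p] by simp
  next
    case False
    moreover have "\<pi> p < n" using d(4)[of p] p by simp
    ultimately show ?thesis using c1[OF p] glue_eq[OF \<pi> p] by simp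
  qed
  have cv: "cover (vrep n \<pi> p) = cover p" if p: "p < n" for p
    using orbit_invariant[OF glue_permutes[OF \<pi>], of p cover "vrep n \<pi> p"] inv vrep_props(1)[OF \<pi> p] p by simp
  have sub: "cands n \<pi> \<subseteq> {..<n}"
  proof -
    have "Suc k < n" if "k < n" "k < \<pi> k" for k using d(4)[of k] that by auto
    then show ?thesis using n by (auto simp: cands_def)
  qed
  \<comment> \<open>The later candidate \<open>Suc k\<close> lies under the chord opened at
    \<open>k\<close>, the earlier one does not.\<close>
  have inj: "inj_on cover (cands n \<pi>)"
  proof (rule linorder_inj_onI)
    fix r r' assume r: "r < r'" "r \<in> cands n \<pi>" "r' \<in> cands n \<pi>"
    then obtain k where k: "r' = Suc k" "k < n" "k < \<pi> k" by (auto simp: cands_def)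
    then have "k \<in> cover r'" "k \<notin> cover r" using r by (auto simp: cover_def)
    then show "cover r \<noteq> cover r'" by auto
  qed auto
  have "cover ` cands n \<pi> \<subseteq> cover ` vreps n \<pi>"
  proof
    fix A assume "A \<in> cover ` cands n \<pi>"
    then obtain p where p: "p < n" "A = cover p" using sub by auto
    then show "A \<in> cover ` vreps n \<pi>" using cv vreps_props(4)[OF \<pi>] by (metis image_eqI)
  qed
  then have "card (cover ` cands n \<pi>) \<le> card (vreps n \<pi>)"
    by (meson card_image_le card_mono finite_imageI le_trans vreps_props(3)[OF \<pi>])
  then have "Suc (n div 2) \<le> nvert n \<pi>" using card_image[OF inj] card_vreps[OF \<pi>] card_cands[OF \<pi>] by simp
  then show ?thesis using nvert_le[OF \<pi>] by simp
qed

lemma crossing_nvert_le: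
  assumes "\<pi> \<in> pairings {..<2 * l}" "\<not> noncrossing {..<2 * l} \<pi>"
  shows "Suc (nvert (2 * l) \<pi>) \<le> l"
proof -
  have "l > 0" using assms(2) by (cases l) (auto simp: noncrossing_def)
  have "nvert (2 * l) \<pi> \<le> l" using crossing_nvert[OF assms] by simp
  moreover have "nvert (2 * l) \<pi> \<noteq> l" using nvert_parity[OF assms(1) \<open>l > 0\<close>] by auto
  ultimately show ?thesis by simp
qed

section \<open>The cyclic distance, and counting walks along a spanning tree\<close>

lemma cyclic_dist_sym: "cyclic_dist N j k = cyclic_dist N k j"
  by (simp add: cyclic_dist_def abs_minus_commute)

text \<open>The cyclic distance is the least absolute value among the integers representing the
  difference modulo \<open>N\<close>. This form serves both the count of a band and the lifting of
  walks.\<close>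

lemma cyclic_dist_le_iff:
  assumes "j < N" "k < N"
  shows "cyclic_dist N j k \<le> int b \<longleftrightarrow> (\<exists>t. \<bar>int k - int j + t * int N\<bar> \<le> int b)"
proof
  assume "cyclic_dist N j k \<le> int b"
  then consider "\<bar>int j - int k\<bar> \<le> int b" | "int N - \<bar>int j - int k\<bar> \<le> int b"
    by (auto simp: cyclic_dist_def min_def split: if_splits)
  then show "\<exists>t. \<bar>int k - int j + t * int N\<bar> \<le> int b"
  proof cases
    case 1 then show ?thesis by (intro exI[of _ 0]) auto
  next
    case 2
    show ?thesis
    proof (cases "j \<le> k")
      case True then show ?thesis using 2 assms by (intro exI[of _ "-1"]) auto
    next
      case False then show ?thesis using 2 assms by (intro exI[of _ "1"]) auto
    qed
  qed
next
  assume "\<exists>t. \<bar>int k - int j + t * int N\<bar> \<le> int b"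
  then obtain t where t: "\<bar>int k - int j + t * int N\<bar> \<le> int b" by auto
  show "cyclic_dist N j k \<le> int b"
  proof (rule ccontr)
    assume "\<not> ?thesis"
    then have n: "\<bar>int j - int k\<bar> > int b" "int N - \<bar>int j - int k\<bar> > int b" by (auto simp: cyclic_dist_def)
    consider "t = 0" | "t \<ge> 1" | "t \<le> -1" by linarith
    then show False
    proof cases
      case 1 then show False using t n by auto
    next
      case 2
      then have "1 * int N \<le> t * int N" by (intro mult_right_mono) auto
      then show False using t n by linarith
    next
      case 3
      then have "t * int N \<le> (-1) * int N" by (intro mult_right_mono) auto
      then show False using t n by auto
    qed
  qed
qed

text \<open>All vertices have equally many neighbours, also when the band wraps around; this makes
  the noncrossing count exact for every \<open>b\<close>.\<close>

lemma card_band: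
  assumes "v < N"
  shows "card {w\<in>{..<N}. cyclic_dist N v w \<le> int b} = band_norm N b"
proof (cases "N \<le> 2 * b + 1")
  case True
  have "cyclic_dist N v w \<le> int b" for w
  proof -
    have "\<bar>int v - int w\<bar> \<le> int b \<or> int N - \<bar>int v - int w\<bar> \<le> int b" using True by linarith
    then show ?thesis by (auto simp: cyclic_dist_def)
  qed
  then have "{w\<in>{..<N}. cyclic_dist N v w \<le> int b} = {..<N}" by auto
  then show ?thesis using True by (simp add: band_norm_def)
next
  case False
  define g where "g t = nat ((int v + t) mod int N)" for t
  have gN: "int (g t) = (int v + t) mod int N" for t using assms by (simp add: g_def)
  have "g ` {- int b..int b} = {w\<in>{..<N}. cyclic_dist N v w \<le> int b}"
  proof (intro Set.set_eqI iffI)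
    fix w assume "w \<in> g ` {- int b..int b}"
    then obtain t where t: "w = g t" "\<bar>t\<bar> \<le> int b" by auto
    have w: "w < N" using gN[of t] t assms by (metis of_nat_less_iff pos_mod_bound of_nat_0_less_iff gr_implies_not0 not_gr_zero)
    have "int w - int v + ((int v + t) div int N) * int N = t"
      using gN[of t] t(1) by (simp add: minus_div_mult_eq_mod[symmetric])
    then have "\<exists>s. \<bar>int w - int v + s * int N\<bar> \<le> int b" using t(2) by metis
    then show "w \<in> {w\<in>{..<N}. cyclic_dist N v w \<le> int b}" using cyclic_dist_le_iff[OF assms w] w by simp
  next
    fix w assume "w \<in> {w\<in>{..<N}. cyclic_dist N v w \<le> int b}"
    then have w: "w < N" and "\<exists>t. \<bar>int w - int v + t * int N\<bar> \<le> int b" using cyclic_dist_le_iff[OF assms] by auto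
    then obtain t where t: "\<bar>int w - int v + t * int N\<bar> \<le> int b" by auto
    have "int (g (int w - int v + t * int N)) = int w" unfolding gN using w by (simp add: algebra_simps)
    then have "g (int w - int v + t * int N) = w" by simp
    moreover have "int w - int v + t * int N \<in> {- int b..int b}" using t by auto
    ultimately show "w \<in> g ` {- int b..int b}" by (metis image_eqI)
  qed
  moreover have "inj_on g {- int b..int b}"
  proof (rule inj_onI)
    fix s t assume st: "s \<in> {- int b..int b}" "t \<in> {- int b..int b}" "g s = g t"
    then have "(int v + s) mod int N = (int v + t) mod int N" using gN by metis
    then have "int N dvd s - t" by (metis add_diff_cancel_left mod_eq_dvd_iff)
    moreover have "\<bar>s - t\<bar> < int N" using st False by auto
    ultimately show "s = t" using zdvd_imp_le[of "int N" "\<bar>s - t\<bar>"] by auto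
  qed
  ultimately have "card {w\<in>{..<N}. cyclic_dist N v w \<le> int b} = card {- int b..int b}" by (metis card_image)
  then show ?thesis using False by (simp add: band_norm_def nat_add_distrib)
qed

text \<open>\<open>par\<close> describes a tree rooted at \<open>0\<close> whose labels increase
  away from the root. The largest label is a leaf, for which exactly \<open>band_norm N b\<close>
  positions are left; the root has \<open>N\<close>.\<close>

lemma card_tree_maps:
  fixes R :: "nat set"
  assumes "finite R" "0 \<in> R" "\<And>r. r \<in> R \<Longrightarrow> r \<noteq> 0 \<Longrightarrow> par r \<in> R \<and> par r < r"
  shows "card {y\<in>R \<rightarrow>\<^sub>E {..<N}. \<forall>r\<in>R-{0}. cyclic_dist N (y (par r)) (y r) \<le> int b} = N * band_norm N b ^ (card R - 1)"
  using assms
proof (induction R rule: finite_linorder_max_induct)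
  case empty then show ?case by simp
next
  case (insert m R)
  define Y where "Y R = {y\<in>R \<rightarrow>\<^sub>E {..<N}. \<forall>r\<in>R-{0}. cyclic_dist N (y (par r)) (y r) \<le> int b}" for R
  have finY: "finite (Y R)" unfolding Y_def
    by (rule finite_subset[OF _ finite_PiE[of R "\<lambda>_. {..<N}"]]) (use insert.hyps in auto)
  show ?case
  proof (cases "R = {}")
    case True
    then have m: "m = 0" using insert.prems by auto
    have "Y {0} = {0} \<rightarrow>\<^sub>E {..<N}" by (auto simp: Y_def)
    then show ?thesis unfolding True m Y_def by (simp add: card_PiE)
  next
    case False
    have mR: "m \<notin> R" using insert.hyps by auto
    have "0 < m" using False insert.hyps by (metis ex_in_conv not_gr_zero not_less_zero)
    then have zR: "0 \<in> R" using insert.prems by auto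
    have par: "par r \<in> R \<and> par r < r" if "r \<in> R" "r \<noteq> 0" for r
    proof -
      have "par r \<in> insert m R" "par r < r" "r < m" using insert.prems(2)[of r] insert.hyps that by auto
      then show ?thesis by auto
    qed
    have pm: "par m \<in> R" using insert.prems(2)[of m] \<open>0 < m\<close> by auto
    have IH: "card (Y R) = N * band_norm N b ^ (card R - 1)" unfolding Y_def by (rule insert.IH[OF zR par])
    have "bij_betw (\<lambda>(y, w). y(m := w)) (SIGMA y:Y R. {w\<in>{..<N}. cyclic_dist N (y (par m)) w \<le> int b}) (Y (insert m R))"
    proof (rule bij_betw_byWitness[where f' = "\<lambda>y. (restrict y R, y m)"])
      show "\<forall>p\<in>SIGMA y:Y R. {w\<in>{..<N}. cyclic_dist N (y (par m)) w \<le> int b}.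
        (restrict (case p of (y, w) \<Rightarrow> y(m := w)) R, (case p of (y, w) \<Rightarrow> y(m := w)) m) = p"
        using mR by (auto simp: Y_def fun_eq_iff PiE_iff extensional_def)
      show "\<forall>y\<in>Y (insert m R). (case (restrict y R, y m) of (y, w) \<Rightarrow> y(m := w)) = y"
        by (auto simp: Y_def fun_eq_iff PiE_iff extensional_def)
      show "(\<lambda>(y, w). y(m := w)) ` (SIGMA y:Y R. {w\<in>{..<N}. cyclic_dist N (y (par m)) w \<le> int b}) \<subseteq> Y (insert m R)"
      proof
        fix z assume "z \<in> (\<lambda>(y, w). y(m := w)) ` (SIGMA y:Y R. {w\<in>{..<N}. cyclic_dist N (y (par m)) w \<le> int b})"
        then obtain y w where z: "z = y(m := w)" "y \<in> Y R" "w < N" "cyclic_dist N (y (par m)) w \<le> int b" by auto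
        have "cyclic_dist N (z (par r)) (z r) \<le> int b" if "r \<in> insert m R - {0}" for r
        proof (cases "r = m")
          case True then show ?thesis using z pm mR by auto
        next
          case False
          then have "r \<in> R" "r \<noteq> 0" using that by auto
          then show ?thesis using z par[of r] mR False by (auto simp: Y_def)
        qed
        then show "z \<in> Y (insert m R)" using z by (auto simp: Y_def PiE_iff extensional_def)
      qed
      show "(\<lambda>y. (restrict y R, y m)) ` Y (insert m R) \<subseteq> (SIGMA y:Y R. {w\<in>{..<N}. cyclic_dist N (y (par m)) w \<le> int b})"
      proof
        fix p assume "p \<in> (\<lambda>y. (restrict y R, y m)) ` Y (insert m R)"
        then obtain y where y: "p = (restrict y R, y m)" "y \<in> Y (insert m R)" by auto
        have c: "cyclic_dist N (y (par r)) (y r) \<le> int b" if "r \<in> insert m R" "r \<noteq> 0" for r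
          using y(2) that by (simp add: Y_def)
        have "cyclic_dist N (restrict y R (par r)) (restrict y R r) \<le> int b" if "r \<in> R - {0}" for r
          using c[of r] par[of r] that by simp
        moreover have "restrict y R \<in> R \<rightarrow>\<^sub>E {..<N}" "y m < N" using y(2) by (auto simp: Y_def)
        ultimately show "p \<in> (SIGMA y:Y R. {w\<in>{..<N}. cyclic_dist N (y (par m)) w \<le> int b})"
          using c[of m] pm \<open>0 < m\<close> unfolding y(1) Y_def by simp
      qed
    qed
    then have "card (Y (insert m R)) = card (SIGMA y:Y R. {w\<in>{..<N}. cyclic_dist N (y (par m)) w \<le> int b})"
      by (rule bij_betw_same_card[symmetric])
    also have "\<dots> = (\<Sum>y\<in>Y R. card {w\<in>{..<N}. cyclic_dist N (y (par m)) w \<le> int b})"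
      using finY by (intro card_SigmaI) auto
    also have "\<dots> = (\<Sum>y\<in>Y R. band_norm N b)"
    proof (intro sum.cong refl card_band)
      show "y (par m) < N" if "y \<in> Y R" for y using that pm by (auto simp: Y_def PiE_iff)
    qed
    also have "\<dots> = N * band_norm N b ^ (card (insert m R) - 1)"
    proof -
      have "card R \<noteq> 0" using False insert.hyps by auto
      then show ?thesis using IH mR insert.hyps by (cases "card R") auto
    qed
    finally show ?thesis unfolding Y_def .
  qed
qed

text \<open>The pairing condition says that a walk is constant on the orbits of \<open>glue\<close>,
  so the values at the least representatives determine it, and only the band condition
  remains.\<close>

lemma card_band_walks_reduce:
  assumes \<pi>: "\<pi> \<in> pairings {..<n}"
  shows "card (band_walks N b n \<pi>) =
    card {y\<in>vreps n \<pi> \<rightarrow>\<^sub>E {..<N}. \<forall>k<n. cyclic_dist N (y (vrep n \<pi> k)) (y (vrep n \<pi> (Suc k mod n))) \<le> int b}"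
    (is "_ = card ?Y")
proof -
  note d = pairingsD[OF \<pi>]
  have xv: "x (vrep n \<pi> p) = x p" if "x \<in> band_walks N b n \<pi>" "p < n" for x p
  proof -
    have "x (glue n \<pi> q) = x q" if "q < n" for q
    proof -
      have "\<pi> q < n" using d(4)[of q] that by simp
      then have "x (\<pi> (\<pi> q)) = x (Suc (\<pi> q) mod n)" using \<open>x \<in> band_walks N b n \<pi>\<close> unfolding band_walks_def by blast
      then show ?thesis using d(2) glue_eq[OF \<pi> that] by simp
    qed
    then show ?thesis
      using orbit_invariant[OF glue_permutes[OF \<pi>], of p x "vrep n \<pi> p"] vrep_props(1)[OF \<pi> \<open>p < n\<close>] \<open>p < n\<close> by simp
  qed
  have R: "vreps n \<pi> \<subseteq> {..<n}" by (rule vreps_props(2)[OF \<pi>])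
  have "bij_betw (\<lambda>x. restrict x (vreps n \<pi>)) (band_walks N b n \<pi>) ?Y"
  proof (rule bij_betw_byWitness[where f' = "\<lambda>y. \<lambda>k\<in>{..<n}. y (vrep n \<pi> k)"])
    show "\<forall>x\<in>band_walks N b n \<pi>. (\<lambda>k\<in>{..<n}. restrict x (vreps n \<pi>) (vrep n \<pi> k)) = x"
    proof
      fix x assume x: "x \<in> band_walks N b n \<pi>"
      then have "x \<in> extensional {..<n}" by (auto simp: band_walks_def PiE_iff)
      then show "(\<lambda>k\<in>{..<n}. restrict x (vreps n \<pi>) (vrep n \<pi> k)) = x"
        using xv[OF x] vreps_props(4)[OF \<pi>] by (auto simp: fun_eq_iff extensional_def)
    qed
    show "\<forall>y\<in>?Y. restrict (\<lambda>k\<in>{..<n}. y (vrep n \<pi> k)) (vreps n \<pi>) = y"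
    proof
      fix y assume "y \<in> ?Y"
      then have "y \<in> extensional (vreps n \<pi>)" by (auto simp: PiE_iff)
      then show "restrict (\<lambda>k\<in>{..<n}. y (vrep n \<pi> k)) (vreps n \<pi>) = y"
        using vreps_props(1)[OF \<pi>] by (auto simp: fun_eq_iff extensional_def)
    qed
    show "(\<lambda>x. restrict x (vreps n \<pi>)) ` band_walks N b n \<pi> \<subseteq> ?Y"
    proof
      fix y assume "y \<in> (\<lambda>x. restrict x (vreps n \<pi>)) ` band_walks N b n \<pi>"
      then obtain x where x: "x \<in> band_walks N b n \<pi>" "y = restrict x (vreps n \<pi>)" by auto
      have "y (vrep n \<pi> k) = x k" if "k < n" for k using xv[OF x(1) that] vreps_props(4)[OF \<pi> that] x(2) by simp
      moreover have "Suc k mod n < n" if "k < n" for k using that by simp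
      ultimately have "\<forall>k<n. cyclic_dist N (y (vrep n \<pi> k)) (y (vrep n \<pi> (Suc k mod n))) \<le> int b"
        using x(1) unfolding band_walks_def by simp
      moreover have "y \<in> vreps n \<pi> \<rightarrow>\<^sub>E {..<N}" using x R by (auto simp: band_walks_def)
      ultimately show "y \<in> ?Y" by simp
    qed
    show "(\<lambda>y. \<lambda>k\<in>{..<n}. y (vrep n \<pi> k)) ` ?Y \<subseteq> band_walks N b n \<pi>"
    proof
      fix x assume "x \<in> (\<lambda>y. \<lambda>k\<in>{..<n}. y (vrep n \<pi> k)) ` ?Y"
      then obtain y where y: "y \<in> ?Y" "x = (\<lambda>k\<in>{..<n}. y (vrep n \<pi> k))" by auto
      have xk: "x k = y (vrep n \<pi> k)" if "k < n" for k using that y(2) by simp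
      have xP: "x \<in> {..<n} \<rightarrow>\<^sub>E {..<N}" using y vreps_props(4)[OF \<pi>] by (auto simp: PiE_iff)
      have "x (\<pi> k) = x (Suc k mod n) \<and> cyclic_dist N (x k) (x (Suc k mod n)) \<le> int b" if k: "k < n" for k
      proof -
        have k': "\<pi> k < n" "Suc k mod n < n" using d(4)[of k] k by auto
        have "vrep n \<pi> (Suc k mod n) = vrep n \<pi> (\<pi> k)" using vrep_glue[OF \<pi> k'(1)] d(2) by simp
        then show ?thesis using xk[OF k] xk[OF k'(1)] xk[OF k'(2)] y(1) k by auto
      qed
      then show "x \<in> band_walks N b n \<pi>" using xP unfolding band_walks_def by blast
    qed
  qed
  then show ?thesis by (rule bij_betw_same_card)
qed

text \<open>Keeping only the band conditions along a spanning tree gives the upper bound. Without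
  crossings nothing is lost: each opening step is a tree edge, and each closing step retraces
  one.\<close>

lemma card_band_walks_le:
  assumes \<pi>: "\<pi> \<in> pairings {..<n}" and n: "n > 0"
  shows "card (band_walks N b n \<pi>) \<le> N * band_norm N b ^ (nvert n \<pi> - 1)"
    and "noncrossing {..<n} \<pi> \<Longrightarrow> card (band_walks N b n \<pi>) = N * band_norm N b ^ (n div 2)"
proof -
  note d = pairingsD[OF \<pi>]
  let ?R = "vreps n \<pi>"
  \<comment> \<open>A representative \<open>r\<close> is entered by step \<open>r - 1\<close>, which
    starts at an earlier vertex: these steps form the spanning tree.\<close>
  define par where "par r = vrep n \<pi> (r - 1)" for r
  let ?T = "{y\<in>?R \<rightarrow>\<^sub>E {..<N}. \<forall>r\<in>?R-{0}. cyclic_dist N (y (par r)) (y r) \<le> int b}"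
  let ?Y = "{y\<in>?R \<rightarrow>\<^sub>E {..<N}. \<forall>k<n. cyclic_dist N (y (vrep n \<pi> k)) (y (vrep n \<pi> (Suc k mod n))) \<le> int b}"
  have R0: "0 \<in> ?R" using vrep_props(2)[OF \<pi>, of 0] vreps_props(1)[OF \<pi>] n by auto
  have par: "par r \<in> ?R \<and> par r < r" if "r \<in> ?R" "r \<noteq> 0" for r
  proof -
    have "r < n" using that vreps_props(1)[OF \<pi>, of r] by simp
    then have "r - 1 < n" by simp
    then show ?thesis using vreps_props(4)[OF \<pi>] vrep_props(2)[OF \<pi>] that unfolding par_def
      by (metis One_nat_def Suc_pred diff_less le_imp_less_Suc less_Suc_eq_0_disj neq0_conv)
  qed
  have T: "card ?T = N * band_norm N b ^ (nvert n \<pi> - 1)"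
    using card_tree_maps[OF vreps_props(3)[OF \<pi>] R0 par, of N b] card_vreps[OF \<pi>] by simp
  have rk: "r - 1 < n" "vrep n \<pi> (Suc (r - 1) mod n) = r" if "r \<in> ?R - {0}" for r
    using that vreps_props(1)[OF \<pi>, of r] by auto
  have sub: "?Y \<subseteq> ?T"
  proof
    fix y assume y: "y \<in> ?Y"
    have "cyclic_dist N (y (par r)) (y r) \<le> int b" if r: "r \<in> ?R - {0}" for r
      using y rk[OF r] unfolding par_def by force
    then show "y \<in> ?T" using y by blast
  qed
  have finT: "finite ?T" by (rule finite_subset[OF _ finite_PiE[of ?R "\<lambda>_. {..<N}"]]) (auto simp: vreps_props(3)[OF \<pi>])
  show "card (band_walks N b n \<pi>) \<le> N * band_norm N b ^ (nvert n \<pi> - 1)"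
    unfolding card_band_walks_reduce[OF \<pi>] T[symmetric] by (rule card_mono[OF finT sub])
  assume nc: "noncrossing {..<n} \<pi>"
  have V: "nvert n \<pi> = Suc (n div 2)" by (rule noncrossing_nvert[OF \<pi> nc n])
  have "card ?R = card (cands n \<pi>)" using card_vreps[OF \<pi>] V card_cands[OF \<pi>] by simp
  \<comment> \<open>There are as many representatives as candidates, so every opening step ends at a
    new vertex.\<close>
  then have RC: "?R = cands n \<pi>" by (intro card_subset_eq finite_cands vreps_subset_cands \<pi>)
  have "?T \<subseteq> ?Y"
  proof
    fix y assume y: "y \<in> ?T"
    have op: "cyclic_dist N (y (vrep n \<pi> k)) (y (vrep n \<pi> (Suc k mod n))) \<le> int b" if k: "k < n" "k < \<pi> k" for k
    proof -
      have "Suc k \<in> ?R" unfolding RC using k by (auto simp: cands_def)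
      then have "Suc k \<in> ?R - {0}" "vrep n \<pi> (Suc k mod n) = Suc k" using vreps_props(1)[OF \<pi>, of "Suc k"] by auto
      moreover have "cyclic_dist N (y (par (Suc k))) (y (Suc k)) \<le> int b" using y calculation(1) by blast
      ultimately show ?thesis by (simp add: par_def)
    qed
    have "cyclic_dist N (y (vrep n \<pi> k)) (y (vrep n \<pi> (Suc k mod n))) \<le> int b" if k: "k < n" for k
    proof (cases "k < \<pi> k")
      case True then show ?thesis using op k by blast
    next
      case False
      define q where "q = \<pi> k"
      have q: "q < n" "q < \<pi> q" "\<pi> q = k"
        using d(2)[of k] d(3)[of k] d(4)[of k] k False by (auto simp: q_def neq_iff)
      have "vrep n \<pi> (Suc q mod n) = vrep n \<pi> k" using vrep_glue[OF \<pi> k] by (simp add: q_def)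
      moreover have "vrep n \<pi> (Suc k mod n) = vrep n \<pi> q" using vrep_glue[OF \<pi> q(1)] q(3) by simp
      ultimately show ?thesis using op[OF q(1,2)] by (simp add: cyclic_dist_sym)
    qed
    then show "y \<in> ?Y" using y by blast
  qed
  then have "?Y = ?T" using sub by blast
  then show "card (band_walks N b n \<pi>) = N * band_norm N b ^ (n div 2)"
    unfolding card_band_walks_reduce[OF \<pi>] using T V by simp
qed

section \<open>Noncrossing pairings\<close>

lemma catalan_Suc: "real (k + 2) * catalan (Suc k) = (4 * real k + 2) * catalan k"
proof -
  have c: "catalan l = fact (2 * l) / (fact l * fact l * (real l + 1))" for l
    by (simp add: catalan_def binomial_fact mult_2 add.commute)
  have f: "fact (2 * Suc k) = (2 * (real k + 1)) * (2 * real k + 1) * (fact (2 * k) :: real)"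
    by (simp add: algebra_simps)
  have g: "fact (Suc k) = (real k + 1) * (fact k :: real)" by simp
  have "(k2 * (2 * k1 * m * F / (k1 * G * (k1 * G) * k2))) = (2 * m) * (F / (G * G * k1))"
    if "k1 \<noteq> 0" "k2 \<noteq> 0" for k1 k2 m F G :: real
    using that by (cases "G = 0") (auto simp: field_simps)
  from this[of "real k + 1" "real (Suc k) + 1" "2 * real k + 1" "fact (2 * k)" "fact k"]
  show ?thesis unfolding c f g by (simp add: algebra_simps)
qed

lemma catalan_0 [simp]: "catalan 0 = 1" by (simp add: catalan_def)

text \<open>The coefficients of \<open>(1 - sqrt (1 - 4 x)) / (2 x)\<close>, verified by comparing
  two-term recursions.\<close>

lemma catalan_gbinomial: "catalan k = 2 * (-4) ^ k * ((1/2) gchoose Suc k)"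
proof (induction k)
  case 0 then show ?case by simp
next
  case (Suc k)
  let ?g = "\<lambda>j. (1/2 :: real) gchoose j"
  have "real (k + 2) * ?g (Suc (Suc k)) = (1/2 - real (Suc k)) * ?g (Suc k)"
    using gbinomial_absorb_comp[of "1/2::real" "Suc k"] gbinomial_absorption[of "Suc k" "1/2::real"]
    by (simp add: algebra_simps)
  moreover have "real (k + 2) * (2 * (-4) ^ Suc k * ?g (Suc (Suc k))) = 2 * (-4) ^ Suc k * (real (k + 2) * ?g (Suc (Suc k)))"
    by simp
  moreover have "2 * (-4) ^ Suc k * ((1/2 - real (Suc k)) * ?g (Suc k)) = (4 * real k + 2) * (2 * (-4) ^ k * ?g (Suc k))"
    by (simp add: algebra_simps)
  ultimately have "real (k + 2) * (2 * (-4) ^ Suc k * ?g (Suc (Suc k))) = (4 * real k + 2) * (2 * (-4) ^ k * ?g (Suc k))"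
    by metis
  also have "\<dots> = real (k + 2) * catalan (Suc k)" using catalan_Suc[of k] Suc.IH by simp
  finally have "real (k + 2) * (2 * (-4) ^ Suc k * ?g (Suc (Suc k))) = real (k + 2) * catalan (Suc k)" .
  moreover have "real (k + 2) \<noteq> 0" by simp
  ultimately show ?case by (metis mult_left_cancel)
qed

text \<open>Behind this is \<open>sqrt (1 - 4 x) ^ 2 = 1 - 4 x\<close>: the Vandermonde sum for
  \<open>1/2 + 1/2 = 1\<close> vanishes beyond degree one, and its two boundary terms produce the
  left-hand side.\<close>

lemma catalan_convolution: "catalan (Suc n) = (\<Sum>i\<le>n. catalan i * catalan (n - i))"
proof -
  let ?g = "\<lambda>j. (1/2 :: real) gchoose j"
  have "(1 :: real) gchoose (n + 2) = 0"
    using binomial_gbinomial[of 1 "n + 2", where 'a = real] by (simp add: binomial_eq_0)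
  then have "0 = (\<Sum>k\<le>n+2. ?g k * ?g (n + 2 - k))"
    using gbinomial_Vandermonde[of "1/2::real" "1/2" "n + 2"] by (simp add: atLeast0AtMost)
  also have "\<dots> = ?g (n + 2) + (\<Sum>k\<le>Suc n. ?g (Suc k) * ?g (Suc n - k))"
    unfolding add_2_eq_Suc' sum.atMost_Suc_shift[of _ "Suc n"] by simp
  also have "(\<Sum>k\<le>Suc n. ?g (Suc k) * ?g (Suc n - k)) = (\<Sum>k\<le>n. ?g (Suc k) * ?g (Suc (n - k))) + ?g (n + 2)"
    by (simp add: Suc_diff_le)
  finally have v: "(\<Sum>k\<le>n. ?g (Suc k) * ?g (Suc (n - k))) = - 2 * ?g (n + 2)" by simp
  have "(\<Sum>i\<le>n. catalan i * catalan (n - i)) = (\<Sum>i\<le>n. 4 * (-4) ^ n * (?g (Suc i) * ?g (Suc (n - i))))"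
  proof (rule sum.cong[OF refl])
    fix i assume "i \<in> {..n}"
    then have "(-4::real) ^ i * (-4) ^ (n - i) = (-4) ^ n" by (simp flip: power_add)
    then show "catalan i * catalan (n - i) = 4 * (-4) ^ n * (?g (Suc i) * ?g (Suc (n - i)))"
      unfolding catalan_gbinomial by (simp add: algebra_simps)
  qed
  also have "\<dots> = catalan (Suc n)"
    unfolding sum_distrib_left[symmetric] v catalan_gbinomial[of "Suc n"] by simp
  finally show ?thesis ..
qed

section \<open>Noncrossing pairings of intervals and the Catalan recursion\<close>

definition NC :: "nat \<Rightarrow> nat \<Rightarrow> (nat \<Rightarrow> nat) set" where
  "NC a b = {\<pi>\<in>pairings {a..<b}. noncrossing {a..<b} \<pi>}"

lemma finite_NC: "finite (NC a b)"
  by (rule finite_subset[of _ "pairings {a..<b}"]) (auto simp: NC_def)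

lemma involution_pairing:
  assumes "\<And>i. i \<in> S \<Longrightarrow> \<pi> i \<in> S \<and> \<pi> i \<noteq> i \<and> \<pi> (\<pi> i) = i" "\<And>i. i \<notin> S \<Longrightarrow> \<pi> i = i"
  shows "\<pi> \<in> pairings S"
proof -
  have "bij_betw \<pi> S S" by (rule bij_betw_byWitness[where f' = \<pi>]) (use assms in auto)
  then have "\<pi> permutes S" using assms(2) by (rule bij_imp_permutes)
  then show ?thesis using assms by (simp add: pairings_def)
qed

text \<open>The chord from \<open>a\<close> to \<open>c\<close> separates the rest of the interval;
  chords on different sides cannot cross, and none crosses the new chord.\<close>

lemma NC_join:
  assumes c: "a < c" "c < b" and p1: "\<pi>1 \<in> NC (Suc a) c" and p2: "\<pi>2 \<in> NC (Suc c) b"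
  shows "(\<lambda>i. if i = a then c else if i = c then a else if i < c then \<pi>1 i else \<pi>2 i) \<in> NC a b" (is "?\<pi> \<in> _")
proof -
  have q1: "\<pi>1 \<in> pairings {Suc a..<c}" and q2: "\<pi>2 \<in> pairings {Suc c..<b}" using p1 p2 by (auto simp: NC_def)
  note d1 = pairingsD[OF q1] and d2 = pairingsD[OF q2]
  have v1: "?\<pi> i = \<pi>1 i" "a < \<pi>1 i" "\<pi>1 i < c" if "a < i" "i < c" for i
    using that d1(4)[of i] by auto
  have v2: "?\<pi> i = \<pi>2 i" "c < \<pi>2 i" "\<pi>2 i < b" if "c < i" "i < b" for i
    using that c d2(4)[of i] by auto
  have va: "?\<pi> a = c" "?\<pi> c = a" using c by auto
  have P: "?\<pi> \<in> pairings {a..<b}"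
  proof (rule involution_pairing)
    fix i assume i: "i \<in> {a..<b}"
    consider "i = a" | "i = c" | "a < i" "i < c" | "c < i" "i < b" using i by force
    then show "?\<pi> i \<in> {a..<b} \<and> ?\<pi> i \<noteq> i \<and> ?\<pi> (?\<pi> i) = i"
    proof cases
      case 1 then show ?thesis using c by auto
    next
      case 2 then show ?thesis using c by auto
    next
      case 3
      then show ?thesis using v1[OF 3] d1(2)[of i] d1(3)[of i] c by auto
    next
      case 4
      then show ?thesis using v2[OF 4] d2(2)[of i] d2(3)[of i] c by auto
    qed
  next
    fix i assume i: "i \<notin> {a..<b}"
    then show "?\<pi> i = i" using d1(5)[of i] d2(5)[of i] c by auto
  qed
  have "\<not> (i < j \<and> j < ?\<pi> i \<and> ?\<pi> i < ?\<pi> j)" if ij: "i \<in> {a..<b}" "j \<in> {a..<b}" for i j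
  proof
    assume cr: "i < j \<and> j < ?\<pi> i \<and> ?\<pi> i < ?\<pi> j"
    consider "i = a" | "i = c" | "a < i" "i < c" | "c < i" "i < b" using ij by force
    then show False
    proof cases
      case 1
      then have "?\<pi> i = c" "a < j" "j < c" using va cr by auto
      moreover from this have "?\<pi> j < c" using v1(1,3)[of j] by simp
      ultimately show False using cr by linarith
    next
      case 2 then show False using va cr c by simp
    next
      case 3
      note vi = v1[OF 3]
      have j: "a < j" "j < c" using cr vi 3 by linarith+
      have "i < j \<and> j < \<pi>1 i \<and> \<pi>1 i < \<pi>1 j" using cr unfolding vi(1) v1(1)[OF j] .
      moreover have "noncrossing {Suc a..<c} \<pi>1" using p1 by (simp add: NC_def)
      ultimately show False unfolding noncrossing_def using 3 j by auto
    next
      case 4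
      note vi = v2[OF 4]
      have j: "c < j" "j < b" using cr vi 4 by linarith+
      have "i < j \<and> j < \<pi>2 i \<and> \<pi>2 i < \<pi>2 j" using cr unfolding vi(1) v2(1)[OF j] .
      moreover have "noncrossing {Suc c..<b} \<pi>2" using p2 by (simp add: NC_def)
      ultimately show False unfolding noncrossing_def using 4 j by auto
    qed
  qed
  then show ?thesis unfolding NC_def noncrossing_def using P by blast
qed

lemma NC_restrict:
  assumes p: "\<pi> \<in> pairings {a..<b}" "noncrossing {a..<b} \<pi>" and J: "{u..<v} \<subseteq> {a..<b}" and J': "\<And>i. i \<in> {u..<v} \<Longrightarrow> \<pi> i \<in> {u..<v}"
  shows "(\<lambda>i. if i \<in> {u..<v} then \<pi> i else i) \<in> NC u v"
proof -
  note d = pairingsD[OF p(1)]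
  have "(\<lambda>i. if i \<in> {u..<v} then \<pi> i else i) \<in> pairings {u..<v}"
  proof (rule involution_pairing)
    fix i assume i: "i \<in> {u..<v}"
    have "i \<in> {a..<b}" using i J by blast
    then have "\<pi> i \<noteq> i" by (rule d(3))
    then show "(if i \<in> {u..<v} then \<pi> i else i) \<in> {u..<v} \<and> (if i \<in> {u..<v} then \<pi> i else i) \<noteq> i \<and>
      (if (if i \<in> {u..<v} then \<pi> i else i) \<in> {u..<v} then \<pi> (if i \<in> {u..<v} then \<pi> i else i) else (if i \<in> {u..<v} then \<pi> i else i)) = i"
      using i J'[OF i] d(2)[of i] by simp
  qed (simp only: if_False)
  moreover have "noncrossing {u..<v} (\<lambda>i. if i \<in> {u..<v} then \<pi> i else i)"
    using p(2) J unfolding noncrossing_def by (smt (verit) subsetD)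
  ultimately show ?thesis by (simp add: NC_def)
qed

text \<open>A chord with one end under the chord of \<open>a\<close> and the other beyond it would
  cross it, so both sides are closed under \<open>\<pi>\<close>.\<close>

lemma NC_split:
  assumes p: "\<pi> \<in> NC a b" and ab: "a < b"
  shows "a < \<pi> a" "\<pi> a < b" "i \<in> {Suc a..<\<pi> a} \<Longrightarrow> \<pi> i \<in> {Suc a..<\<pi> a}" "i \<in> {Suc (\<pi> a)..<b} \<Longrightarrow> \<pi> i \<in> {Suc (\<pi> a)..<b}"
proof -
  have q: "\<pi> \<in> pairings {a..<b}" and nc: "noncrossing {a..<b} \<pi>" using p by (auto simp: NC_def)
  note d = pairingsD[OF q]
  have "\<pi> a \<in> {a..<b}" "\<pi> a \<noteq> a" using d(3)[of a] d(4)[of a] ab by auto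
  then show c: "a < \<pi> a" "\<pi> a < b" by auto
  have in1: "\<pi> i \<in> {Suc a..<\<pi> a}" if i: "i \<in> {Suc a..<\<pi> a}" for i
  proof -
    have ib: "i \<in> {a..<b}" using i c by auto
    have "\<pi> i \<in> {a..<b}" using ib d(4) by blast
    moreover have "\<pi> i \<noteq> a" using d(2)[of i] i by auto
    moreover have "\<pi> i \<noteq> \<pi> a" using d(2)[of i] d(2)[of a] i by auto
    moreover have "\<not> (a < i \<and> i < \<pi> a \<and> \<pi> a < \<pi> i)" using nc ib ab unfolding noncrossing_def by auto
    ultimately show ?thesis using i by auto
  qed
  then show "i \<in> {Suc a..<\<pi> a} \<Longrightarrow> \<pi> i \<in> {Suc a..<\<pi> a}" .
  assume i: "i \<in> {Suc (\<pi> a)..<b}"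
  have "\<pi> i \<in> {a..<b}" using i c d(4)[of i] by auto
  moreover have "\<pi> i \<noteq> a" using d(2)[of i] i by auto
  moreover have "\<pi> i \<noteq> \<pi> a" using d(2)[of i] d(2)[of a] i c by auto
  moreover have "\<pi> i \<notin> {Suc a..<\<pi> a}" using in1[of "\<pi> i"] d(2)[of i] i by auto
  ultimately show "\<pi> i \<in> {Suc (\<pi> a)..<b}" by auto
qed

lemma card_NC_rec:
  assumes ab: "a < b"
  shows "card (NC a b) = (\<Sum>c\<in>{a<..<b}. card (NC (Suc a) c) * card (NC (Suc c) b))"
proof -
  let ?J = "\<lambda>(c, \<pi>1, \<pi>2) i. if i = a then c else if i = c then a else if i < c then \<pi>1 i else \<pi>2 i"
  let ?r = "\<lambda>\<pi> J i. if i \<in> J then \<pi> i else (i::nat)"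
  let ?D = "SIGMA c:{a<..<b}. NC (Suc a) c \<times> NC (Suc c) b"
  have "bij_betw ?J ?D (NC a b)"
  proof (rule bij_betw_byWitness[where f' = "\<lambda>\<pi>. (\<pi> a, ?r \<pi> {Suc a..<\<pi> a}, ?r \<pi> {Suc (\<pi> a)..<b})"])
    show "?J ` ?D \<subseteq> NC a b" using NC_join by auto
    show "(\<lambda>\<pi>. (\<pi> a, ?r \<pi> {Suc a..<\<pi> a}, ?r \<pi> {Suc (\<pi> a)..<b})) ` NC a b \<subseteq> ?D"
    proof
      fix t assume "t \<in> (\<lambda>\<pi>. (\<pi> a, ?r \<pi> {Suc a..<\<pi> a}, ?r \<pi> {Suc (\<pi> a)..<b})) ` NC a b"
      then obtain \<pi> where t: "t = (\<pi> a, ?r \<pi> {Suc a..<\<pi> a}, ?r \<pi> {Suc (\<pi> a)..<b})" and \<pi>: "\<pi> \<in> NC a b" by blast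
      note s = NC_split[OF \<pi> ab]
      have q: "\<pi> \<in> pairings {a..<b}" "noncrossing {a..<b} \<pi>" using \<pi> by (auto simp: NC_def)
      have "?r \<pi> {Suc a..<\<pi> a} \<in> NC (Suc a) (\<pi> a)" "?r \<pi> {Suc (\<pi> a)..<b} \<in> NC (Suc (\<pi> a)) b"
        by (rule NC_restrict[OF q]; use s in auto)+
      then show "t \<in> ?D" unfolding t using s(1,2) by simp
    qed
    show "\<forall>\<pi>\<in>NC a b. ?J (\<pi> a, ?r \<pi> {Suc a..<\<pi> a}, ?r \<pi> {Suc (\<pi> a)..<b}) = \<pi>"
    proof (intro ballI ext)
      fix \<pi> i assume \<pi>: "\<pi> \<in> NC a b"
      note s = NC_split[OF \<pi> ab]
      have q: "\<pi> \<in> pairings {a..<b}" using \<pi> by (auto simp: NC_def)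
      note d = pairingsD[OF q]
      show "?J (\<pi> a, ?r \<pi> {Suc a..<\<pi> a}, ?r \<pi> {Suc (\<pi> a)..<b}) i = \<pi> i"
        using s(1,2) d(2)[of a] d(5)[of i] by auto
    qed
    show "\<forall>t\<in>?D. (?J t a, ?r (?J t) {Suc a..<?J t a}, ?r (?J t) {Suc (?J t a)..<b}) = t"
    proof
      fix t assume "t \<in> ?D"
      then obtain c \<pi>1 \<pi>2 where t: "t = (c, \<pi>1, \<pi>2)" "a < c" "c < b" "\<pi>1 \<in> pairings {Suc a..<c}" "\<pi>2 \<in> pairings {Suc c..<b}"
        by (auto simp: NC_def)
      have "?r (?J t) {Suc a..<c} = \<pi>1"
      proof
        fix i show "?r (?J t) {Suc a..<c} i = \<pi>1 i" using pairingsD(5)[OF t(4), of i] t(1,2) by auto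
      qed
      moreover have "?r (?J t) {Suc c..<b} = \<pi>2"
      proof
        fix i show "?r (?J t) {Suc c..<b} i = \<pi>2 i" using pairingsD(5)[OF t(5), of i] t(1,2) by auto
      qed
      ultimately show "(?J t a, ?r (?J t) {Suc a..<?J t a}, ?r (?J t) {Suc (?J t a)..<b}) = t"
        using t(1) by simp
    qed
  qed
  then have "card (NC a b) = card ?D" by (rule bij_betw_same_card[symmetric])
  then show ?thesis by (simp add: card_SigmaI finite_NC card_cartesian_product)
qed

lemma card_NC:
  "real (card (NC a b)) = (if a < b then (if even (b - a) then catalan ((b - a) div 2) else 0) else 1)"
proof (induction "b - a" arbitrary: a b rule: less_induct)
  case less
  show ?case
  proof (cases "a < b")
    case False
    then have "NC a b = {id}" by (auto simp: NC_def noncrossing_def)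
    then show ?thesis using False by simp
  next
    case True
    have IH: "real (card (NC u v)) = (if even (v - u) then catalan ((v - u) div 2) else 0)"
      if "v - u < b - a" for u v
      using less[of v u] that by (cases "u < v") auto
    have "real (card (NC a b)) = (\<Sum>c\<in>{a<..<b}. real (card (NC (Suc a) c)) * real (card (NC (Suc c) b)))"
      unfolding card_NC_rec[OF True] by simp
    also have "\<dots> = (\<Sum>c\<in>{a<..<b}. (if even (c - Suc a) then catalan ((c - Suc a) div 2) else 0) *
        (if even (b - Suc c) then catalan ((b - Suc c) div 2) else 0))"
      using True by (intro sum.cong refl arg_cong2[of _ _ _ _ "(*)"] IH) auto
    also have "\<dots> = (if even (b - a) then catalan ((b - a) div 2) else 0)"
    proof (cases "even (b - a)")
      case False
      have "\<not> (even (c - Suc a) \<and> even (b - Suc c))" if "a < c" "c < b" for c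
        using that False by presburger
      then show ?thesis using False by (intro trans[OF sum.neutral]) auto
    next
      case e: True
      then obtain m where m: "b = a + 2 * Suc m" using True
        by (metis add_diff_inverse_nat evenE less_imp_not_less nat.exhaust zero_less_diff mult_0_right not_less_zero)
      \<comment> \<open>Both parts must have even length, so only the partners
        \<open>c = Suc a + 2 * i\<close> contribute.\<close>
      have "(\<Sum>c\<in>{a<..<b}. (if even (c - Suc a) then catalan ((c - Suc a) div 2) else 0) *
        (if even (b - Suc c) then catalan ((b - Suc c) div 2) else 0)) =
        (\<Sum>c\<in>(\<lambda>i. Suc a + 2 * i) ` {..m}. catalan ((c - Suc a) div 2) * catalan ((b - Suc c) div 2))"
      proof (rule sum.mono_neutral_cong_right)
        show "(\<lambda>i. Suc a + 2 * i) ` {..m} \<subseteq> {a<..<b}" using m by auto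
        show "\<forall>c\<in>{a<..<b} - (\<lambda>i. Suc a + 2 * i) ` {..m}. (if even (c - Suc a) then catalan ((c - Suc a) div 2) else 0) *
          (if even (b - Suc c) then catalan ((b - Suc c) div 2) else 0) = 0"
        proof
          fix c assume c: "c \<in> {a<..<b} - (\<lambda>i. Suc a + 2 * i) ` {..m}"
          have "odd (c - Suc a)"
          proof
            assume "even (c - Suc a)"
            then obtain i where i: "c - Suc a = 2 * i" by (elim evenE)
            then have "c = Suc a + 2 * i" "i \<le> m" using c m by auto
            then show False using c by auto
          qed
          then show "(if even (c - Suc a) then catalan ((c - Suc a) div 2) else 0) *
            (if even (b - Suc c) then catalan ((b - Suc c) div 2) else 0) = 0" by simp
        qed
      qed (auto simp: m)
      also have "\<dots> = (\<Sum>i\<le>m. catalan i * catalan (m - i))"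
        by (subst sum.reindex) (auto simp: inj_on_def m o_def intro!: sum.cong arg_cong2[of _ _ _ _ "(*)"] arg_cong[of _ _ catalan])
      also have "\<dots> = catalan (Suc m)" by (rule catalan_convolution[symmetric])
      finally show ?thesis using e m by simp
    qed
    finally show ?thesis using True by simp
  qed
qed

lemma card_noncrossing: "real (card {\<pi>\<in>pairings {..<2 * l}. noncrossing {..<2 * l} \<pi>}) = catalan l"
  using card_NC[of 0 "2 * l"] by (cases "l = 0") (auto simp: NC_def lessThan_atLeast0)

section \<open>Walks on the integers\<close>

text \<open>Lifts of band walks to the line, anchored at \<open>0\<close> to divide out
  translations; the \<open>N\<close> possible starting points are accounted for separately.\<close>

definition int_walks :: "nat \<Rightarrow> nat \<Rightarrow> (nat \<Rightarrow> nat) \<Rightarrow> (nat \<Rightarrow> int) set" where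
  "int_walks b n \<pi> = {y\<in>{..<n} \<rightarrow>\<^sub>E UNIV. y 0 = 0 \<and>
     (\<forall>k<n. y (\<pi> k) = y (Suc k mod n) \<and> \<bar>y (Suc k mod n) - y k\<bar> \<le> int b)}"

lemma int_walks_bound:
  assumes "y \<in> int_walks b n \<pi>" "k < n"
  shows "\<bar>y k\<bar> \<le> int (k * b)" "\<bar>y k\<bar> \<le> int (n * b)"
proof -
  have st: "\<bar>y (Suc k mod n) - y k\<bar> \<le> int b" if "k < n" for k using assms(1) that by (simp add: int_walks_def)
  show 1: "\<bar>y k\<bar> \<le> int (k * b)" using assms(2)
  proof (induction k)
    case 0 then show ?case using assms by (simp add: int_walks_def)
  next
    case (Suc k)
    then have "\<bar>y (Suc k) - y k\<bar> \<le> int b" using st[of k] by simp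
    then show ?case using Suc by simp
  qed
  have "k * b \<le> n * b" using assms(2) by simp
  then show "\<bar>y k\<bar> \<le> int (n * b)" using 1 by linarith
qed

lemma finite_int_walks: "finite (int_walks b n \<pi>)"
proof (rule finite_subset)
  show "int_walks b n \<pi> \<subseteq> {..<n} \<rightarrow>\<^sub>E {- int (n * b)..int (n * b)}"
  proof
    fix y assume y: "y \<in> int_walks b n \<pi>"
    have "y k \<in> {- int (n * b)..int (n * b)}" if "k < n" for k
      using int_walks_bound(2)[OF y that] by auto
    moreover have "y \<in> extensional {..<n}" using y by (simp add: int_walks_def PiE_iff)
    ultimately show "y \<in> {..<n} \<rightarrow>\<^sub>E {- int (n * b)..int (n * b)}" by (auto simp: PiE_iff)
  qed
  show "finite ({..<n} \<rightarrow>\<^sub>E {- int (n * b)..int (n * b)})" by (intro finite_PiE) auto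
qed

text \<open>If \<open>N\<close> is large compared to the total length \<open>n b\<close>, a closed walk does not wind around the
  cycle, and lifts to the integers.\<close>

lemma card_band_walks_int:
  assumes n: "n > 0" and N: "2 * n * b + b < N" and \<pi>: "\<pi> \<in> pairings {..<n}"
  shows "card (band_walks N b n \<pi>) = N * card (int_walks b n \<pi>)"
proof -
  note d = pairingsD[OF \<pi>]
  have N0: "0 < int N" using N by simp
  \<comment> \<open>Two lifts of the same residue coincide: they differ by at most
    \<open>2 * n * b\<close>, which is less than \<open>N\<close>.\<close>
  have small: "y = z" if "\<bar>y\<bar> \<le> int (n * b)" "\<bar>z\<bar> \<le> int (n * b)" "int N dvd y - z" for y z
  proof (rule ccontr)
    assume "y \<noteq> z"
    then have "int N \<le> \<bar>y - z\<bar>" using that(3) zdvd_imp_le[of "int N" "\<bar>y - z\<bar>"] by simp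
    moreover have "int (2 * n * b + b) < int N" using N by linarith
    ultimately show False using that by (simp add: mult.assoc)
  qed
  define g where "g = (\<lambda>(a, y) k. if k < n then nat ((int a + y k) mod int N) else undefined)"
  have gi: "int (g (a, y) k) = (int a + y k) mod int N" if "k < n" for a y k
    using N0 that by (simp add: g_def)
  have gN: "g (a, y) k < N" if "k < n" for a y k
  proof -
    have "int (g (a, y) k) < int N" unfolding gi[OF that] using N0 by simp
    then show ?thesis by simp
  qed
  have sm: "Suc k mod n < n" for k using n by simp
  have "bij_betw g ({..<N} \<times> int_walks b n \<pi>) (band_walks N b n \<pi>)"
    unfolding bij_betw_def
  proof (intro conjI subset_antisym subsetI)
    show "inj_on g ({..<N} \<times> int_walks b n \<pi>)"
    proof (rule inj_onI)
      fix p q assume "p \<in> {..<N} \<times> int_walks b n \<pi>" "q \<in> {..<N} \<times> int_walks b n \<pi>" and e: "g p = g q"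
      then obtain a y c z where pq: "p = (a, y)" "q = (c, z)" "a < N" "c < N" "y \<in> int_walks b n \<pi>" "z \<in> int_walks b n \<pi>"
        by auto
      have gk: "(int a + y k) mod int N = (int c + z k) mod int N" if "k < n" for k
        using gi[OF that, of a y] gi[OF that, of c z] e pq by simp
      have "int a = int c" using gk[of 0] pq n by (simp add: int_walks_def)
      then have ac: "a = c" by simp
      have "y k = z k" if "k < n" for k
      proof (rule small)
        show "\<bar>y k\<bar> \<le> int (n * b)" "\<bar>z k\<bar> \<le> int (n * b)" using int_walks_bound(2) pq that by blast+
        show "int N dvd y k - z k" using gk[OF that] ac by (metis add_diff_cancel_left mod_eq_dvd_iff)
      qed
      moreover have "y \<in> extensional {..<n}" "z \<in> extensional {..<n}" using pq by (auto simp: int_walks_def PiE_iff)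
      ultimately have "y = z" by (intro extensionalityI) auto
      then show "p = q" using pq ac by simp
    qed
  next
    fix x assume "x \<in> g ` ({..<N} \<times> int_walks b n \<pi>)"
    then obtain a y where x: "x = g (a, y)" "a < N" "y \<in> int_walks b n \<pi>" by auto
    have "x (\<pi> k) = x (Suc k mod n) \<and> cyclic_dist N (x k) (x (Suc k mod n)) \<le> int b" if k: "k < n" for k
    proof
      have pk: "\<pi> k < n" using d(4)[of k] k by simp
      have yk: "y (\<pi> k) = y (Suc k mod n)" "\<bar>y (Suc k mod n) - y k\<bar> \<le> int b" using x(3) k by (auto simp: int_walks_def)
      show "x (\<pi> k) = x (Suc k mod n)" unfolding x(1) g_def using yk(1) pk sm by simp
      let ?u = "int a + y k" and ?v = "int a + y (Suc k mod n)"
      have "int (x (Suc k mod n)) - int (x k) + (?v div int N - ?u div int N) * int N = ?v - ?u"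
        unfolding x(1) gi[OF k] gi[OF sm] by (simp add: minus_div_mult_eq_mod[symmetric] algebra_simps)
      then have "\<bar>int (x (Suc k mod n)) - int (x k) + (?v div int N - ?u div int N) * int N\<bar> \<le> int b"
        using yk(2) by simp
      then have "\<exists>t. \<bar>int (x (Suc k mod n)) - int (x k) + t * int N\<bar> \<le> int b" by (rule exI)
      then show "cyclic_dist N (x k) (x (Suc k mod n)) \<le> int b"
        unfolding x(1) cyclic_dist_le_iff[OF gN[OF k] gN[OF sm]] .
    qed
    moreover have "x \<in> {..<n} \<rightarrow>\<^sub>E {..<N}" using gN[of _ a y] unfolding x(1) by (auto simp: PiE_iff extensional_def g_def)
    ultimately show "x \<in> band_walks N b n \<pi>" unfolding band_walks_def by blast
  next
    fix x assume x: "x \<in> band_walks N b n \<pi>"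
    have xN: "x k < N" if "k < n" for k using x that by (auto simp: band_walks_def PiE_iff)
    have "\<exists>t. \<forall>k<n. \<bar>int (x (Suc k mod n)) - int (x k) + t k * int N\<bar> \<le> int b"
    proof -
      have "\<forall>k. \<exists>t. k < n \<longrightarrow> \<bar>int (x (Suc k mod n)) - int (x k) + t * int N\<bar> \<le> int b"
      proof (intro allI)
        fix k
        have "k < n \<longrightarrow> cyclic_dist N (x k) (x (Suc k mod n)) \<le> int b" using x by (simp add: band_walks_def)
        then show "\<exists>t. k < n \<longrightarrow> \<bar>int (x (Suc k mod n)) - int (x k) + t * int N\<bar> \<le> int b"
          using cyclic_dist_le_iff[OF xN xN[OF sm], of k k b] by auto
      qed
      then show ?thesis by metis
    qed
    then obtain t where t: "\<And>k. k < n \<Longrightarrow> \<bar>int (x (Suc k mod n)) - int (x k) + t k * int N\<bar> \<le> int b" by blast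
    \<comment> \<open>The lifted steps are summed up from the start. That the closing step from
      \<open>n - 1\<close> back to \<open>0\<close> is again at most \<open>b\<close> is not built
      in and must be derived from the size of \<open>N\<close>.\<close>
    define y where "y k = (if k < n then int (x k) - int (x 0) + (\<Sum>i<k. t i) * int N else undefined)" for k
    have yb: "\<bar>y k\<bar> \<le> int (k * b)" if "k < n" for k
      using that
    proof (induction k)
      case 0 then show ?case using n by (simp add: y_def)
    next
      case (Suc k)
      have "y (Suc k) = y k + (int (x (Suc k)) - int (x k) + t k * int N)"
        using Suc.prems by (simp add: y_def algebra_simps)
      moreover have "\<bar>int (x (Suc k)) - int (x k) + t k * int N\<bar> \<le> int b" using t[of k] Suc.prems by simp
      ultimately show ?case using Suc by simp
    qed
    have yb': "\<bar>y k\<bar> \<le> int (n * b)" if "k < n" for k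
    proof -
      have "k * b \<le> n * b" using that by simp
      then show ?thesis using yb[OF that] by linarith
    qed
    have dv: "\<exists>s. y k = int (x k) - int (x 0) + s * int N" if "k < n" for k using that by (auto simp: y_def)
    have "y (\<pi> k) = y (Suc k mod n) \<and> \<bar>y (Suc k mod n) - y k\<bar> \<le> int b" if k: "k < n" for k
    proof
      have pk: "\<pi> k < n" using d(4)[of k] k by simp
      have xe: "x (\<pi> k) = x (Suc k mod n)" using x k by (auto simp: band_walks_def)
      obtain s s' s'' where s: "y (\<pi> k) = int (x (\<pi> k)) - int (x 0) + s * int N"
        "y (Suc k mod n) = int (x (Suc k mod n)) - int (x 0) + s' * int N" "y k = int (x k) - int (x 0) + s'' * int N"
        using dv[OF pk] dv[OF sm[of k]] dv[OF k] by blast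
      have "y (\<pi> k) - y (Suc k mod n) = int N * (s - s')" using s(1,2) xe by (simp add: algebra_simps)
      then have "int N dvd y (\<pi> k) - y (Suc k mod n)" by simp
      then show "y (\<pi> k) = y (Suc k mod n)" by (rule small[OF yb'[OF pk] yb'[OF sm]])
      let ?D = "int (x (Suc k mod n)) - int (x k) + t k * int N"
      have e: "y (Suc k mod n) - y k = ?D + (s' - s'' - t k) * int N" using s by (simp add: algebra_simps)
      \<comment> \<open>The increment of \<open>y\<close> and the lifted step agree modulo
        \<open>N\<close> and differ by at most \<open>2 * n * b + b\<close>; here the extra
        \<open>b\<close> in the bound on \<open>N\<close> enters.\<close>
      have "s' - s'' - t k = 0"
      proof (rule ccontr)
        assume "s' - s'' - t k \<noteq> 0"
        then have "1 * int N \<le> \<bar>s' - s'' - t k\<bar> * int N" by (intro mult_right_mono) auto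
        then have "int N \<le> \<bar>(s' - s'' - t k) * int N\<bar>" by (simp add: abs_mult)
        moreover have "int (2 * n * b + b) < int N" using N by linarith
        ultimately show False using e t[OF k] yb'[OF k] yb'[OF sm[of k]] by (simp add: mult.assoc)
      qed
      then show "\<bar>y (Suc k mod n) - y k\<bar> \<le> int b" using e t[OF k] by simp
    qed
    moreover have "y 0 = 0" using n by (simp add: y_def)
    moreover have "y \<in> {..<n} \<rightarrow>\<^sub>E UNIV" by (simp add: PiE_iff extensional_def y_def)
    ultimately have yw: "y \<in> int_walks b n \<pi>" unfolding int_walks_def by blast
    have "x = g (x 0, y)"
    proof
      fix k
      show "x k = g (x 0, y) k"
      proof (cases "k < n")
        case True
        then have "int (g (x 0, y) k) = int (x k) mod int N" unfolding gi[OF True] by (simp add: y_def)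
        also have "\<dots> = int (x k)" using xN[OF True] by simp
        finally show ?thesis by simp
      next
        case False
        then show ?thesis using x by (simp add: g_def band_walks_def PiE_iff extensional_def)
      qed
    qed
    then show "x \<in> g ` ({..<N} \<times> int_walks b n \<pi>)" using yw xN[OF n] by blast
  qed
  then have "card ({..<N} \<times> int_walks b n \<pi>) = card (band_walks N b n \<pi>)" by (rule bij_betw_same_card)
  then show ?thesis by (simp add: card_cartesian_product)
qed

text \<open>The bound on the cycle carries over: \<open>N\<close> is taken just beyond the lifting
  threshold and then cancelled.\<close>

lemma card_int_walks_le:
  assumes "n > 0" "\<pi> \<in> pairings {..<n}"
  shows "card (int_walks b n \<pi>) \<le> (2 * b + 1) ^ (nvert n \<pi> - 1)"
proof -
  define N where "N = 2 * n * b + b + 1"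
  have "N * card (int_walks b n \<pi>) \<le> N * band_norm N b ^ (nvert n \<pi> - 1)"
    using card_band_walks_int[of n b N \<pi>] card_band_walks_le(1)[of \<pi> n N b] assms by (simp add: N_def)
  moreover have "0 < N" by (simp add: N_def)
  ultimately have "card (int_walks b n \<pi>) \<le> band_norm N b ^ (nvert n \<pi> - 1)" by (simp only: mult_le_cancel1)
  also have "\<dots> \<le> (2 * b + 1) ^ (nvert n \<pi> - 1)" by (intro power_mono) (auto simp: band_norm_def)
  finally show ?thesis .
qed

lemma card_int_walks_mono: "b \<le> b' \<Longrightarrow> card (int_walks b n \<pi>) \<le> card (int_walks b' n \<pi>)"
  by (rule card_mono[OF finite_int_walks]) (force simp: int_walks_def)

text \<open>Refining the lattice by a factor \<open>k\<close>: each class of points can be shifted independently by an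
  offset in \<open>{0..<k}\<close>.\<close>

lemma card_int_walks_refine:
  assumes \<pi>: "\<pi> \<in> pairings {..<n}" and n: "n > 0" and kb: "k > 0" "b > 0"
  shows "k ^ (nvert n \<pi> - 1) * card (int_walks (b - 1) n \<pi>) \<le> card (int_walks (k * b - 1) n \<pi>)"
proof -
  note d = pairingsD[OF \<pi>]
  let ?R = "vreps n \<pi> - {0}"
  have v0: "vrep n \<pi> 0 = 0" using vrep_props(2)[OF \<pi> n] by simp
  have R0: "0 \<in> vreps n \<pi>" using vreps_props(1)[OF \<pi>] v0 n by simp
  \<comment> \<open>The class of \<open>0\<close> gets no offset, which keeps the refined walk
    anchored.\<close>
  define off where "off r p = (if vrep n \<pi> p = 0 then 0 else r (vrep n \<pi> p))" for r :: "nat \<Rightarrow> int" and p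
  define g where "g = (\<lambda>(y, r) p. if p < n then int k * y p + off r p else undefined)"
  let ?A = "int_walks (b - 1) n \<pi> \<times> (?R \<rightarrow>\<^sub>E {0..<int k})"
  have off: "0 \<le> off r p" "off r p < int k" if "r \<in> ?R \<rightarrow>\<^sub>E {0..<int k}" "p < n" for r p
    using that vreps_props(4)[OF \<pi> that(2)] kb by (auto simp: off_def PiE_iff)
  have inj: "inj_on g ?A"
  proof (rule inj_onI)
    fix u v assume "u \<in> ?A" "v \<in> ?A" and e: "g u = g v"
    then obtain y r z s where uv: "u = (y, r)" "v = (z, s)" "y \<in> int_walks (b - 1) n \<pi>" "z \<in> int_walks (b - 1) n \<pi>"
      "r \<in> ?R \<rightarrow>\<^sub>E {0..<int k}" "s \<in> ?R \<rightarrow>\<^sub>E {0..<int k}" by blast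
    have yz: "y p = z p \<and> off r p = off s p" if p: "p < n" for p
    proof -
      have e': "int k * y p + off r p = int k * z p + off s p" using fun_cong[OF e, of p] p uv(1,2) by (simp add: g_def)
      have "(int k * y p + off r p) div int k = y p" "(int k * z p + off s p) div int k = z p"
        using off[OF uv(5) p] off[OF uv(6) p] kb by simp_all
      then have "y p = z p" using e' by simp
      then show ?thesis using e' by simp
    qed
    have "y \<in> extensional {..<n}" "z \<in> extensional {..<n}" using uv(3,4) by (simp_all add: int_walks_def PiE_iff)
    then have "y = z" using yz by (intro extensionalityI[of _ "{..<n}"]) simp_all
    moreover have "r = s"
    proof (rule extensionalityI[of _ ?R])
      fix p assume p: "p \<in> ?R"
      then have "p < n" "vrep n \<pi> p = p" using vreps_props(1)[OF \<pi>] by auto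
      then show "r p = s p" using yz[of p] p by (simp add: off_def)
    qed (use uv in \<open>auto simp: PiE_iff\<close>)
    ultimately show "u = v" using uv by simp
  qed
  have sub: "g ` ?A \<subseteq> int_walks (k * b - 1) n \<pi>"
  proof
    fix x assume "x \<in> g ` ?A"
    then obtain y r where x: "x = g (y, r)" and y: "y \<in> int_walks (b - 1) n \<pi>" and r: "r \<in> ?R \<rightarrow>\<^sub>E {0..<int k}" by blast
    have xv: "x p = int k * y p + off r p" if "p < n" for p using that by (simp add: x g_def)
    have "x (\<pi> p) = x (Suc p mod n) \<and> \<bar>x (Suc p mod n) - x p\<bar> \<le> int (k * b - 1)" if p: "p < n" for p
    proof
      have pp: "\<pi> p < n" "Suc p mod n < n" using d(4)[of p] p by auto
      have yp: "y (\<pi> p) = y (Suc p mod n)" "\<bar>y (Suc p mod n) - y p\<bar> \<le> int (b - 1)" using y p by (auto simp: int_walks_def)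
      have "vrep n \<pi> (Suc p mod n) = vrep n \<pi> (\<pi> p)" using vrep_glue[OF \<pi> pp(1)] d(2) by simp
      then show "x (\<pi> p) = x (Suc p mod n)" using xv[OF pp(1)] xv[OF pp(2)] yp(1) by (simp add: off_def)
      have "x (Suc p mod n) - x p = int k * (y (Suc p mod n) - y p) + (off r (Suc p mod n) - off r p)"
        unfolding xv[OF pp(2)] xv[OF p] by (simp add: algebra_simps)
      moreover have "\<bar>int k * (y (Suc p mod n) - y p)\<bar> \<le> int k * int (b - 1)"
        unfolding abs_mult using yp(2) by (simp add: mult_left_mono)
      moreover have "\<bar>off r (Suc p mod n) - off r p\<bar> \<le> int k - 1" using off[OF r p] off[OF r pp(2)] by linarith
      \<comment> \<open>The offsets change a step by at most \<open>k - 1\<close>, hence widths of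
        the form \<open>b - 1\<close> scale without loss.\<close>
      moreover have "int k * int (b - 1) + (int k - 1) = int (k * b - 1)"
        using kb by (simp add: of_nat_diff algebra_simps Suc_le_eq)
      ultimately show "\<bar>x (Suc p mod n) - x p\<bar> \<le> int (k * b - 1)" by linarith
    qed
    moreover have "x 0 = 0" using xv[OF n] y v0 by (simp add: off_def int_walks_def)
    moreover have "x \<in> {..<n} \<rightarrow>\<^sub>E UNIV" by (simp add: PiE_iff x g_def extensional_def)
    ultimately show "x \<in> int_walks (k * b - 1) n \<pi>" unfolding int_walks_def by blast
  qed
  have "card ?A \<le> card (int_walks (k * b - 1) n \<pi>)" by (rule card_inj_on_le[OF inj sub finite_int_walks])
  moreover have "card (?R \<rightarrow>\<^sub>E {0..<int k}) = k ^ (nvert n \<pi> - 1)"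
    using R0 vreps_props(3)[OF \<pi>] card_vreps[OF \<pi>] by (subst card_PiE) auto
  ultimately show ?thesis by (simp add: card_cartesian_product mult.commute)
qed

text \<open>A Fekete argument: the limit is the supremum of the ratios. For a nearly optimal
  \<open>b0\<close>, a large \<open>B\<close> is compared with the multiple of \<open>b0\<close>
  just below it; by monotonicity the ratio drops at most by the factor
  \<open>(1 - b0 / B) ^ d\<close>, which tends to \<open>1\<close>.\<close>

lemma supermultiplicative_convergent:
  fixes f :: "nat \<Rightarrow> real"
  assumes mono: "mono f" and nonneg: "\<And>b. f b \<ge> 0"
    and mult: "\<And>k b. k > 0 \<Longrightarrow> b > 0 \<Longrightarrow> real k ^ d * f b \<le> f (k * b)"
    and bound: "\<And>b. b > 0 \<Longrightarrow> f b \<le> C * real b ^ d"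
  shows "convergent (\<lambda>b. f b / real b ^ d)"
proof -
  define a where "a b = f b / real b ^ d" for b
  have aC: "a b \<le> C" if "b > 0" for b using bound[OF that] that by (simp add: a_def divide_le_eq)
  have bdd: "bdd_above (a ` {0<..})" using aC by (intro bdd_aboveI[of _ C]) auto
  define S where "S = (SUP b\<in>{0<..}. a b)"
  have up: "a b \<le> S" if "b > 0" for b unfolding S_def using that by (intro cSUP_upper bdd) auto
  have "a \<longlonglongrightarrow> S"
  proof (rule order_tendstoI)
    fix u assume u: "u > S"
    show "eventually (\<lambda>b. a b < u) sequentially"
      using eventually_gt_at_top[of 0]
    proof eventually_elim
      case (elim b)
      then show ?case using up[of b] u by linarith
    qed
  next
    fix u assume u: "u < S"
    then obtain b0 where b0: "b0 > 0" "u < a b0"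
      unfolding S_def using less_cSUP_iff[OF _ bdd, of u] by auto
    have "(\<lambda>B. (1 - real b0 / real B) ^ d * a b0) \<longlonglongrightarrow> (1 - 0) ^ d * a b0"
      by (intro tendsto_intros lim_const_over_n)
    then have "(\<lambda>B. (1 - real b0 / real B) ^ d * a b0) \<longlonglongrightarrow> a b0" by simp
    then have "eventually (\<lambda>B. u < (1 - real b0 / real B) ^ d * a b0) sequentially" using b0(2) by (rule order_tendstoD)
    then show "eventually (\<lambda>B. u < a B) sequentially"
      using eventually_ge_at_top[of b0]
    proof eventually_elim
      case (elim B)
      define k where "k = B div b0"
      have k: "k > 0" using elim b0 by (simp add: k_def div_greater_zero_iff)
      have B: "B > 0" using elim b0 by simp
      have kB: "k * b0 \<le> B" by (simp add: k_def)
      have "B < (k + 1) * b0" using b0 by (simp add: k_def dividend_less_div_times add.commute)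
      then have "real B < (real k + 1) * real b0" by (metis of_nat_less_iff of_nat_mult of_nat_Suc Suc_eq_plus1 add.commute)
      then have "real B - real b0 \<le> real k * real b0" by (simp add: algebra_simps)
      then have "(real B - real b0) / real B \<le> real k * real b0 / real B" by (rule divide_right_mono) simp
      then have "1 - real b0 / real B \<le> real k * real b0 / real B" using B by (simp add: diff_divide_distrib)
      moreover have "0 \<le> 1 - real b0 / real B" using elim B by simp
      ultimately have "(1 - real b0 / real B) ^ d * a b0 \<le> (real k * real b0 / real B) ^ d * a b0"
        using nonneg by (intro mult_right_mono power_mono) (auto simp: a_def)
      also have "\<dots> = real k ^ d * f b0 / real B ^ d"
        using b0 by (simp add: a_def power_mult_distrib power_divide)
      also have "\<dots> \<le> f (k * b0) / real B ^ d" using mult[OF k b0(1)] by (intro divide_right_mono) auto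
      also have "\<dots> \<le> a B" unfolding a_def using monoD[OF mono kB] by (intro divide_right_mono) auto
      finally show ?case using elim by linarith
    qed
  qed
  then show ?thesis unfolding a_def convergent_def by blast
qed

text \<open>The exponent \<open>e\<close> will be shared by all crossing pairings for a given
  \<open>l\<close>. If it exceeds \<open>nvert n \<pi> - 1\<close>, the limit is
  \<open>0\<close>.\<close>

lemma int_walks_convergent:
  assumes \<pi>: "\<pi> \<in> pairings {..<n}" and n: "n > 0" and e: "nvert n \<pi> - 1 \<le> e"
  shows "convergent (\<lambda>b. real (card (int_walks b n \<pi>)) / (2 * real b + 1) ^ e)"
proof -
  define d where "d = nvert n \<pi> - 1"
  \<comment> \<open>The shift by one turns the refinement inequality into supermultiplicativity in
    \<open>b\<close>.\<close>
  define f where "f b = real (card (int_walks (b - 1) n \<pi>))" for b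
  have "convergent (\<lambda>b. f b / real b ^ d)"
  proof (rule supermultiplicative_convergent)
    show "mono f" by (rule monoI) (auto simp: f_def intro!: card_int_walks_mono diff_le_mono)
    show "real k ^ d * f b \<le> f (k * b)" if "k > 0" "b > 0" for k b
    proof -
      have "real (k ^ d * card (int_walks (b - 1) n \<pi>)) \<le> real (card (int_walks (k * b - 1) n \<pi>))"
        using card_int_walks_refine[OF \<pi> n that] unfolding d_def by (rule of_nat_mono)
      then show ?thesis by (simp add: f_def)
    qed
    show "f b \<le> 2 ^ d * real b ^ d" if "b > 0" for b
    proof -
      have "f b \<le> real ((2 * (b - 1) + 1) ^ d)" using card_int_walks_le[OF n \<pi>] unfolding f_def d_def by (rule of_nat_mono)
      also have "\<dots> \<le> real ((2 * b) ^ d)" using that by (intro of_nat_mono power_mono) linarith+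
      finally show ?thesis by (simp add: power_mult_distrib)
    qed
  qed (simp add: f_def)
  then obtain L where "(\<lambda>b. f b / real b ^ d) \<longlonglongrightarrow> L" by (auto simp: convergent_def)
  then have L: "(\<lambda>b. f (Suc b) / real (Suc b) ^ d) \<longlonglongrightarrow> L" by (rule LIMSEQ_Suc)
  have "(\<lambda>b. (real (Suc b) / (2 * real b + 1)) ^ d) \<longlonglongrightarrow> (1/2) ^ d"
  proof (rule tendsto_power)
    show "(\<lambda>b. real (Suc b) / (2 * real b + 1)) \<longlonglongrightarrow> 1/2" by real_asymp
  qed
  \<comment> \<open>\<open>0 ^ (e - d)\<close> is \<open>1\<close> if \<open>e = d\<close>, so this
    factor discards exactly the pairings with too few vertices.\<close>
  moreover have "(\<lambda>b. (1 / (2 * real b + 1)) ^ (e - d)) \<longlonglongrightarrow> 0 ^ (e - d)"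
  proof (rule tendsto_power)
    show "(\<lambda>b. 1 / (2 * real b + 1)) \<longlonglongrightarrow> 0" by real_asymp
  qed
  ultimately have "(\<lambda>b. f (Suc b) / real (Suc b) ^ d * (real (Suc b) / (2 * real b + 1)) ^ d * (1 / (2 * real b + 1)) ^ (e - d)) \<longlonglongrightarrow> L * (1/2) ^ d * 0 ^ (e - d)"
    by (intro tendsto_mult L)
  moreover have "f (Suc b) / real (Suc b) ^ d * (real (Suc b) / (2 * real b + 1)) ^ d * (1 / (2 * real b + 1)) ^ (e - d) =
    real (card (int_walks b n \<pi>)) / (2 * real b + 1) ^ e" for b
  proof -
    have "(2 * real b + 1) ^ e = (2 * real b + 1) ^ d * (2 * real b + 1) ^ (e - d)"
      using e by (simp add: d_def flip: power_add)
    then show ?thesis by (simp add: f_def power_divide power_one_over)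
  qed
  ultimately show ?thesis unfolding convergent_def by auto
qed

section \<open>A crossing pairing with many walks\<close>

definition cross_pairing :: "nat \<Rightarrow> nat \<Rightarrow> nat" where
  "cross_pairing l p = (if p < 4 then (p + 2) mod 4 else if p < 2 * l then (if even p then p + 1 else p - 1) else p)"

text \<open>The first four steps are glued to a torus by the pairs \<open>0, 2\<close> and
  \<open>1, 3\<close>; the others are paired with a neighbour and attach \<open>l - 2\<close>
  dangling edges. This attains \<open>l - 1\<close> vertices, the maximum under a crossing.\<close>

lemma cross_pairing:
  assumes "l \<ge> 2"
  shows "cross_pairing l \<in> pairings {..<2 * l}" "\<not> noncrossing {..<2 * l} (cross_pairing l)"
proof -
  have c: "cross_pairing l 0 = 2" "cross_pairing l 1 = 3" by (auto simp: cross_pairing_def)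
  show "\<not> noncrossing {..<2 * l} (cross_pairing l)"
  proof -
    have "0 < (1::nat) \<and> 1 < cross_pairing l 0 \<and> cross_pairing l 0 < cross_pairing l 1" unfolding c by simp
    moreover have "0 \<in> {..<2 * l}" "1 \<in> {..<2 * l}" using assms by auto
    ultimately show ?thesis unfolding noncrossing_def by blast
  qed
  show "cross_pairing l \<in> pairings {..<2 * l}"
  proof (rule involution_pairing)
    fix p assume p: "p \<in> {..<2 * l}"
    consider "p = 0" | "p = 1" | "p = 2" | "p = 3" | "p \<ge> 4" "even p" | "p \<ge> 4" "odd p" by linarith
    then show "cross_pairing l p \<in> {..<2 * l} \<and> cross_pairing l p \<noteq> p \<and> cross_pairing l (cross_pairing l p) = p"
    proof cases
      case 5
      then have "p + 1 < 2 * l" using p by (auto elim!: evenE)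
      then show ?thesis using 5 p by (simp add: cross_pairing_def)
    next
      case 6
      then obtain j where j: "p = 2 * j + 1" by (elim oddE)
      then have "j \<ge> 2" using 6 by simp
      then show ?thesis using j p by (simp add: cross_pairing_def)
    qed (use assms in \<open>auto simp: cross_pairing_def\<close>)
  qed (use assms in \<open>auto simp: cross_pairing_def\<close>)
qed

text \<open>All vertices are placed at \<open>0\<close> except the free ends of the
  \<open>l - 2\<close> dangling edges, which are the odd points from \<open>5\<close> on and range
  independently over \<open>{- b..b}\<close>.\<close>

lemma card_int_walks_cross_pairing:
  assumes l: "l \<ge> 2"
  shows "(2 * b + 1) ^ (l - 2) \<le> card (int_walks b (2 * l) (cross_pairing l))"
proof -
  let ?n = "2 * l"
  let ?Z = "{2..<l} \<rightarrow>\<^sub>E {- int b..int b}"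
  define g where "g z p = (if p < ?n then (if odd p \<and> p \<ge> 5 then z (p div 2) else 0) else undefined)" for z :: "nat \<Rightarrow> int" and p
  have inj: "inj_on g ?Z"
  proof (rule inj_onI)
    fix y z assume yz: "y \<in> ?Z" "z \<in> ?Z" "g y = g z"
    show "y = z"
    proof (rule extensionalityI[of _ "{2..<l}"])
      fix j assume "j \<in> {2..<l}"
      then show "y j = z j" using fun_cong[OF yz(3), of "2 * j + 1"] by (simp add: g_def)
    qed (use yz in \<open>auto simp: PiE_iff\<close>)
  qed
  have sub: "g ` ?Z \<subseteq> int_walks b ?n (cross_pairing l)"
  proof
    fix x assume "x \<in> g ` ?Z"
    then obtain z where z: "z \<in> ?Z" "x = g z" by blast
    have ev: "x p = 0" if "p < ?n" "even p \<or> p < 5" for p using that by (auto simp: z(2) g_def)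
    have bd: "\<bar>x p\<bar> \<le> int b" if "p < ?n" for p
    proof (cases "odd p \<and> p \<ge> 5")
      case True
      then have "p div 2 \<in> {2..<l}" using that by auto
      then have "z (p div 2) \<in> {- int b..int b}" using z(1) by (auto simp: PiE_iff)
      then show ?thesis using True that by (auto simp: z(2) g_def)
    next
      case False then show ?thesis using ev[of p] that by auto
    qed
    have "x (cross_pairing l k) = x (Suc k mod ?n) \<and> \<bar>x (Suc k mod ?n) - x k\<bar> \<le> int b" if k: "k < ?n" for k
    proof -
      have sk: "Suc k mod ?n < ?n" "even (Suc k mod ?n) \<longleftrightarrow> odd k" using l by (auto simp: dvd_mod_iff)
      \<comment> \<open>Consecutive points have opposite parity, also across the closing step, so
        one end of each step is at \<open>0\<close>.\<close>
      have z0: "x (Suc k mod ?n) = 0 \<or> x k = 0" using ev[OF k] ev[OF sk(1)] sk(2) by blast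
      have "x (cross_pairing l k) = x (Suc k mod ?n)"
      proof (cases "k < 4")
        case True
        then have "Suc k mod ?n < 5" "cross_pairing l k < 5" by (auto simp: cross_pairing_def intro: le_less_trans[OF mod_less_eq_dividend])
        moreover have "cross_pairing l k < ?n" using pairingsD(4)[OF cross_pairing(1)[OF l], of k] k by simp
        ultimately show ?thesis using ev[OF sk(1)] ev[of "cross_pairing l k"] by simp
      next
        case False
        show ?thesis
        proof (cases "even k")
          case True
          then have "Suc k < ?n" using k by (auto elim!: evenE)
          then show ?thesis using True False k by (simp add: cross_pairing_def)
        next
          case odd: False
          then have "even (cross_pairing l k)" "cross_pairing l k < ?n" using False k by (auto simp: cross_pairing_def)
          then show ?thesis using ev[OF sk(1)] ev[of "cross_pairing l k"] sk(2) odd by simp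
        qed
      qed
      then show ?thesis using z0 bd[OF k] bd[OF sk(1)] by auto
    qed
    moreover have "x 0 = 0" using ev[of 0] l by simp
    moreover have "x \<in> {..<?n} \<rightarrow>\<^sub>E UNIV" by (simp add: PiE_iff z(2) g_def extensional_def)
    ultimately show "x \<in> int_walks b ?n (cross_pairing l)" unfolding int_walks_def by blast
  qed
  have "card ?Z = (2 * b + 1) ^ (l - 2)" by (subst card_PiE) (auto simp: nat_add_distrib nat_mult_distrib)
  then show ?thesis using card_inj_on_le[OF inj sub finite_int_walks] by simp
qed

section \<open>The semicircle law\<close>

context
  fixes s :: real assumes s: "s > 0"
begin

definition sc_weight :: "real \<Rightarrow> real" where
  "sc_weight t = sqrt (4 * s - t\<^sup>2)"

definition sc_int :: "nat \<Rightarrow> real" where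
  "sc_int k = integral {- 2 * sqrt s..2 * sqrt s} (\<lambda>t. t ^ k * sc_weight t)"

lemma sc_bounds: "t \<in> {- 2 * sqrt s..2 * sqrt s} \<longleftrightarrow> t\<^sup>2 \<le> 4 * s" "t \<in> {- 2 * sqrt s<..<2 * sqrt s} \<Longrightarrow> t\<^sup>2 < 4 * s"
proof -
  have e: "(2 * sqrt s)\<^sup>2 = 4 * s" using s by (simp add: power_mult_distrib)
  have "t \<in> {- 2 * sqrt s..2 * sqrt s} \<longleftrightarrow> \<bar>t\<bar> \<le> \<bar>2 * sqrt s\<bar>" using s by (auto simp: abs_le_iff)
  then show "t \<in> {- 2 * sqrt s..2 * sqrt s} \<longleftrightarrow> t\<^sup>2 \<le> 4 * s" unfolding abs_le_square_iff e .
  assume "t \<in> {- 2 * sqrt s<..<2 * sqrt s}"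
  then have "\<bar>t\<bar> < 2 * sqrt s" by auto
  then have "\<bar>t\<bar>\<^sup>2 < (2 * sqrt s)\<^sup>2" by (intro power_strict_mono) auto
  then show "t\<^sup>2 < 4 * s" unfolding e by simp
qed

lemma sc_weight_cont: "continuous_on A sc_weight"
  unfolding sc_weight_def by (intro continuous_intros)

lemma sc_weight_deriv:
  assumes "t \<in> {- 2 * sqrt s<..<2 * sqrt s}"
  shows "(sc_weight has_real_derivative - t / sc_weight t) (at t)" "sc_weight t > 0" "(sc_weight t)\<^sup>2 = 4 * s - t\<^sup>2"
proof -
  have p: "4 * s - t\<^sup>2 > 0" using sc_bounds(2)[OF assms] by simp
  show "sc_weight t > 0" "(sc_weight t)\<^sup>2 = 4 * s - t\<^sup>2" using p by (auto simp: sc_weight_def)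
  show "(sc_weight has_real_derivative - t / sc_weight t) (at t)"
    unfolding sc_weight_def[abs_def] using p
    by (auto intro!: derivative_eq_intros simp: field_simps)
qed

lemma sc_has_int: "((\<lambda>t. t ^ k * sc_weight t) has_integral sc_int k) {- 2 * sqrt s..2 * sqrt s}"
  unfolding sc_int_def
  by (intro integrable_integral integrable_continuous_real continuous_intros sc_weight_cont)

lemma sc_weight_ends [simp]: "sc_weight (2 * sqrt s) = 0" "sc_weight (- (2 * sqrt s)) = 0"
  using s by (auto simp: sc_weight_def power_mult_distrib)

text \<open>Integrates the derivative of \<open>t^(k+1) (4 s - t^2)^(3/2)\<close>, a function
  vanishing at both ends; the exponent \<open>3/2\<close> makes its derivative a polynomial times
  the weight.\<close>

lemma sc_int_rec: "real (k + 4) * sc_int (k + 2) = 4 * s * real (k + 1) * sc_int k"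
proof -
  let ?G = "\<lambda>t. t ^ (k + 1) * sc_weight t ^ 3"
  let ?g = "\<lambda>t. 4 * s * real (k + 1) * (t ^ k * sc_weight t) - real (k + 4) * (t ^ (k + 2) * sc_weight t)"
  have "(?g has_integral ?G (2 * sqrt s) - ?G (- 2 * sqrt s)) {- 2 * sqrt s..2 * sqrt s}"
  \<comment> \<open>The weight is not differentiable at the end points, so derivatives are taken in
    the interior and continuity is used up to the boundary.\<close>
  proof (rule fundamental_theorem_of_calculus_interior)
    show "- 2 * sqrt s \<le> 2 * sqrt s" using s by simp
    show "continuous_on {- 2 * sqrt s..2 * sqrt s} ?G" by (intro continuous_intros sc_weight_cont)
    fix t assume t: "t \<in> {- 2 * sqrt s<..<2 * sqrt s}"
    note d = sc_weight_deriv[OF t]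
    have "(?G has_real_derivative real (k + 1) * t ^ (k + 1 - Suc 0) * sc_weight t ^ 3 +
        real 3 * (- t / sc_weight t * sc_weight t ^ (3 - Suc 0)) * t ^ (k + 1)) (at t)"
      by (intro DERIV_mult DERIV_pow DERIV_power d(1))
    moreover have "real (k + 1) * t ^ (k + 1 - Suc 0) * sc_weight t ^ 3 +
        real 3 * (- t / sc_weight t * sc_weight t ^ (3 - Suc 0)) * t ^ (k + 1) = ?g t"
    proof -
      have w3: "sc_weight t ^ 3 = sc_weight t * (4 * s - t\<^sup>2)" unfolding d(3)[symmetric] by (simp add: power3_eq_cube power2_eq_square)
      have w2: "- t / sc_weight t * sc_weight t ^ (3 - Suc 0) = - t * sc_weight t" using d(2) by (simp add: numeral_eq_Suc)
      show ?thesis unfolding w3 w2 by (simp add: algebra_simps power2_eq_square)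
    qed
    ultimately show "(?G has_vector_derivative ?g t) (at t)" by (simp add: has_real_derivative_iff_has_vector_derivative)
  qed
  then have "(?g has_integral 0) {- 2 * sqrt s..2 * sqrt s}" by simp
  moreover have "(?g has_integral 4 * s * real (k + 1) * sc_int k - real (k + 4) * sc_int (k + 2)) {- 2 * sqrt s..2 * sqrt s}"
    by (intro has_integral_diff has_integral_mult_right sc_has_int)
  ultimately have "0 = 4 * s * real (k + 1) * sc_int k - real (k + 4) * sc_int (k + 2)" by (rule has_integral_unique)
  then show ?thesis by simp
qed

lemma sc_int_1: "sc_int 1 = 0"
proof -
  let ?G = "\<lambda>t. - (sc_weight t ^ 3) / 3"
  have "((\<lambda>t. t ^ 1 * sc_weight t) has_integral ?G (2 * sqrt s) - ?G (- 2 * sqrt s)) {- 2 * sqrt s..2 * sqrt s}"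
  proof (rule fundamental_theorem_of_calculus_interior)
    show "- 2 * sqrt s \<le> 2 * sqrt s" using s by simp
    show "continuous_on {- 2 * sqrt s..2 * sqrt s} ?G" by (intro continuous_intros sc_weight_cont) auto
    fix t assume t: "t \<in> {- 2 * sqrt s<..<2 * sqrt s}"
    note d = sc_weight_deriv[OF t]
    have "(?G has_real_derivative - (real 3 * (- t / sc_weight t * sc_weight t ^ (3 - Suc 0))) / 3) (at t)"
      by (intro DERIV_cdivide DERIV_minus DERIV_power d(1))
    moreover have "- (real 3 * (- t / sc_weight t * sc_weight t ^ (3 - Suc 0))) / 3 = t ^ 1 * sc_weight t"
      using d(2) by (simp add: numeral_eq_Suc)
    ultimately show "(?G has_vector_derivative t ^ 1 * sc_weight t) (at t)"
      by (simp add: has_real_derivative_iff_has_vector_derivative)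
  qed
  then have "((\<lambda>t. t ^ 1 * sc_weight t) has_integral 0) {- 2 * sqrt s..2 * sqrt s}" by simp
  then show ?thesis using sc_has_int[of 1] has_integral_unique by blast
qed

text \<open>The area of a half disc of radius \<open>2 * sqrt s\<close>, by the usual primitive with
  \<open>arcsin\<close>.\<close>

lemma sc_int_0: "sc_int 0 = 2 * pi * s"
proof -
  let ?G = "\<lambda>t. t * sc_weight t / 2 + 2 * s * arcsin (t / (2 * sqrt s))"
  have "((\<lambda>t. t ^ 0 * sc_weight t) has_integral ?G (2 * sqrt s) - ?G (- 2 * sqrt s)) {- 2 * sqrt s..2 * sqrt s}"
  proof (rule fundamental_theorem_of_calculus_interior)
    show "- 2 * sqrt s \<le> 2 * sqrt s" using s by simp
    show "continuous_on {- 2 * sqrt s..2 * sqrt s} ?G"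
      using s by (intro continuous_intros sc_weight_cont) (auto simp: field_simps)
    fix t assume t: "t \<in> {- 2 * sqrt s<..<2 * sqrt s}"
    note d = sc_weight_deriv[OF t]
    have r: "- 1 < t / (2 * sqrt s)" "t / (2 * sqrt s) < 1" using t s by (auto simp: field_simps)
    have sq: "sqrt (1 - (t / (2 * sqrt s))\<^sup>2) = sc_weight t / (2 * sqrt s)"
    proof -
      have "1 - (t / (2 * sqrt s))\<^sup>2 = (4 * s - t\<^sup>2) / (2 * sqrt s)\<^sup>2"
        using s by (simp add: power_divide power_mult_distrib field_simps)
      then have "sqrt (1 - (t / (2 * sqrt s))\<^sup>2) = sqrt (4 * s - t\<^sup>2) / sqrt ((2 * sqrt s)\<^sup>2)"
        by (simp only: real_sqrt_divide)
      then show ?thesis using s unfolding real_sqrt_abs by (simp add: sc_weight_def)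
    qed
    have "(?G has_real_derivative (1 * sc_weight t + - t / sc_weight t * t) / 2 +
        2 * s * (inverse (sqrt (1 - (t / (2 * sqrt s))\<^sup>2)) * (1 / (2 * sqrt s)))) (at t)"
      by (intro DERIV_add DERIV_cdivide DERIV_mult DERIV_ident d(1) DERIV_cmult DERIV_chain2[where f = arcsin and g = "\<lambda>t. t / (2 * sqrt s)", OF DERIV_arcsin[OF r]])
    moreover have "(1 * sc_weight t + - t / sc_weight t * t) / 2 +
        2 * s * (inverse (sqrt (1 - (t / (2 * sqrt s))\<^sup>2)) * (1 / (2 * sqrt s))) = t ^ 0 * sc_weight t"
    proof -
      have a: "inverse (sc_weight t / (2 * sqrt s)) * (1 / (2 * sqrt s)) = 1 / sc_weight t" using s d(2) by (simp add: field_simps)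
      have b: "(1 * sc_weight t + - t / sc_weight t * t) / 2 + 2 * s * (1 / sc_weight t) = ((sc_weight t)\<^sup>2 - t\<^sup>2 + 4 * s) / (2 * sc_weight t)"
        using d(2) by (simp add: field_simps power2_eq_square)
      have c: "(sc_weight t)\<^sup>2 - t\<^sup>2 + 4 * s = 2 * (sc_weight t)\<^sup>2" using d(3) by simp
      show ?thesis unfolding sq a b c using d(2) by (simp add: power2_eq_square)
    qed
    ultimately show "(?G has_vector_derivative t ^ 0 * sc_weight t) (at t)"
      by (simp add: has_real_derivative_iff_has_vector_derivative)
  qed
  moreover have "?G (2 * sqrt s) - ?G (- 2 * sqrt s) = 2 * pi * s" using s by simp
  ultimately show ?thesis using sc_has_int[of 0] has_integral_unique by metis
qed

definition sc_moment :: "nat \<Rightarrow> real" where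
  "sc_moment k = (if even k then s ^ (k div 2) * catalan (k div 2) else 0)"

text \<open>Both sides obey the same recursion in steps of two, which for the right-hand side is
  \<open>catalan_Suc\<close>; two initial values settle the even and the odd case.\<close>

lemma sc_int_eq: "sc_int k = 2 * pi * s * sc_moment k"
proof (induction k rule: induct_nat_012)
  case 0 then show ?case by (simp add: sc_int_0 sc_moment_def)
next
  case 1 then show ?case using sc_int_1 by (simp add: sc_moment_def)
next
  case (ge2 k)
  have "real (k + 4) * sc_moment (k + 2) = 4 * s * real (k + 1) * sc_moment k"
  proof (cases "even k")
    case True
    then obtain l where k: "k = 2 * l" by (elim evenE)
    have "real (k + 4) * sc_moment (k + 2) = 2 * s ^ Suc l * (real (l + 2) * catalan (Suc l))"
      by (simp add: k sc_moment_def algebra_simps)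
    also have "\<dots> = 4 * s * real (k + 1) * sc_moment k"
      unfolding catalan_Suc by (simp add: k sc_moment_def algebra_simps)
    finally show ?thesis .
  qed (simp add: sc_moment_def)
  then have "real (k + 4) * sc_int (k + 2) = real (k + 4) * (2 * pi * s * sc_moment (k + 2))"
    unfolding sc_int_rec ge2(1) by (simp add: algebra_simps)
  moreover have "real (k + 4) \<noteq> 0" by simp
  ultimately have "sc_int (k + 2) = 2 * pi * s * sc_moment (k + 2)" by (simp only: mult_cancel_left) simp
  then show ?case by simp
qed

text \<open>Translates integrals against the density into gauge integrals over the support, where
  the fundamental theorem of calculus applies.\<close>

lemma semicircle_integral:
  fixes g :: "real \<Rightarrow> real"
  assumes g: "continuous_on UNIV g"
  shows "integrable (semicircle s) g"
    and "(\<integral>t. g t \<partial>semicircle s) = integral {- 2 * sqrt s..2 * sqrt s} (\<lambda>t. g t * sc_weight t) / (2 * pi * s)"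
proof -
  let ?I = "{- 2 * sqrt s..2 * sqrt s}"
  let ?d = "\<lambda>t. indicator ?I t * (sqrt (4 * s - t\<^sup>2) / (2 * pi * s)) :: real"
  have gm: "g \<in> borel_measurable lborel" using borel_measurable_continuous_onI[OF g] by simp
  have dm: "?d \<in> borel_measurable lborel" by measurable
  have nn: "AE t in lborel. 0 \<le> ?d t"
    using s by (intro AE_I2) (auto simp: indicator_def sc_bounds(1)[symmetric] dest: sc_bounds(1)[THEN iffD1])
  have e: "?d t *\<^sub>R g t = indicator ?I t *\<^sub>R (g t * sc_weight t / (2 * pi * s))" for t
    by (simp add: sc_weight_def)
  have c: "continuous_on ?I (\<lambda>t. g t * sc_weight t / (2 * pi * s))"
    using s by (intro continuous_intros sc_weight_cont continuous_on_subset[OF g]) auto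
  have si: "set_integrable lborel ?I (\<lambda>t. g t * sc_weight t / (2 * pi * s))"
    using c by (rule borel_integrable_atLeastAtMost')
  show "integrable (semicircle s) g"
    unfolding semicircle_def integrable_density[OF gm dm nn] e using si by (simp add: set_integrable_def)
  have "(\<integral>t. g t \<partial>semicircle s) = (LINT t:?I|lborel. g t * sc_weight t / (2 * pi * s))"
    unfolding semicircle_def integral_density[OF gm dm nn] e set_lebesgue_integral_def ..
  also have "\<dots> = integral ?I (\<lambda>t. g t * sc_weight t / (2 * pi * s))"
    by (rule set_borel_integral_eq_integral(2)[OF si])
  finally show "(\<integral>t. g t \<partial>semicircle s) = integral ?I (\<lambda>t. g t * sc_weight t) / (2 * pi * s)" by simp
qed

lemma semicircle_moment: "integrable (semicircle s) (\<lambda>t. t ^ k)" "(\<integral>t. t ^ k \<partial>semicircle s) = sc_moment k"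
proof -
  have c: "continuous_on UNIV (\<lambda>t::real. t ^ k)" by (intro continuous_intros)
  show "integrable (semicircle s) (\<lambda>t. t ^ k)" by (rule semicircle_integral(1)[OF c])
  show "(\<integral>t. t ^ k \<partial>semicircle s) = sc_moment k"
    using semicircle_integral(2)[OF c] sc_int_eq[of k] s by (simp add: sc_int_def)
qed

lemma moments_of_semicircle: "moments_of (semicircle s) P = (\<Sum>i\<le>degree P. coeff P i * complex_of_real (sc_moment i))"
proof -
  have "moments_of (semicircle s) P = (\<integral>t. (\<Sum>i\<le>degree P. coeff P i * complex_of_real (t ^ i)) \<partial>semicircle s)"
    by (simp add: moments_of_def poly_altdef)
  also have "\<dots> = (\<Sum>i\<le>degree P. \<integral>t. coeff P i * complex_of_real (t ^ i) \<partial>semicircle s)"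
    by (intro Bochner_Integration.integral_sum integrable_mult_right integrable_of_real semicircle_moment)
  also have "\<dots> = (\<Sum>i\<le>degree P. coeff P i * complex_of_real (sc_moment i))"
    by (simp add: semicircle_moment del: of_real_power)
  finally show ?thesis .
qed

lemma semicircle_law: "prob_space (semicircle s)" "compact_finite_measure (semicircle s)"
proof -
  have i1: "integrable (semicircle s) (\<lambda>t. 1 :: real)" "(\<integral>t. 1 \<partial>semicircle s) = (1 :: real)"
    using semicircle_moment[of 0] by (auto simp: sc_moment_def)
  have fin: "emeasure (semicircle s) (space (semicircle s)) \<noteq> \<infinity>"
    using i1(1) unfolding integrable_iff_bounded by simp
  have m: "measure (semicircle s) (space (semicircle s)) = 1" using i1(2) by simp
  show p: "prob_space (semicircle s)"
    by (rule prob_spaceI) (use fin m in \<open>simp add: emeasure_eq_ennreal_measure\<close>)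
  have "AE t in semicircle s. \<bar>t\<bar> \<le> 2 * sqrt s"
    unfolding semicircle_def by (subst AE_density) (auto simp: indicator_def abs_le_iff intro!: AE_I2 split: if_splits)
  then show "compact_finite_measure (semicircle s)"
    unfolding compact_finite_measure_def using prob_space.finite_measure[OF p] by (auto simp: semicircle_def)
qed

end

section \<open>From traces of powers to the type \<open>B\<close> distribution\<close>

lemma trace_poly_mat:
  assumes "A \<in> carrier_mat N N"
  shows "mat_trace (poly_mat P A) = (\<Sum>i\<le>degree P. coeff P i * mat_trace (A ^\<^sub>m i))"
proof -
  have "mat_trace (poly_mat P A) = (\<Sum>j<N. \<Sum>i\<le>degree P. coeff P i * (A ^\<^sub>m i) $$ (j, j))"
    using assms by (simp add: mat_trace_def poly_mat_def)
  also have "\<dots> = (\<Sum>i\<le>degree P. \<Sum>j<N. coeff P i * (A ^\<^sub>m i) $$ (j, j))" by (rule sum.swap)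
  also have "\<dots> = (\<Sum>i\<le>degree P. coeff P i * mat_trace (A ^\<^sub>m i))"
    using assms by (simp add: mat_trace_def sum_distrib_left)
  finally show ?thesis .
qed

text \<open>An error \<open>o(1)\<close> in the unnormalized traces of powers is just what
  \<open>\<nu> = 0\<close> requires, and divided by \<open>N\<close> it yields the convergence to
  the semicircle moments. Polynomials follow by linearity.\<close>

lemma type_B_law_semicircle:
  assumes s: "s > 0"
    and sa: "\<And>N. N > 0 \<Longrightarrow> random_selfadjoint (M N) N (A N)"
    and ent: "\<And>N j k p. N > 0 \<Longrightarrow> j < N \<Longrightarrow> k < N \<Longrightarrow> integrable (M N) (\<lambda>\<omega>. cmod (A N \<omega> $$ (j, k)) ^ p)"
    and int: "\<And>N i. N > 0 \<Longrightarrow> integrable (M N) (\<lambda>\<omega>. mat_trace (A N \<omega> ^\<^sub>m i))"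
    and lim: "\<And>i. (\<lambda>N. (\<integral>\<omega>. mat_trace (A N \<omega> ^\<^sub>m i) \<partial>M N) - of_nat N * complex_of_real (sc_moment s i)) \<longlonglongrightarrow> 0"
  shows "type_B_law M A (semicircle s) zero_signed"
proof -
  have null: "moments_of (null_measure borel) P = 0" for P by (simp add: moments_of_def)
  have nullc: "compact_finite_measure (null_measure borel)"
    unfolding compact_finite_measure_def
  proof (intro conjI exI)
    show "finite_measure (null_measure (borel :: real measure))" by (rule finite_measureI) simp
    show "AE t in null_measure borel. \<bar>t :: real\<bar> \<le> 0" by (rule AE_I[where N = UNIV]) auto
  qed simp
  define R where "R P N = (\<Sum>i\<le>degree P. coeff P i * ((\<integral>\<omega>. mat_trace (A N \<omega> ^\<^sub>m i) \<partial>M N) - of_nat N * complex_of_real (sc_moment s i)))" for P N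
  have R0: "R P \<longlonglongrightarrow> 0" for P
  proof -
    have "R P \<longlonglongrightarrow> (\<Sum>i\<le>degree P. coeff P i * 0)" unfolding R_def by (intro tendsto_sum tendsto_mult tendsto_const lim)
    then show ?thesis by simp
  qed
  have mm: "mean_moment (M N) N (A N) P = moments_of (semicircle s) P + R P N / of_nat N" if N: "N > 0" for N P
  proof -
    have car: "A N \<omega> \<in> carrier_mat N N" if "\<omega> \<in> space (M N)" for \<omega> using sa[OF N] that by (simp add: random_selfadjoint_def)
    have "(\<integral>\<omega>. mat_trace (poly_mat P (A N \<omega>)) \<partial>M N) = (\<integral>\<omega>. (\<Sum>i\<le>degree P. coeff P i * mat_trace (A N \<omega> ^\<^sub>m i)) \<partial>M N)"
      by (rule Bochner_Integration.integral_cong[OF refl]) (rule trace_poly_mat[OF car])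
    also have "\<dots> = (\<Sum>i\<le>degree P. coeff P i * (\<integral>\<omega>. mat_trace (A N \<omega> ^\<^sub>m i) \<partial>M N))"
      using int[OF N] by (subst Bochner_Integration.integral_sum) auto
    also have "\<dots> = of_nat N * moments_of (semicircle s) P + R P N"
      unfolding R_def moments_of_semicircle[OF s] by (simp add: sum_distrib_left sum.distrib[symmetric] algebra_simps)
    finally show ?thesis using N by (simp add: mean_moment_def add_divide_distrib)
  qed
  have l1: "(\<lambda>N. of_nat N * (mean_moment (M N) N (A N) P - moments_of (semicircle s) P)) \<longlonglongrightarrow> 0" for P
    by (rule Lim_transform_eventually[OF R0[of P]])
      (rule eventually_mono[OF eventually_gt_at_top[of 0]], simp add: mm)
  have "(\<lambda>N. R P N * (1 / of_nat N)) \<longlonglongrightarrow> 0 * 0" for P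
    by (intro tendsto_mult R0 lim_1_over_n)
  then have "(\<lambda>N. moments_of (semicircle s) P + R P N * (1 / of_nat N)) \<longlonglongrightarrow> moments_of (semicircle s) P + 0" for P
    by (intro tendsto_add tendsto_const) auto
  then have l2': "(\<lambda>N. moments_of (semicircle s) P + R P N * (1 / of_nat N)) \<longlonglongrightarrow> moments_of (semicircle s) P" for P
    by simp
  have l2: "(\<lambda>N. mean_moment (M N) N (A N) P) \<longlonglongrightarrow> moments_of (semicircle s) P" for P
    by (rule Lim_transform_eventually[OF l2'[of P]])
      (rule eventually_mono[OF eventually_gt_at_top[of 0]], simp add: mm)
  have "type_B_distribution M A (moments_of (semicircle s)) (\<lambda>P. 0)"
    unfolding type_B_distribution_def using sa ent l1 l2 by blast
  then show ?thesis
    unfolding type_B_law_def using semicircle_law[OF s] nullc by (simp add: null)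
qed

section \<open>Asymptotics of the moments\<close>

definition crossings :: "nat \<Rightarrow> (nat \<Rightarrow> nat) set" where
  "crossings l = {\<pi>\<in>pairings {..<2 * l}. \<not> noncrossing {..<2 * l} \<pi>}"

lemma finite_crossings [simp]: "finite (crossings l)"
  by (rule finite_subset[of _ "pairings {..<2 * l}"]) (auto simp: crossings_def)

lemma crossings_small: "l < 2 \<Longrightarrow> crossings l = {}"
proof -
  assume l: "l < 2"
  have "noncrossing {..<2 * l} \<pi>" if \<pi>: "\<pi> \<in> pairings {..<2 * l}" for \<pi>
    unfolding noncrossing_def
  proof (intro notI, elim bexE conjE)
    fix i j assume "i \<in> {..<2 * l}" "j \<in> {..<2 * l}" "i < j" "j < \<pi> i" "\<pi> i < \<pi> j"
    moreover have "\<pi> j < 2 * l" using pairingsD(4)[OF \<pi>, of j] \<open>j \<in> _\<close> by simp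
    ultimately show False using l by linarith
  qed
  then show ?thesis by (auto simp: crossings_def)
qed

lemma crossings_nvert:
  assumes "\<pi> \<in> crossings l"
  shows "\<pi> \<in> pairings {..<2 * l}" "nvert (2 * l) \<pi> - 1 \<le> l - 2" "l \<ge> 2"
proof -
  show \<pi>: "\<pi> \<in> pairings {..<2 * l}" using assms by (simp add: crossings_def)
  show "nvert (2 * l) \<pi> - 1 \<le> l - 2" using crossing_nvert_le[OF \<pi>] assms by (simp add: crossings_def)
  show "l \<ge> 2" using assms crossings_small[of l] by (cases "l < 2") auto
qed

text \<open>The contribution of the crossing pairings to the mean trace, which will be the moment
  defect.\<close>

definition cross_sum :: "nat \<Rightarrow> nat \<Rightarrow> nat \<Rightarrow> real \<Rightarrow> real" where
  "cross_sum N b l s = s ^ l / real (band_norm N b) ^ l * (\<Sum>\<pi>\<in>crossings l. real (card (band_walks N b (2 * l) \<pi>)))"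

lemma band_norm_pos: "N > 0 \<Longrightarrow> band_norm N b > 0"
  by (simp add: band_norm_def)

text \<open>The hypothesis on \<open>c\<close> covers two normalizations:
  \<open>c = 1 / sqrt \<xi>\<close> with variance \<open>s\<close> for the band matrix, and
  \<open>c = 1\<close> with variance \<open>s / N\<close> for the full GUE matrix, where
  \<open>\<xi> = N\<close>.\<close>

lemma trace_moment_cross_sum:
  assumes G: "is_GUE M N s' X" and s': "s' > 0" and N: "N > 0" and l: "l > 0"
    and c: "c\<^sup>2 * s' = s / real (band_norm N b)"
  shows "(\<integral>\<omega>. mat_trace (wband N b c (X \<omega>) ^\<^sub>m (2 * l)) \<partial>M) =
    complex_of_real (real N * s ^ l * catalan l + cross_sum N b l s)"
proof -
  let ?\<xi> = "real (band_norm N b)" and ?P = "pairings {..<2 * l}"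
  have \<xi>: "?\<xi> > 0" using band_norm_pos[OF N] by simp
  have "?P = {\<pi>\<in>?P. noncrossing {..<2 * l} \<pi>} \<union> crossings l" by (auto simp: crossings_def)
  then have "(\<Sum>\<pi>\<in>?P. real (card (band_walks N b (2 * l) \<pi>))) =
    (\<Sum>\<pi>\<in>{\<pi>\<in>?P. noncrossing {..<2 * l} \<pi>} \<union> crossings l. real (card (band_walks N b (2 * l) \<pi>)))" by simp
  also have "\<dots> = (\<Sum>\<pi>\<in>{\<pi>\<in>?P. noncrossing {..<2 * l} \<pi>}. real (card (band_walks N b (2 * l) \<pi>))) +
    (\<Sum>\<pi>\<in>crossings l. real (card (band_walks N b (2 * l) \<pi>)))"
    by (rule sum.union_disjoint) (auto simp: crossings_def)
  also have "(\<Sum>\<pi>\<in>{\<pi>\<in>?P. noncrossing {..<2 * l} \<pi>}. real (card (band_walks N b (2 * l) \<pi>))) =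
    (\<Sum>\<pi>\<in>{\<pi>\<in>?P. noncrossing {..<2 * l} \<pi>}. real N * ?\<xi> ^ l)"
    using card_band_walks_le(2)[where n = "2 * l"] l by (intro sum.cong) auto
  also have "\<dots> = catalan l * (real N * ?\<xi> ^ l)" using card_noncrossing[of l] by simp
  finally have sum: "(\<Sum>\<pi>\<in>?P. real (card (band_walks N b (2 * l) \<pi>))) =
    catalan l * (real N * ?\<xi> ^ l) + (\<Sum>\<pi>\<in>crossings l. real (card (band_walks N b (2 * l) \<pi>)))" .
  have "c ^ (2 * l) * s' ^ l = (c\<^sup>2 * s') ^ l" by (simp add: power_mult power_mult_distrib)
  then have cs: "c ^ (2 * l) * s' ^ l = s ^ l / ?\<xi> ^ l" unfolding c power_divide .
  have "c ^ (2 * l) * s' ^ l * (\<Sum>\<pi>\<in>?P. real (card (band_walks N b (2 * l) \<pi>))) =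
    real N * s ^ l * catalan l + cross_sum N b l s"
    unfolding cs sum cross_sum_def using \<xi> by (simp add: distrib_left)
  then show ?thesis using trace_moment_pairings(2)[OF G s', of "2 * l" b c] l by simp
qed

lemma trace_moment_odd:
  assumes G: "is_GUE M N s' X" and s': "s' > 0" and i: "odd i"
  shows "(\<integral>\<omega>. mat_trace (wband N b c (X \<omega>) ^\<^sub>m i) \<partial>M) = 0"
proof -
  have "pairings {..<i} = {}"
  proof (rule ccontr)
    assume "pairings {..<i} \<noteq> {}"
    then obtain \<pi> where "\<pi> \<in> pairings {..<i}" by auto
    then have "2 * card {k\<in>{..<i}. k < \<pi> k} = i" using card_openers[of \<pi> "{..<i}"] by simp
    then show False using i by (metis dvd_triv_left)
  qed
  then show ?thesis using trace_moment_pairings(2)[OF G s', of i b c] i by (simp add: odd_pos)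
qed

lemma cross_sum_bounds:
  assumes "N > 0" "s > 0"
  shows "0 \<le> cross_sum N b l s"
    and "cross_sum N b l s \<le> s ^ l * real (card (crossings l)) * (real N / real (band_norm N b) ^ 2)"
proof -
  let ?\<xi> = "real (band_norm N b)"
  have \<xi>: "?\<xi> \<ge> 1" using band_norm_pos[OF assms(1), of b] by simp
  show "0 \<le> cross_sum N b l s" using assms unfolding cross_sum_def by (intro mult_nonneg_nonneg sum_nonneg) auto
  have "real (card (band_walks N b (2 * l) \<pi>)) \<le> real N * (?\<xi> ^ l / ?\<xi> ^ 2)" if "\<pi> \<in> crossings l" for \<pi>
  proof -
    note v = crossings_nvert[OF that]
    have "real (card (band_walks N b (2 * l) \<pi>)) \<le> real (N * band_norm N b ^ (nvert (2 * l) \<pi> - 1))"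
      using card_band_walks_le(1)[OF v(1)] v(3) by (intro of_nat_mono) auto
    also have "\<dots> \<le> real N * ?\<xi> ^ (l - 2)" using v(2) \<xi> by (auto intro!: mult_left_mono power_increasing)
    also have "?\<xi> ^ (l - 2) = ?\<xi> ^ l / ?\<xi> ^ 2" using v(3) \<xi> by (intro power_diff) auto
    finally show ?thesis .
  qed
  then have "(\<Sum>\<pi>\<in>crossings l. real (card (band_walks N b (2 * l) \<pi>))) \<le> real (card (crossings l)) * (real N * (?\<xi> ^ l / ?\<xi> ^ 2))"
    by (rule sum_bounded_above)
  then have "cross_sum N b l s \<le> s ^ l / ?\<xi> ^ l * (real (card (crossings l)) * (real N * (?\<xi> ^ l / ?\<xi> ^ 2)))"
    unfolding cross_sum_def using assms by (intro mult_left_mono) auto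
  also have "\<dots> = s ^ l * real (card (crossings l)) * (real N / ?\<xi> ^ 2)" using \<xi> by simp
  finally show "cross_sum N b l s \<le> s ^ l * real (card (crossings l)) * (real N / ?\<xi> ^ 2)" .
qed

lemma cross_sum_tendsto_0:
  assumes s: "s > 0" and l: "(\<lambda>N. real N / real (band_norm N (b N)) ^ 2) \<longlonglongrightarrow> 0"
  shows "(\<lambda>N. cross_sum N (b N) l s) \<longlonglongrightarrow> 0"
proof (rule tendsto_sandwich)
  show "eventually (\<lambda>N. 0 \<le> cross_sum N (b N) l s) sequentially"
    using eventually_gt_at_top[of 0] by eventually_elim (rule cross_sum_bounds(1)[OF _ s])
  show "eventually (\<lambda>N. cross_sum N (b N) l s \<le> s ^ l * real (card (crossings l)) * (real N / real (band_norm N (b N)) ^ 2)) sequentially"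
    using eventually_gt_at_top[of 0] by eventually_elim (rule cross_sum_bounds(2)[OF _ s])
  have "(\<lambda>N. s ^ l * real (card (crossings l)) * (real N / real (band_norm N (b N)) ^ 2)) \<longlonglongrightarrow> s ^ l * real (card (crossings l)) * 0"
    by (intro tendsto_mult tendsto_const l)
  then show "(\<lambda>N. s ^ l * real (card (crossings l)) * (real N / real (band_norm N (b N)) ^ 2)) \<longlonglongrightarrow> 0" by simp
qed simp

text \<open>For \<open>V = l - 1\<close> the volume of the polytope of walks rescaled by
  \<open>2 b + 1\<close>; with fewer vertices the value is \<open>0\<close>, because all crossing
  pairings are normalized by the exponent \<open>l - 2\<close>.\<close>

definition walk_density :: "nat \<Rightarrow> (nat \<Rightarrow> nat) \<Rightarrow> real" where
  "walk_density l \<pi> = lim (\<lambda>b. real (card (int_walks b (2 * l) \<pi>)) / (2 * real b + 1) ^ (l - 2))"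

lemma walk_density:
  assumes "\<pi> \<in> crossings l"
  shows "(\<lambda>b. real (card (int_walks b (2 * l) \<pi>)) / (2 * real b + 1) ^ (l - 2)) \<longlonglongrightarrow> walk_density l \<pi>"
    and "walk_density l \<pi> \<ge> 0"
proof -
  note v = crossings_nvert[OF assms]
  show L: "(\<lambda>b. real (card (int_walks b (2 * l) \<pi>)) / (2 * real b + 1) ^ (l - 2)) \<longlonglongrightarrow> walk_density l \<pi>"
    unfolding walk_density_def convergent_LIMSEQ_iff[symmetric]
    by (rule int_walks_convergent[OF v(1) _ v(2)]) (use v(3) in simp)
  show "walk_density l \<pi> \<ge> 0" by (rule LIMSEQ_le_const[OF L]) (auto intro!: exI[of _ 0])
qed

lemma walk_density_sum_pos:
  assumes l: "l \<ge> 2"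
  shows "(\<Sum>\<pi>\<in>crossings l. walk_density l \<pi>) > 0"
proof (rule sum_pos2)
  show c: "cross_pairing l \<in> crossings l" using cross_pairing[OF l] by (simp add: crossings_def)
  have "1 \<le> walk_density l (cross_pairing l)"
  proof (rule LIMSEQ_le_const[OF walk_density(1)[OF c]], intro exI allI impI)
    fix b
    have "real ((2 * b + 1) ^ (l - 2)) \<le> real (card (int_walks b (2 * l) (cross_pairing l)))"
      by (rule of_nat_mono[OF card_int_walks_cross_pairing[OF l]])
    then show "1 \<le> real (card (int_walks b (2 * l) (cross_pairing l))) / (2 * real b + 1) ^ (l - 2)"
      by (simp add: le_divide_eq add.commute)
  qed
  then show "0 < walk_density l (cross_pairing l)" by simp
qed (auto intro: walk_density(2))

text \<open>Separates the dependence on \<open>N\<close>, the factor \<open>N / (2 b + 1)^2\<close>,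
  from a factor that depends on \<open>b\<close> alone and converges.\<close>

lemma cross_sum_int:
  assumes "2 * (2 * l) * b + b < N" "l > 0"
  shows "cross_sum N b l s = s ^ l * (real N / (2 * real b + 1) ^ 2) *
    (\<Sum>\<pi>\<in>crossings l. real (card (int_walks b (2 * l) \<pi>)) / (2 * real b + 1) ^ (l - 2))"
proof -
  have "b \<le> l * b" using assms(2) by simp
  then have "2 * b + 1 \<le> N" using assms(1) by linarith
  then have \<xi>: "real (band_norm N b) = 2 * real b + 1" by (simp add: band_norm_def)
  have "s ^ l / (2 * real b + 1) ^ l * real (card (band_walks N b (2 * l) \<pi>)) =
    s ^ l * (real N / (2 * real b + 1) ^ 2) * (real (card (int_walks b (2 * l) \<pi>)) / (2 * real b + 1) ^ (l - 2))"
    if "\<pi> \<in> crossings l" for \<pi>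
  proof -
    note v = crossings_nvert[OF that]
    have "(2 * real b + 1) ^ l = (2 * real b + 1) ^ 2 * (2 * real b + 1) ^ (l - 2)"
      using v(3) by (metis power_add le_add_diff_inverse)
    then show ?thesis using card_band_walks_int[OF _ assms(1) v(1)] assms(2) by simp
  qed
  then show ?thesis unfolding cross_sum_def \<xi> sum_distrib_left by (intro sum.cong refl)
qed

lemma band_ratio:
  assumes "N > 0"
  shows "real N / (2 * real b + 1) ^ 2 = inverse ((2 * (real b / sqrt (real N)) + 1 / sqrt (real N))\<^sup>2)"
proof -
  have "2 * (real b / sqrt (real N)) + 1 / sqrt (real N) = (2 * real b + 1) / sqrt (real N)" by (simp add: add_divide_distrib)
  then show ?thesis using assms by (simp add: power_divide)
qed

lemma inverse_sqrt_tendsto: "(\<lambda>N. 1 / sqrt (real N)) \<longlonglongrightarrow> 0"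
  by real_asymp

text \<open>The normalization is \<open>2 b + 1\<close> or \<open>N\<close>, and the ratio is
  accordingly controlled by \<open>b / sqrt N\<close> or equal to \<open>1 / N\<close>. As
  \<open>N\<close> may switch between the cases infinitely often, the sum of both bounds is
  used.\<close>

lemma wide_band_ratio:
  assumes r: "filterlim (\<lambda>N. real (b N) / sqrt (real N)) at_top sequentially"
  shows "(\<lambda>N. real N / real (band_norm N (b N)) ^ 2) \<longlonglongrightarrow> 0"
proof -
  let ?q = "\<lambda>N. 2 * (real (b N) / sqrt (real N)) + 1 / sqrt (real N)"
  have "filterlim ?q at_top sequentially"
  proof (rule filterlim_at_top_mono[OF r], intro always_eventually allI)
    fix N
    have "0 \<le> real (b N) / sqrt (real N)" "0 \<le> 1 / sqrt (real N)" by simp_all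
    then show "real (b N) / sqrt (real N) \<le> ?q N" by linarith
  qed
  then have "(\<lambda>N. (inverse (?q N))\<^sup>2) \<longlonglongrightarrow> 0\<^sup>2"
    by (intro tendsto_power tendsto_inverse_0_at_top)
  moreover have "(\<lambda>N. 1 / real N) \<longlonglongrightarrow> 0" by real_asymp
  ultimately have "(\<lambda>N. (inverse (?q N))\<^sup>2 + 1 / real N) \<longlonglongrightarrow> 0\<^sup>2 + 0" by (rule tendsto_add)
  then have up: "(\<lambda>N. (inverse (?q N))\<^sup>2 + 1 / real N) \<longlonglongrightarrow> 0" by simp
  have "eventually (\<lambda>N. real N / real (band_norm N (b N)) ^ 2 \<le> (inverse (?q N))\<^sup>2 + 1 / real N) sequentially"
    using eventually_gt_at_top[of 0]
  proof eventually_elim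
    case (elim N)
    show ?case
    proof (cases "2 * b N + 1 \<le> N")
      case True
      then have "real (band_norm N (b N)) = 2 * real (b N) + 1" by (simp add: band_norm_def)
      then show ?thesis using band_ratio[OF elim, of "b N"] by (simp add: power_inverse)
    next
      case False
      then have "real (band_norm N (b N)) = real N" by (simp add: band_norm_def)
      then show ?thesis using elim by (simp add: power2_eq_square)
    qed
  qed
  then show ?thesis by (rule tendsto_sandwich[OF _ _ tendsto_const up, rotated]) simp
qed

text \<open>\<open>c = 0\<close> is included, so that the subcritical and the critical regime share
  one formula. In both \<open>b / N\<close> tends to \<open>0\<close>, and the walks eventually
  lift.\<close>

lemma narrow_band:
  assumes b: "filterlim b at_top sequentially" and r: "(\<lambda>N. real (b N) / sqrt (real N)) \<longlonglongrightarrow> c" and l: "l > 0"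
  shows "eventually (\<lambda>N. cross_sum N (b N) l s = inverse ((2 * (real (b N) / sqrt (real N)) + 1 / sqrt (real N))\<^sup>2) *
      (s ^ l * (\<Sum>\<pi>\<in>crossings l. real (card (int_walks (b N) (2 * l) \<pi>)) / (2 * real (b N) + 1) ^ (l - 2)))) sequentially"
    and "(\<lambda>N. s ^ l * (\<Sum>\<pi>\<in>crossings l. real (card (int_walks (b N) (2 * l) \<pi>)) / (2 * real (b N) + 1) ^ (l - 2)))
      \<longlonglongrightarrow> s ^ l * (\<Sum>\<pi>\<in>crossings l. walk_density l \<pi>)"
proof -
  have "(\<lambda>N. real (b N) / sqrt (real N) * (1 / sqrt (real N))) \<longlonglongrightarrow> c * 0"
    by (intro tendsto_mult r inverse_sqrt_tendsto)
  then have "(\<lambda>N. real (b N) / real N) \<longlonglongrightarrow> 0" by simp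
  \<comment> \<open>\<open>4 * l + 1\<close> is the factor of \<open>b\<close> in the lifting
    condition \<open>2 * (2 * l) * b + b < N\<close>.\<close>
  then have "eventually (\<lambda>N. real (b N) / real N < 1 / (4 * real l + 1)) sequentially" by (rule order_tendstoD) simp
  then show "eventually (\<lambda>N. cross_sum N (b N) l s = inverse ((2 * (real (b N) / sqrt (real N)) + 1 / sqrt (real N))\<^sup>2) *
      (s ^ l * (\<Sum>\<pi>\<in>crossings l. real (card (int_walks (b N) (2 * l) \<pi>)) / (2 * real (b N) + 1) ^ (l - 2)))) sequentially"
    using eventually_gt_at_top[of 0]
  proof eventually_elim
    case (elim N)
    then have "real (2 * (2 * l) * b N + b N) < real N" by (simp add: field_simps)
    then have "2 * (2 * l) * b N + b N < N" by (simp only: of_nat_less_iff)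
    then show ?case using cross_sum_int[of l "b N" N s] l band_ratio[OF elim(2), of "b N"] by (simp add: mult.left_commute)
  qed
  show "(\<lambda>N. s ^ l * (\<Sum>\<pi>\<in>crossings l. real (card (int_walks (b N) (2 * l) \<pi>)) / (2 * real (b N) + 1) ^ (l - 2)))
      \<longlonglongrightarrow> s ^ l * (\<Sum>\<pi>\<in>crossings l. walk_density l \<pi>)"
    by (intro tendsto_mult tendsto_const tendsto_sum filterlim_compose[OF walk_density(1) b])
qed

section \<open>Integrability, and the type \<open>B\<close> laws of wide band matrices and of the
  GUE\<close>

lemma GUE_entry_integrable:
  assumes "is_GUE M N s X" "s > 0" "j < N" "k < N"
  shows "integrable M (\<lambda>\<omega>. cmod (X \<omega> $$ (j, k)) ^ p)"
proof -
  have "integrable M (\<lambda>\<omega>. \<Prod>i<p. X \<omega> $$ (j, k))"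
    by (rule GUE_wick(1)[OF assms(1,2)]) (use assms in auto)
  then have "integrable M (\<lambda>\<omega>. X \<omega> $$ (j, k) ^ p)" by simp
  then have "integrable M (\<lambda>\<omega>. cmod (X \<omega> $$ (j, k) ^ p))" by (rule integrable_norm)
  then show ?thesis by (simp add: norm_power)
qed

lemma wband_random:
  assumes G: "is_GUE M N s X" "s > 0"
  shows "random_selfadjoint M N (\<lambda>\<omega>. wband N b c (X \<omega>))"
    and "j < N \<Longrightarrow> k < N \<Longrightarrow> integrable M (\<lambda>\<omega>. cmod (wband N b c (X \<omega>) $$ (j, k)) ^ p)"
proof -
  have X: "random_selfadjoint M N X" using G by (simp add: is_GUE_def)
  have e: "wband N b c A $$ (j, k) = complex_of_real c * (if cyclic_dist N j k \<le> int b then A $$ (j, k) else 0)"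
    if "j < N" "k < N" for A j k using that by (simp add: wband_def)
  have "mat_adjoint (wband N b c (X \<omega>)) = wband N b c (X \<omega>)" if \<omega>: "\<omega> \<in> space M" for \<omega>
  proof (rule eq_matI)
    fix i j assume "i < dim_row (wband N b c (X \<omega>))" "j < dim_col (wband N b c (X \<omega>))"
    then have ij: "i < N" "j < N" by (auto simp: wband_def)
    have "X \<omega> $$ (i, j) = cnj (X \<omega> $$ (j, i))"
      using X \<omega> ij by (intro mat_adjoint_index) (auto simp: random_selfadjoint_def)
    then show "mat_adjoint (wband N b c (X \<omega>)) $$ (i, j) = wband N b c (X \<omega>) $$ (i, j)"
      unfolding mat_adjoint_entry[OF wband_carrier ij] e[OF ij] e[OF ij(2,1)] by (simp add: cyclic_dist_sym)
  qed (simp_all add: mat_adjoint_def wband_def)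
  moreover have "(\<lambda>\<omega>. wband N b c (X \<omega>) $$ (j, k)) \<in> borel_measurable M" if "j < N" "k < N" for j k
  proof -
    have "(\<lambda>\<omega>. X \<omega> $$ (j, k)) \<in> borel_measurable M" using X that by (simp add: random_selfadjoint_def)
    then show ?thesis unfolding e[OF that] by (cases "cyclic_dist N j k \<le> int b") auto
  qed
  ultimately show "random_selfadjoint M N (\<lambda>\<omega>. wband N b c (X \<omega>))"
    using X by (simp add: random_selfadjoint_def)
  assume jk: "j < N" "k < N"
  have "cmod (wband N b c (X \<omega>) $$ (j, k)) ^ p =
    (\<bar>c\<bar> * of_bool (cyclic_dist N j k \<le> int b)) ^ p * cmod (X \<omega> $$ (j, k)) ^ p" for \<omega>
    unfolding e[OF jk] by (simp add: norm_mult flip: power_mult_distrib)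
  then show "integrable M (\<lambda>\<omega>. cmod (wband N b c (X \<omega>) $$ (j, k)) ^ p)"
    using GUE_entry_integrable[OF G jk] by simp
qed

lemma trace_pow_0: "A \<in> carrier_mat N N \<Longrightarrow> mat_trace (A ^\<^sub>m 0) = of_nat N"
  by (simp add: mat_trace_def)

lemma band_trace_limits:
  assumes s: "s > 0" and G: "\<And>N. N > 0 \<Longrightarrow> is_GUE (M N) N (s' N) (X N)"
    and s': "\<And>N. N > 0 \<Longrightarrow> s' N > 0" and c: "\<And>N. N > 0 \<Longrightarrow> (c N)\<^sup>2 * s' N = s / real (band_norm N (b N))"
    and r: "(\<lambda>N. real N / real (band_norm N (b N)) ^ 2) \<longlonglongrightarrow> 0"
  shows "N > 0 \<Longrightarrow> integrable (M N) (\<lambda>\<omega>. mat_trace (wband N (b N) (c N) (X N \<omega>) ^\<^sub>m i))"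
    and "(\<lambda>N. (\<integral>\<omega>. mat_trace (wband N (b N) (c N) (X N \<omega>) ^\<^sub>m i) \<partial>M N) - of_nat N * complex_of_real (sc_moment s i)) \<longlonglongrightarrow> 0"
proof -
  have P: "prob_space (M N)" if "N > 0" for N using G[OF that] by (simp add: is_GUE_def random_selfadjoint_def)
  show "integrable (M N) (\<lambda>\<omega>. mat_trace (wband N (b N) (c N) (X N \<omega>) ^\<^sub>m i))" if N: "N > 0" for N
  proof (cases "i = 0")
    case True
    interpret prob_space "M N" by (rule P[OF N])
    show ?thesis unfolding True trace_pow_0[OF wband_carrier] by simp
  next
    case False then show ?thesis by (intro trace_moment_pairings(1)[OF G[OF N] s'[OF N]]) simp
  qed
  \<comment> \<open>The trace of the zeroth power is exactly \<open>N\<close>, odd traces have mean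
    zero, and for positive even \<open>i\<close> the Catalan terms cancel.\<close>
  have E: "(\<integral>\<omega>. mat_trace (wband N (b N) (c N) (X N \<omega>) ^\<^sub>m i) \<partial>M N) - of_nat N * complex_of_real (sc_moment s i) =
      (if even i \<and> i > 0 then complex_of_real (cross_sum N (b N) (i div 2) s) else 0)" if N: "N > 0" for N
  proof (cases "even i")
    case False
    then show ?thesis using trace_moment_odd[OF G[OF N] s'[OF N]] by (simp add: sc_moment_def[OF s])
  next
    case True
    then obtain l where l: "i = 2 * l" by (elim evenE)
    show ?thesis
    proof (cases "l = 0")
      case l0: True
      interpret prob_space "M N" by (rule P[OF N])
      have "i = 0" using l l0 by simp
      then show ?thesis unfolding \<open>i = 0\<close> trace_pow_0[OF wband_carrier] by (simp add: sc_moment_def[OF s] prob_space)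
    next
      case False
      then show ?thesis using trace_moment_cross_sum[OF G[OF N] s'[OF N] N _ c[OF N], of l]
        by (simp add: l sc_moment_def[OF s] mult.assoc)
    qed
  qed
  have "(\<lambda>N. if even i \<and> i > 0 then complex_of_real (cross_sum N (b N) (i div 2) s) else 0) \<longlonglongrightarrow> 0"
  proof (cases "even i \<and> i > 0")
    case True
    have "(\<lambda>N. complex_of_real (cross_sum N (b N) (i div 2) s)) \<longlonglongrightarrow> complex_of_real 0"
      by (intro tendsto_of_real cross_sum_tendsto_0[OF s r])
    then show ?thesis using True by simp
  qed auto
  then show "(\<lambda>N. (\<integral>\<omega>. mat_trace (wband N (b N) (c N) (X N \<omega>) ^\<^sub>m i) \<partial>M N) - of_nat N * complex_of_real (sc_moment s i)) \<longlonglongrightarrow> 0"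
    by (rule Lim_transform_eventually) (rule eventually_mono[OF eventually_gt_at_top[of 0]], simp only: E)
qed

lemma periodic_band_wband: "periodic_band N b A = wband N b (1 / sqrt (real (band_norm N b))) A"
  by (simp add: periodic_band_def wband_def)

lemma wband_full:
  assumes "A \<in> carrier_mat N N"
  shows "wband N N 1 A = A"
proof (rule eq_matI)
  fix i j assume "i < dim_row A" "j < dim_col A"
  then have ij: "i < N" "j < N" using assms by auto
  then have "cyclic_dist N i j \<le> int N" by (auto simp: cyclic_dist_def)
  then show "wband N N 1 A $$ (i, j) = A $$ (i, j)" using ij by (simp add: wband_def)
qed (use assms in \<open>auto simp: wband_def\<close>)

lemma type_B_law_periodic_band:
  assumes s: "s > 0" and G: "\<And>N. N > 0 \<Longrightarrow> is_GUE (M N) N s (X N)"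
    and r: "filterlim (\<lambda>N. real (b N) / sqrt (real N)) at_top sequentially"
  shows "type_B_law M (\<lambda>N \<omega>. periodic_band N (b N) (X N \<omega>)) (semicircle s) zero_signed"
proof -
  have c: "(1 / sqrt (real (band_norm N (b N))))\<^sup>2 * s = s / real (band_norm N (b N))" for N
    by (simp add: power_divide)
  show ?thesis unfolding periodic_band_wband
  proof (rule type_B_law_semicircle[OF s])
    show "N > 0 \<Longrightarrow> random_selfadjoint (M N) N (\<lambda>\<omega>. wband N (b N) (1 / sqrt (real (band_norm N (b N)))) (X N \<omega>))" for N
      by (rule wband_random(1)[OF G s])
    show "N > 0 \<Longrightarrow> j < N \<Longrightarrow> k < N \<Longrightarrow>
        integrable (M N) (\<lambda>\<omega>. cmod (wband N (b N) (1 / sqrt (real (band_norm N (b N)))) (X N \<omega>) $$ (j, k)) ^ p)" for N j k p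
      by (rule wband_random(2)[OF G s])
  qed (rule band_trace_limits[OF s G s c wide_band_ratio[OF r]]; assumption)+
qed

text \<open>A GUE matrix of variance \<open>s / N\<close> is a band matrix of width \<open>N\<close>
  with factor \<open>1\<close>; there \<open>\<xi> = N\<close>, and
  \<open>N / \<xi>^2 = 1 / N\<close> tends to \<open>0\<close>.\<close>

lemma type_B_law_GUE:
  assumes s: "s > 0" and G: "\<And>N. N > 0 \<Longrightarrow> is_GUE (M N) N (s / real N) (W N)"
  shows "type_B_law M W (semicircle s) zero_signed"
proof (rule type_B_law_semicircle[OF s])
  have sa: "random_selfadjoint (M N) N (W N)" if "N > 0" for N using G[OF that] by (simp add: is_GUE_def)
  then show "N > 0 \<Longrightarrow> random_selfadjoint (M N) N (W N)" for N .
  have sN: "s / real N > 0" if "N > 0" for N using s that by simp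
  show "integrable (M N) (\<lambda>\<omega>. cmod (W N \<omega> $$ (j, k)) ^ p)" if "N > 0" "j < N" "k < N" for N j k p
    by (rule GUE_entry_integrable[OF G[OF that(1)] sN[OF that(1)] that(2,3)])
  have bn: "band_norm N N = N" for N by (simp add: band_norm_def)
  have "(\<lambda>N. 1 / real N) \<longlonglongrightarrow> 0" by real_asymp
  moreover have "real N / real (band_norm N N) ^ 2 = 1 / real N" for N by (simp add: bn power2_eq_square)
  ultimately have r: "(\<lambda>N. real N / real (band_norm N N) ^ 2) \<longlonglongrightarrow> 0" by simp
  have c: "1\<^sup>2 * (s / real N) = s / real (band_norm N N)" for N by (simp add: bn)
  have lim1: "integrable (M N) (\<lambda>\<omega>. mat_trace (wband N N 1 (W N \<omega>) ^\<^sub>m i))" if "N > 0" for N i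
    by (rule band_trace_limits(1)[OF s G sN c r that])
  have lim2: "(\<lambda>N. (\<integral>\<omega>. mat_trace (wband N N 1 (W N \<omega>) ^\<^sub>m i) \<partial>M N) - of_nat N * complex_of_real (sc_moment s i)) \<longlonglongrightarrow> 0" for i
    by (rule band_trace_limits(2)[OF s G sN c r])
  have full: "wband N N 1 (W N \<omega>) = W N \<omega>" if "N > 0" "\<omega> \<in> space (M N)" for N \<omega>
    using sa[OF that(1)] that(2) by (intro wband_full) (simp add: random_selfadjoint_def)
  show "integrable (M N) (\<lambda>\<omega>. mat_trace (W N \<omega> ^\<^sub>m i))" if N: "N > 0" for N i
    by (rule Bochner_Integration.integrable_cong[THEN iffD1, OF refl _ lim1[OF N]]) (simp add: full[OF N])
  have I: "(\<integral>\<omega>. mat_trace (wband N N 1 (W N \<omega>) ^\<^sub>m i) \<partial>M N) = (\<integral>\<omega>. mat_trace (W N \<omega> ^\<^sub>m i) \<partial>M N)" if N: "N > 0" for N i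
    by (rule Bochner_Integration.integral_cong[OF refl]) (simp add: full[OF N])
  show "(\<lambda>N. (\<integral>\<omega>. mat_trace (W N \<omega> ^\<^sub>m i) \<partial>M N) - of_nat N * complex_of_real (sc_moment s i)) \<longlonglongrightarrow> 0" for i
    by (rule Lim_transform_eventually[OF lim2[of i]])
      (rule eventually_mono[OF eventually_gt_at_top[of 0]], simp add: I)
qed

lemma moment_defect_cross_sum:
  assumes "is_GUE M N s X" "s > 0" "N > 0" "l > 0"
  shows "moment_defect M N s (\<lambda>\<omega>. periodic_band N b (X \<omega>)) l = cross_sum N b l s"
proof -
  have c: "(1 / sqrt (real (band_norm N b)))\<^sup>2 * s = s / real (band_norm N b)"
    by (simp add: power_divide)
  show ?thesis
    unfolding moment_defect_def periodic_band_wband trace_moment_cross_sum[OF assms c] by simp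
qed

text \<open>In the narrow regime \<open>l = 1\<close> is set apart: two steps admit no crossing, so
  the second moment is exactly \<open>N * s2\<close> for every band width, and its defect cannot
  diverge.\<close>

theorem theorem1p17:
  "\<exists>m :: nat \<Rightarrow> real \<Rightarrow> real \<Rightarrow> real.
     (\<forall>s2>0. \<forall>c>0. m 2 s2 c = 0 \<and> (\<forall>l\<ge>2. m (2 * l) s2 c > 0)) \<and>
     (\<forall>(s2::real) (b :: nat \<Rightarrow> nat) (M :: nat \<Rightarrow> 'a measure) (X :: nat \<Rightarrow> 'a \<Rightarrow> complex mat).
        s2 > 0 \<longrightarrow>
        filterlim b at_top sequentially \<longrightarrow>
        (\<forall>N>0. is_GUE (M N) N s2 (X N)) \<longrightarrow>
        (let \<Xi> = (\<lambda>N \<omega>. periodic_band N (b N) (X N \<omega>));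
             D = (\<lambda>l N. moment_defect (M N) N s2 (\<Xi> N) l);
             r = (\<lambda>N. real (b N) / sqrt (real N))
         in (filterlim r at_top sequentially \<longrightarrow>
               (\<forall>l\<ge>1. D l \<longlonglongrightarrow> 0)) \<and>
            (r \<longlonglongrightarrow> 0 \<longrightarrow>
               (\<forall>l\<ge>2. filterlim (D l) at_top sequentially) \<and> D 1 \<longlonglongrightarrow> 0) \<and>
            (\<forall>c>0. r \<longlonglongrightarrow> c \<longrightarrow>
               (\<forall>l\<ge>1. D l \<longlonglongrightarrow> m (2 * l) s2 c)) \<and>
            (filterlim r at_top sequentially \<longrightarrow>
               type_B_law M \<Xi> (semicircle s2) zero_signed \<and>
               (\<forall>(M' :: nat \<Rightarrow> 'b measure) (W :: nat \<Rightarrow> 'b \<Rightarrow> complex mat).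
                  (\<forall>N>0. is_GUE (M' N) N (s2 / real N) (W N)) \<longrightarrow>
                  type_B_law M' W (semicircle s2) zero_signed))))"
\<comment> \<open>\<open>m\<close> is indexed by the order \<open>2 l\<close> of the moment, whence
  \<open>j div 2\<close>; \<open>inverse ((2 * c)^2)\<close> is the limit of
  \<open>N / (2 b + 1)^2\<close>.\<close>
proof (rule exI[where x = "\<lambda>j s c. inverse ((2 * c)\<^sup>2) * (s ^ (j div 2) * (\<Sum>\<pi>\<in>crossings (j div 2). walk_density (j div 2) \<pi>))"],
    intro conjI allI impI, goal_cases)
  case (1 s c)
  then show ?case by (simp add: crossings_small)
next
  case (2 s c l)
  have "0 < inverse ((2 * c)\<^sup>2) * (s ^ l * (\<Sum>\<pi>\<in>crossings l. walk_density l \<pi>))"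
    using 2 by (intro mult_pos_pos walk_density_sum_pos) auto
  then show ?case by simp
next
  case (3 s b M X)
  note s = 3(1) and b = 3(2) and G = 3(3)[rule_format]
  let ?r = "\<lambda>N. real (b N) / sqrt (real N)"
  define D where "D l N = moment_defect (M N) N s (\<lambda>\<omega>. periodic_band N (b N) (X N \<omega>)) l" for l N
  have ev: "eventually (\<lambda>N. cross_sum N (b N) l s = D l N) sequentially" if "l \<ge> 1" for l
    using eventually_gt_at_top[of 0]
  proof eventually_elim
    case (elim N)
    then show ?case unfolding D_def using moment_defect_cross_sum[OF G s, of N l "b N"] that by simp
  qed
  have wide: "D l \<longlonglongrightarrow> 0" if "filterlim ?r at_top sequentially" "l \<ge> 1" for l
    by (rule Lim_transform_eventually[OF cross_sum_tendsto_0[OF s wide_band_ratio[OF that(1)]] ev[OF that(2)]])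
  have D1: "D 1 \<longlonglongrightarrow> 0"
    by (rule Lim_transform_eventually[OF _ ev[of 1]]) (simp_all add: cross_sum_def crossings_small)
  have q: "(\<lambda>N. (2 * ?r N + 1 / sqrt (real N))\<^sup>2) \<longlonglongrightarrow> (2 * c + 0)\<^sup>2" if "?r \<longlonglongrightarrow> c" for c
    by (intro tendsto_intros that inverse_sqrt_tendsto)
  have critical: "D l \<longlonglongrightarrow> inverse ((2 * c)\<^sup>2) * (s ^ l * (\<Sum>\<pi>\<in>crossings l. walk_density l \<pi>))"
    if "?r \<longlonglongrightarrow> c" "c > 0" "l \<ge> 1" for c l
  proof -
    have "(\<lambda>N. inverse ((2 * ?r N + 1 / sqrt (real N))\<^sup>2)) \<longlonglongrightarrow> inverse ((2 * c + 0)\<^sup>2)"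
      using that by (intro tendsto_inverse q) auto
    then have "(\<lambda>N. inverse ((2 * ?r N + 1 / sqrt (real N))\<^sup>2) *
        (s ^ l * (\<Sum>\<pi>\<in>crossings l. real (card (int_walks (b N) (2 * l) \<pi>)) / (2 * real (b N) + 1) ^ (l - 2))))
        \<longlonglongrightarrow> inverse ((2 * c + 0)\<^sup>2) * (s ^ l * (\<Sum>\<pi>\<in>crossings l. walk_density l \<pi>))"
      by (intro tendsto_mult narrow_band(2)[OF b that(1)]) (use that in auto)
    moreover have "eventually (\<lambda>N. inverse ((2 * ?r N + 1 / sqrt (real N))\<^sup>2) *
        (s ^ l * (\<Sum>\<pi>\<in>crossings l. real (card (int_walks (b N) (2 * l) \<pi>)) / (2 * real (b N) + 1) ^ (l - 2))) = D l N) sequentially"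
      using narrow_band(1)[OF b that(1), of l s] ev[OF that(3)] that(3) by (auto elim: eventually_elim2)
    ultimately show ?thesis by (auto intro: Lim_transform_eventually)
  qed
  \<comment> \<open>As \<open>b / sqrt N\<close> tends to \<open>0\<close>, the factor
    \<open>N / (2 b + 1)^2\<close> tends to infinity, while the other factor has a positive limit
    because \<open>l \<ge> 2\<close> admits a crossing.\<close>
  have narrow: "filterlim (D l) at_top sequentially" if r: "?r \<longlonglongrightarrow> 0" and l: "l \<ge> 2" for l
  proof -
    have "eventually (\<lambda>N. (2 * ?r N + 1 / sqrt (real N))\<^sup>2 > 0) sequentially"
      using eventually_gt_at_top[of 0]
    proof eventually_elim
      case (elim N)
      then have "0 < 2 * ?r N + 1 / sqrt (real N)" by (intro add_nonneg_pos) auto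
      then show ?case by simp
    qed
    then have "filterlim (\<lambda>N. inverse ((2 * ?r N + 1 / sqrt (real N))\<^sup>2)) at_top sequentially"
      using q[OF r] by (intro filterlim_inverse_at_top) auto
    moreover have "0 < s ^ l * (\<Sum>\<pi>\<in>crossings l. walk_density l \<pi>)"
      using s by (intro mult_pos_pos walk_density_sum_pos[OF l]) auto
    ultimately have "filterlim (\<lambda>N. (s ^ l * (\<Sum>\<pi>\<in>crossings l. real (card (int_walks (b N) (2 * l) \<pi>)) / (2 * real (b N) + 1) ^ (l - 2))) *
        inverse ((2 * ?r N + 1 / sqrt (real N))\<^sup>2)) at_top sequentially"
      using l by (intro filterlim_tendsto_pos_mult_at_top[OF narrow_band(2)[OF b r]]) auto
    moreover have "eventually (\<lambda>N. (s ^ l * (\<Sum>\<pi>\<in>crossings l. real (card (int_walks (b N) (2 * l) \<pi>)) / (2 * real (b N) + 1) ^ (l - 2))) *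
        inverse ((2 * ?r N + 1 / sqrt (real N))\<^sup>2) = D l N) sequentially"
    proof -
      have "l > 0" "l \<ge> 1" using l by auto
      from narrow_band(1)[OF b r this(1), of s] ev[OF this(2)] show ?thesis
        by eventually_elim (metis mult.commute)
    qed
    ultimately show ?thesis by (rule filterlim_cong[THEN iffD1, OF refl refl, rotated])
  qed
  have tb: "type_B_law M (\<lambda>N \<omega>. periodic_band N (b N) (X N \<omega>)) (semicircle s) zero_signed"
    if "filterlim ?r at_top sequentially"
    using G by (rule type_B_law_periodic_band[OF s _ that])
  have gue: "type_B_law M' W (semicircle s) zero_signed"
    if "\<forall>N>0. is_GUE (M' N) N (s / real N) (W N)" for M' :: "nat \<Rightarrow> 'b measure" and W
    using that by (intro type_B_law_GUE[OF s]) auto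
  show ?case
    unfolding Let_def D_def[symmetric]
    using wide D1 critical narrow tb gue by auto
qed

end
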